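(* Let $0<\underline\beta<\overline\beta$. There exists a positive constant $C_{\underline\beta,\overline\beta}$ such that the following holds. Let $n\ge2$, and let $\hat P=\hat P_\delta$ be a $\rho$-estimator on $\mathscr Q_\delta=\bigcup_{K=2}^n\mathscr G_{K,\delta(K)}$ with $\delta(K)=\frac Vn\wedge\frac1K$ and penalty $$\mathrm{pen}(q)=\kappa\inf_{K\in\{2,\dots,n\}:\,Q\in\mathscr G_K}\left[174.1\,KV\left[5.82+\log\left(\frac{(K+1)^2}{\delta(K)}\right)+\log_+\left(\frac n{KV}\right)\right]+K\right],$$ where $Q$ is the distribution with density $q$. For any $\beta\in[\underline\beta,\overline\beta]$ and any $p\in\mathcal H(\beta,\mathcal P(\underline\beta,\overline\beta))$, if $X_1,\dots,X_n$ are i.i.d. with distribution $P^*$ having density $p$ with respect to Lebesgue measure, then for all $\xi>0$, with probability at least $1-e^{-\xi}$, $$h^2(P^*,\hat P)\le C_{\underline\beta,\overline\beta}\left(\frac{(\log n)^{\frac{5\beta}{2\beta+1}}}{n^{\frac{2\beta}{2\beta+1}}}+\frac\xi n\right).$$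
   Context: $h^2(Q,Q')=\frac12\int(\sqrt{dQ/d\nu}-\sqrt{dQ'/d\nu})^2d\nu$ is the squared Hellinger distance; $h^2(P,\mathscr A)=\inf_{Q\in\mathscr A}h^2(P,Q)$; $\log_+(x)=\max(\log x,0)$, $a\wedge b=\min(a,b)$, $a\vee b=\max(a,b)$. Gaussian mixtures. $\phi_\sigma(x)=\frac1{\sqrt{2\pi\sigma^2}}e^{-x^2/(2\sigma^2)}$, $\mathcal G=\{\phi_\sigma(\cdot-z):z\in\mathbb R,\sigma>0\}$, and $V$ is the VC-index of $\mathcal G$ (smallest integer $m\ge1$ such that no $m$-point set is shattered by the subgraphs $\{(x,t):t<f(x)\}$, $f\in\mathcal G$). With $\mathcal W_K=\{w\in[0,1]^K:\sum_kw_k=1\}$, $\mathscr G_K$ is the set of distributions $\sum_{k=1}^Kw_k\mathcal N(z_k,\sigma_k^2)$, $w\in\mathcal W_K$, $z_k\in\mathbb R$, $\sigma_k>0$; $\mathscr G_{K,\delta}$ is the subset of mixtures with $w_k\ge\delta$, $w_k\in\mathbb Q$ and components in a fixed at most countable Hellinger-dense subset of the Gaussian location-scale family. $\mathcal Q_\delta$ is the set of Lebesgue densities of $\mathscr Q_\delta$. Class $\mathcal H(\beta,\mathcal P)$. Let $\beta>0$, $r=\lfloor\beta\rfloor$ and $\mathcal P=(\gamma,l^+,L,\epsilon,C,\alpha,\xi_0,M)$, where $L$ is a polynomial function on $\mathbb R$ and the other entries are positive constants. $\mathcal H(\beta,\mathcal P)$ is the set of probability densities $p$ on $\mathbb R$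 such that: (i) for all $x,y$ with $|y-x|\le\gamma$, $|(\log p)^{(r)}(x)-(\log p)^{(r)}(y)|\le r!\,L(x)|y-x|^{\beta-r}$, and $|(\log p)^{(j)}(0)|\le l^+$ for all $j\in\{0,\dots,r\}$; (ii) $\max_{1\le j\le r}\int_{\mathbb R}|(\log p)^{(j)}(x)|^{\frac{2\beta+\epsilon}j}p(x)dx\ \vee\ \int_{\mathbb R}|L(x)|^{2+\frac\epsilon\beta}p(x)dx\le C$; (iii) $p(x)\le M\psi_0(x)$ for all $x\in\mathbb R$, where $\psi_0(x)=\pi^{-1/2}e^{-x^2}$; (iv) $p$ is strictly positive, non-decreasing on $(-\infty,-\alpha)$, non-increasing on $(\alpha,\infty)$, and $p(x)\ge\xi_0$ for all $x\in[-\alpha,\alpha]$. $\mathcal P(\underline\beta,\overline\beta)$ denotes a fixed parameter set for which there is a positive constant $c_{\underline\beta,\overline\beta}$ such that for all $\beta\in[\underline\beta,\overline\beta]$, all $p\in\mathcal H(\beta,\mathcal P(\underline\beta,\overline\beta))$ (with associated distribution $P$) and all $K\ge 2$, $h^2(P,\mathscr G_K)\le c_{\underline\beta,\overline\beta}\frac{(\log K)^{3\beta}}{K^{2\beta}}$; the existence of such a parameter set is a known result of Maugis and Michel. The constant $C_{\underline\beta,\overline\beta}$ may depend on $\underline\beta,\overline\beta$ (through this fixed choice). Penalized $\rho$-estimator. With $\mathbf X=(X_1,\dots,X_n)$, let $\psi(x)=\frac{x-1}{x+1}$ on $[0,+\infty]$ ($\psi(+\infty)=1$), $\mathbf T(\mathbf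 X,q,q')=\sum_{i=1}^n\psi\big(\sqrt{q'(X_i)/q(X_i)}\big)$ (with $0/0=1$, $a/0=+\infty$ for $a>0$) and $\mathbf\Upsilon(\mathbf X,q)=\sup_{q'\in\mathcal Q_\delta}[\mathbf T(\mathbf X,q,q')-\mathrm{pen}(q')]+\mathrm{pen}(q)$. A $\rho$-estimator on $\mathscr Q_\delta$ with penalty $\mathrm{pen}$ is any measurable element of the Hellinger closure of the set of distributions with density $q\in\mathcal Q_\delta$ such that $\mathbf\Upsilon(\mathbf X,q)<\inf_{q'\in\mathcal Q_\delta}\mathbf\Upsilon(\mathbf X,q')+8.24$. The numerical constant $\kappa$ is $280\sqrt2+74$. *)

theory Defs
  imports "HOL-Probability.Probability" "HOL-Computational_Algebra.Polynomial"
begin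

section \<open>Hellinger distance\<close>

definition sum_measure :: "'a measure \<Rightarrow> 'a measure \<Rightarrow> 'a measure" where
  "sum_measure Q Q' = measure_of (space Q) (sets Q) (\<lambda>A. emeasure Q A + emeasure Q' A)"

text \<open>The squared Hellinger distance does not depend on the dominating measure; \<open>Q + Q'\<close> is
  taken as the canonical choice, see \<open>hellinger_sq_density\<close> below for the general case.\<close>

definition hellinger_sq :: "'a measure \<Rightarrow> 'a measure \<Rightarrow> real" where
  "hellinger_sq Q Q' = (let \<nu> = sum_measure Q Q' in
     1 / 2 * (\<integral>x. (sqrt (enn2real (RN_deriv \<nu> Q x)) - sqrt (enn2real (RN_deriv \<nu> Q' x)))\<^sup>2 \<partial>\<nu>))"

definition hellinger :: "'a measure \<Rightarrow> 'a measure \<Rightarrow> real" where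
  "hellinger Q Q' = sqrt (hellinger_sq Q Q')"

definition hellinger_sq_set :: "'a measure \<Rightarrow> 'a measure set \<Rightarrow> real" where
  "hellinger_sq_set P A = (INF Q\<in>A. hellinger_sq P Q)"

definition hellinger_closure :: "real measure set \<Rightarrow> real measure set" where
  "hellinger_closure A =
     {R \<in> space (prob_algebra borel). \<forall>e>0. \<exists>Q\<in>A. hellinger R Q < e}"

lemma
  assumes "sets Q' = sets Q"
  shows space_sum_measure: "space (sum_measure Q Q') = space Q"
    and sets_sum_measure: "sets (sum_measure Q Q') = sets Q"
    and emeasure_sum_measure:
      "A \<in> sets Q \<Longrightarrow> emeasure (sum_measure Q Q') A = emeasure Q A + emeasure Q' A"
proof -
  show sp: "space (sum_measure Q Q') = space Q"
    unfolding sum_measure_def by (simp add: space_measure_of_conv)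
  show se: "sets (sum_measure Q Q') = sets Q"
    unfolding sum_measure_def by simp
  assume A: "A \<in> sets Q"
  show "emeasure (sum_measure Q Q') A = emeasure Q A + emeasure Q' A"
  proof (rule emeasure_measure_of[OF sum_measure_def])
    show "sets Q \<subseteq> Pow (space Q)" by (rule sets.space_closed)
    show "A \<in> sets (sum_measure Q Q')" using A se by simp
    show "positive (sets (sum_measure Q Q')) (\<lambda>A. emeasure Q A + emeasure Q' A)"
      by (simp add: positive_def)
    show "countably_additive (sets (sum_measure Q Q')) (\<lambda>A. emeasure Q A + emeasure Q' A)"
      unfolding countably_additive_def se
    proof (intro allI impI)
      fix F :: "nat \<Rightarrow> 'a set"
      assume F: "range F \<subseteq> sets Q" "disjoint_family F"
      show "(\<Sum>i. emeasure Q (F i) + emeasure Q' (F i)) =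
          emeasure Q (\<Union> (range F)) + emeasure Q' (\<Union> (range F))"
        using suminf_emeasure[OF F] suminf_emeasure[of F Q'] F assms
        by (simp add: suminf_add[symmetric] summableI)
    qed
  qed
qed

lemma hellinger_sq_density:
  fixes f g :: "'a \<Rightarrow> real"
  assumes [measurable]: "f \<in> borel_measurable \<nu>" "g \<in> borel_measurable \<nu>"
    and nonneg: "\<And>x. 0 \<le> f x" "\<And>x. 0 \<le> g x"
    and prob: "prob_space (density \<nu> f)" "prob_space (density \<nu> g)"
  shows "hellinger_sq (density \<nu> f) (density \<nu> g) = 1 / 2 * (\<integral>x. (sqrt (f x) - sqrt (g x))\<^sup>2 \<partial>\<nu>)"
proof -
  define s where "s = (\<lambda>x. f x + g x)"
  have [measurable]: "s \<in> borel_measurable \<nu>" unfolding s_def by simp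
  have s0: "0 \<le> s x" for x using nonneg[of x] by (simp add: s_def)
  define \<mu> where "\<mu> = sum_measure (density \<nu> f) (density \<nu> g)"
  have \<mu>: "\<mu> = density \<nu> s"
  proof (rule measure_eqI)
    show "sets \<mu> = sets (density \<nu> s)" unfolding \<mu>_def by (simp add: sets_sum_measure)
    fix A assume "A \<in> sets \<mu>"
    then have A [measurable]: "A \<in> sets \<nu>" unfolding \<mu>_def by (simp add: sets_sum_measure)
    have "emeasure \<mu> A = (\<integral>\<^sup>+x. ennreal (f x) * indicator A x \<partial>\<nu>) + (\<integral>\<^sup>+x. ennreal (g x) * indicator A x \<partial>\<nu>)"
      unfolding \<mu>_def by (simp add: emeasure_sum_measure emeasure_density)
    also have "\<dots> = (\<integral>\<^sup>+x. ennreal (s x) * indicator A x \<partial>\<nu>)"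
      by (subst nn_integral_add[symmetric])
        (auto simp: s_def nonneg ennreal_plus distrib_right intro!: nn_integral_cong)
    finally show "emeasure \<mu> A = emeasure (density \<nu> s) A" by (simp add: emeasure_density)
  qed
  have "emeasure \<mu> (space \<mu>) = 2"
  proof -
    have "emeasure (density \<nu> f) (space \<nu>) = 1" "emeasure (density \<nu> g) (space \<nu>) = 1"
      using prob_space.emeasure_space_1[OF prob(1)] prob_space.emeasure_space_1[OF prob(2)]
      by simp_all
    moreover have "space \<mu> = space \<nu>" unfolding \<mu> by simp
    moreover have "emeasure \<mu> (space \<nu>) =
        emeasure (density \<nu> f) (space \<nu>) + emeasure (density \<nu> g) (space \<nu>)"
      unfolding \<mu>_def by (rule emeasure_sum_measure) auto
    ultimately show ?thesis by simp
  qed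
  then interpret finite_measure \<mu> by (intro finite_measureI) simp
  have RN: "AE x in \<mu>. ennreal (h x / s x) = RN_deriv \<mu> (density \<nu> h) x"
    if h [measurable]: "h \<in> borel_measurable \<nu>" and h0: "\<And>x. 0 \<le> h x" "\<And>x. h x \<le> s x" for h
  proof (rule RN_deriv_unique)
    show "(\<lambda>x. ennreal (h x / s x)) \<in> borel_measurable \<mu>" unfolding \<mu> by simp
    have eq: "ennreal (s x) * ennreal (h x / s x) = ennreal (h x)" for x
      using s0[of x] h0[of x] by (cases "s x = 0") (auto simp: ennreal_mult[symmetric])
    show "density \<mu> (\<lambda>x. ennreal (h x / s x)) = density \<nu> h"
      unfolding \<mu> by (subst density_density_eq) (simp_all add: eq)
  qed
  have "hellinger_sq (density \<nu> f) (density \<nu> g)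
      = 1 / 2 * (\<integral>x. (sqrt (f x / s x) - sqrt (g x / s x))\<^sup>2 \<partial>\<mu>)"
    unfolding hellinger_sq_def Let_def \<mu>_def[symmetric]
  proof (intro arg_cong2[where f="(*)"] refl integral_cong_AE)
    show "AE x in \<mu>. (sqrt (enn2real (RN_deriv \<mu> (density \<nu> f) x)) -
        sqrt (enn2real (RN_deriv \<mu> (density \<nu> g) x)))\<^sup>2 = (sqrt (f x / s x) - sqrt (g x / s x))\<^sup>2"
      using RN[of f] RN[of g]
      by (rule AE_mp[OF _ AE_mp[OF _ AE_I2]])
        (auto simp: s_def nonneg dest!: sym[of "ennreal _"])
    show "(\<lambda>x. (sqrt (f x / s x) - sqrt (g x / s x))\<^sup>2) \<in> borel_measurable \<mu>"
      unfolding \<mu> by simp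
  qed measurable
  also have "(\<integral>x. (sqrt (f x / s x) - sqrt (g x / s x))\<^sup>2 \<partial>\<mu>)
      = (\<integral>x. s x * (sqrt (f x / s x) - sqrt (g x / s x))\<^sup>2 \<partial>\<nu>)"
    unfolding \<mu> by (subst integral_density) (auto simp: s0)
  also have "\<dots> = (\<integral>x. (sqrt (f x) - sqrt (g x))\<^sup>2 \<partial>\<nu>)"
  proof (rule Bochner_Integration.integral_cong[OF refl])
    fix x
    show "s x * (sqrt (f x / s x) - sqrt (g x / s x))\<^sup>2 = (sqrt (f x) - sqrt (g x))\<^sup>2"
    proof (cases "s x = 0")
      case True
      then show ?thesis using nonneg[of x] by (simp add: s_def add_nonneg_eq_0_iff)
    next
      case False
      have "sqrt (f x / s x) - sqrt (g x / s x) = (sqrt (f x) - sqrt (g x)) / sqrt (s x)"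
        by (simp add: real_sqrt_divide diff_divide_distrib)
      then show ?thesis using False s0[of x] by (simp add: power_divide)
    qed
  qed
  finally show ?thesis .
qed

section \<open>Gaussian mixtures\<close>

definition subgraph :: "(real \<Rightarrow> real) \<Rightarrow> (real \<times> real) set" where
  "subgraph f = {(x, t). t < f x}"

definition shatters :: "'a set set \<Rightarrow> 'a set \<Rightarrow> bool" where
  "shatters \<C> S \<longleftrightarrow> (\<forall>A\<subseteq>S. \<exists>B\<in>\<C>. S \<inter> B = A)"

definition vc_index :: "(real \<Rightarrow> real) set \<Rightarrow> nat" where
  "vc_index F = (LEAST m. 1 \<le> m \<and>
     \<not> (\<exists>S. finite S \<and> card S = m \<and> shatters (subgraph ` F) S))"

definition gaussian_vc :: nat where
  "gaussian_vc = vc_index {normal_density z \<sigma> | z \<sigma>. 0 < \<sigma>}"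

definition gaussian :: "real \<Rightarrow> real \<Rightarrow> real measure" where
  "gaussian z \<sigma> = density lborel (normal_density z \<sigma>)"

definition gaussian_family :: "real measure set" where
  "gaussian_family = {gaussian z \<sigma> | z \<sigma>. 0 < \<sigma>}"

definition countable_dense_gaussians :: "real measure set \<Rightarrow> bool" where
  "countable_dense_gaussians D \<longleftrightarrow> D \<subseteq> gaussian_family \<and> countable D \<and>
     (\<forall>G\<in>gaussian_family. \<forall>e>0. \<exists>Q\<in>D. hellinger G Q < e)"

definition weights :: "nat \<Rightarrow> (nat \<Rightarrow> real) set" where
  "weights K = {w. (\<forall>k\<in>{1..K}. 0 \<le> w k \<and> w k \<le> 1) \<and> (\<Sum>k=1..K. w k) = 1}"

definition mixture_density ::
    "nat \<Rightarrow> (nat \<Rightarrow> real) \<Rightarrow> (nat \<Rightarrow> real) \<Rightarrow> (nat \<Rightarrow> real) \<Rightarrow> real \<Rightarrow> real" where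
  "mixture_density K w z \<sigma> x = (\<Sum>k=1..K. w k * normal_density (z k) (\<sigma> k) x)"

definition gaussian_mixtures :: "nat \<Rightarrow> real measure set" where
  "gaussian_mixtures K = {density lborel (mixture_density K w z \<sigma>) | w z \<sigma>.
     w \<in> weights K \<and> (\<forall>k\<in>{1..K}. 0 < \<sigma> k)}"

text \<open>The restricted class of mixtures is represented by its continuous densities (and not by
  all almost-everywhere versions of them), since the estimator evaluates densities at the data.\<close>

definition restricted_mixture_densities ::
    "real measure set \<Rightarrow> nat \<Rightarrow> real \<Rightarrow> (real \<Rightarrow> real) set" where
  "restricted_mixture_densities D K \<delta> = {mixture_density K w z \<sigma> | w z \<sigma>.
     w \<in> weights K \<and>
     (\<forall>k\<in>{1..K}. \<delta> \<le> w k \<and> w k \<in> \<rat> \<and> 0 < \<sigma> k \<and> gaussian (z k) (\<sigma> k) \<in> D)}"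

definition mixture_delta :: "nat \<Rightarrow> nat \<Rightarrow> real" where
  "mixture_delta n K = min (real gaussian_vc / real n) (1 / real K)"

definition model_densities :: "real measure set \<Rightarrow> nat \<Rightarrow> (real \<Rightarrow> real) set" where
  "model_densities D n = (\<Union>K\<in>{2..n}. restricted_mixture_densities D K (mixture_delta n K))"

definition log_plus :: "real \<Rightarrow> real" where
  "log_plus x = max (ln x) 0"

definition mixture_penalty :: "nat \<Rightarrow> (real \<Rightarrow> real) \<Rightarrow> real" where
  "mixture_penalty n q = (280 * sqrt 2 + 74) *
     (INF K\<in>{K\<in>{2..n}. density lborel q \<in> gaussian_mixtures K}.
        174.1 * real K * real gaussian_vc *
          (5.82 + ln ((real K + 1)\<^sup>2 / mixture_delta n K)
             + log_plus (real n / (real K * real gaussian_vc)))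
        + real K)"

section \<open>Penalized rho-estimators\<close>

definition rho_psi :: "ennreal \<Rightarrow> real" where
  "rho_psi x = (if x = \<infinity> then 1 else (enn2real x - 1) / (enn2real x + 1))"

text \<open>The square root of \<open>a / b\<close>, where \<open>0 / 0 = 1\<close> and \<open>a / 0 = \<infinity>\<close> for \<open>a > 0\<close>.\<close>

definition sqrt_ratio :: "real \<Rightarrow> real \<Rightarrow> ennreal" where
  "sqrt_ratio a b =
     (if b = 0 then (if a = 0 then 1 else \<infinity>) else ennreal (sqrt (a / b)))"

definition rho_T ::
    "nat \<Rightarrow> (nat \<Rightarrow> real) \<Rightarrow> (real \<Rightarrow> real) \<Rightarrow> (real \<Rightarrow> real) \<Rightarrow> real" where
  "rho_T n x q q' = (\<Sum>i=1..n. rho_psi (sqrt_ratio (q' (x i)) (q (x i))))"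

definition rho_Upsilon :: "nat \<Rightarrow> (real \<Rightarrow> real) set \<Rightarrow> ((real \<Rightarrow> real) \<Rightarrow> real) \<Rightarrow>
    (nat \<Rightarrow> real) \<Rightarrow> (real \<Rightarrow> real) \<Rightarrow> real" where
  "rho_Upsilon n \<Q> pen x q = (SUP q'\<in>\<Q>. rho_T n x q q' - pen q') + pen q"

text \<open>An estimator is a map from samples \<open>x \<in> \<real>\<^sup>n\<close> to probability measures on the line, measurable
  for the \<open>\<sigma>\<close>-algebra generated by the evaluations \<open>R \<mapsto> R A\<close>.\<close>

definition rho_estimator :: "nat \<Rightarrow> (real \<Rightarrow> real) set \<Rightarrow> ((real \<Rightarrow> real) \<Rightarrow> real) \<Rightarrow>
    ((nat \<Rightarrow> real) \<Rightarrow> real measure) \<Rightarrow> bool" where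
  "rho_estimator n \<Q> pen Phat \<longleftrightarrow>
     Phat \<in> (\<Pi>\<^sub>M i\<in>{1..n}. borel) \<rightarrow>\<^sub>M prob_algebra borel \<and>
     (\<forall>x\<in>space (\<Pi>\<^sub>M i\<in>{1..n}. (borel :: real measure)).
        Phat x \<in> hellinger_closure {density lborel q | q. q \<in> \<Q> \<and>
          rho_Upsilon n \<Q> pen x q < (INF q'\<in>\<Q>. rho_Upsilon n \<Q> pen x q') + 8.24})"

section \<open>The class of regular densities\<close>

record holder_params =
  hp_gamma :: real
  hp_l :: real
  hp_L :: "real poly"
  hp_eps :: real
  hp_C :: real
  hp_alpha :: real
  hp_xi :: real
  hp_M :: real

definition positive_params :: "holder_params \<Rightarrow> bool" where
  "positive_params \<P> \<longleftrightarrow> 0 < hp_gamma \<P> \<and> 0 < hp_l \<P> \<and> 0 < hp_eps \<P> \<and> 0 < hp_C \<P> \<and>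
     0 < hp_alpha \<P> \<and> 0 < hp_xi \<P> \<and> 0 < hp_M \<P>"

definition probability_density :: "(real \<Rightarrow> real) \<Rightarrow> bool" where
  "probability_density p \<longleftrightarrow> p \<in> borel_measurable borel \<and> (\<forall>x. 0 \<le> p x) \<and>
     (\<integral>\<^sup>+x. ennreal (p x) \<partial>lborel) = 1"

definition log_deriv :: "nat \<Rightarrow> (real \<Rightarrow> real) \<Rightarrow> real \<Rightarrow> real" where
  "log_deriv j p = (deriv ^^ j) (\<lambda>x. ln (p x))"

definition psi0 :: "real \<Rightarrow> real" where
  "psi0 x = pi powr (- 1 / 2) * exp (- x\<^sup>2)"

text \<open>The differentiability clause is implicit in the use of the derivatives of \<open>log p\<close> up to
  order \<open>r\<close> and is needed because \<open>deriv\<close> is total. In the Hoelder condition, \<open>0 powr 0 = 0\<close> is harmless: it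
  only matters when \<open>x = y\<close> and \<open>\<beta> = r\<close>, and then the condition at \<open>y \<noteq> x\<close> already forces
  \<open>L x \<ge> 0\<close>. Integrals of nonnegative functions are bounded in \<open>[0, \<infinity>]\<close>, so that the
  bound includes finiteness.\<close>

definition holder_class :: "real \<Rightarrow> holder_params \<Rightarrow> (real \<Rightarrow> real) set" where
  "holder_class \<beta> \<P> = {p. probability_density p \<and>
     (let r = nat \<lfloor>\<beta>\<rfloor>; L = poly (hp_L \<P>) in
        (\<forall>j<r. \<forall>x. log_deriv j p differentiable (at x)) \<and>
        (\<forall>x y. \<bar>y - x\<bar> \<le> hp_gamma \<P> \<longrightarrow>
           \<bar>log_deriv r p x - log_deriv r p y\<bar> \<le> fact r * L x * \<bar>y - x\<bar> powr (\<beta> - real r)) \<and>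
        (\<forall>j\<le>r. \<bar>log_deriv j p 0\<bar> \<le> hp_l \<P>) \<and>
        (\<forall>j\<in>{1..r}. (\<integral>\<^sup>+x. ennreal (\<bar>log_deriv j p x\<bar> powr ((2 * \<beta> + hp_eps \<P>) / real j) * p x) \<partial>lborel)
           \<le> ennreal (hp_C \<P>)) \<and>
        (\<integral>\<^sup>+x. ennreal (\<bar>L x\<bar> powr (2 + hp_eps \<P> / \<beta>) * p x) \<partial>lborel) \<le> ennreal (hp_C \<P>) \<and>
        (\<forall>x. p x \<le> hp_M \<P> * psi0 x) \<and>
        (\<forall>x. 0 < p x) \<and>
        mono_on {..< - hp_alpha \<P>} p \<and>
        antimono_on {hp_alpha \<P> <..} p \<and>
        (\<forall>x\<in>{- hp_alpha \<P>..hp_alpha \<P>}. hp_xi \<P> \<le> p x))}"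

text \<open>A parameter set is admissible on a range of regularities if Gaussian mixtures approximate
  the corresponding classes at the stated rate.\<close>

definition admissible_params :: "real \<Rightarrow> real \<Rightarrow> holder_params \<Rightarrow> bool" where
  "admissible_params \<beta>l \<beta>u \<P> \<longleftrightarrow> positive_params \<P> \<and>
     (\<exists>c>0. \<forall>\<beta>\<in>{\<beta>l..\<beta>u}. \<forall>p\<in>holder_class \<beta> \<P>. \<forall>K\<ge>2.
        hellinger_sq_set (density lborel p) (gaussian_mixtures K)
          \<le> c * (ln (real K) powr (3 * \<beta>) / real K powr (2 * \<beta>)))"

end

theory Submission
  imports Defs "HOL-Real_Asymp.Real_Asymp"
begin

text \<open>The estimator is compared with a single element \<open>qb\<close> of the model that is close to \<open>p\<close>. The
statistic \<open>T\<close> sums the contrast \<open>(sqrt q - sqrt qb) / (sqrt q + sqrt qb)\<close>, which is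
antisymmetric in the two densities. Its mean under \<open>p\<close> is at most a multiple of
\<open>h\<^sup>2(p, qb)\<close> minus a multiple of \<open>h\<^sup>2(p, q)\<close>, and its second moment is controlled by the same two
distances (\<open>expectation_contrast_le\<close>, \<open>second_moment_contrast_le\<close>). So if, simultaneously for all
\<open>q\<close> in the model, the sum exceeds its mean by at most a small part of \<open>n h\<^sup>2(p, q)\<close> plus the penalty
of \<open>q\<close>, then by antisymmetry every \<open>q\<close> that nearly minimises the criterion satisfies
\<open>n h\<^sup>2(p, q) \<lesssim> n h\<^sup>2(p, qb) + pen qb\<close> (\<open>rho_oracle_inequality\<close>).

Only upper deviations have to be controlled, and the contrast increases with \<open>q\<close>; hence a finite
family of upper brackets is enough. On \<open>[- n, n]\<close>, and away from its own mean, a Gaussian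
density is within \<open>2 n\<^sup>-\<^sup>7\<close> below one of polynomially many brackets (\<open>gaussian_bracket_exists\<close>).
Near the mean, and outside \<open>[- n, n]\<close>, the contrast is replaced by its upper bound 1, which costs little
because \<open>p\<close> is dominated by a multiple of a Gaussian density. Where \<open>qb\<close> is much smaller than \<open>p\<close>
the additive error is not negligible, but the \<open>p\<close>-mass of that region is at most a multiple of
\<open>h\<^sup>2(p, qb)\<close> (\<open>bracket_contrast_error\<close>). Mixtures with \<open>K\<close> components thus have \<open>n\<close> to the power
\<open>210 K\<close> brackets, and Bernstein's inequality with a union bound gives a deviation of order
\<open>K log n\<close>, uniformly in the components and the weights (\<open>contrast_deviation\<close>).

The penalty dominates this deviation. The VC-index lies between 1 and 4, because log-ratios of
Gaussians are quadratic, and this makes the penalty comparable to \<open>K log n\<close> with a large factor, for the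
number \<open>K\<close> at which its infimum is attained (\<open>mixture_penalty_lower\<close>, \<open>mixture_penalty_upper\<close>).

It remains to choose \<open>qb\<close>. A mixture that is almost optimal among those with \<open>K\<close> components can be
moved into the model at the price \<open>O(K / n)\<close> (\<open>restricted_mixture_approximation\<close>), and the \<open>K\<close> that
balances \<open>(log K)\<^sup>3\<^sup>\<beta> K\<^sup>-\<^sup>2\<^sup>\<beta>\<close> against \<open>K log n / n\<close> produces the stated rate
(\<open>optimal_components\<close>). Small \<open>n\<close> are absorbed by the constant, since \<open>h\<^sup>2 \<le> 1\<close>.

Finally, the event in the theorem has to be measurable for its probability to be meaningful. The
estimator takes values in the Hellinger closure of a countable set, and there the loss is a
limit of expressions in the probabilities of countably many Scheffe sets
(\<open>hellinger_sublevel_measurable\<close>).\<close>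

section \<open>Hellinger distance and total variation\<close>

lemma prob_density_integral:
  fixes f :: "'a \<Rightarrow> real"
  assumes [measurable]: "f \<in> borel_measurable \<nu>" and nn: "\<And>x. 0 \<le> f x"
    and p: "prob_space (density \<nu> f)"
  shows "integrable \<nu> f" "integral\<^sup>L \<nu> f = 1"
proof -
  have 1: "(\<integral>\<^sup>+x. ennreal (f x) \<partial>\<nu>) = 1"
    using prob_space.emeasure_space_1[OF p] by (simp add: emeasure_density cong: nn_integral_cong)
  show "integrable \<nu> f" using 1 nn by (intro integrableI_nonneg) auto
  show "integral\<^sup>L \<nu> f = 1" using nn 1 by (subst integral_eq_nn_integral) auto
qed

lemma integrable_sqrt_diff_sq:
  fixes f g :: "'a \<Rightarrow> real"
  assumes "integrable \<nu> f" "integrable \<nu> g" and nn: "\<And>x. 0 \<le> f x" "\<And>x. 0 \<le> g x"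
  shows "integrable \<nu> (\<lambda>x. (sqrt (f x) - sqrt (g x))\<^sup>2)"
proof (rule Bochner_Integration.integrable_bound[of \<nu> "\<lambda>x. f x + g x"])
  show "integrable \<nu> (\<lambda>x. f x + g x)" using assms by auto
  show "(\<lambda>x. (sqrt (f x) - sqrt (g x))\<^sup>2) \<in> borel_measurable \<nu>"
    using assms(1,2)[THEN borel_measurable_integrable] by measurable
  show "AE x in \<nu>. norm ((sqrt (f x) - sqrt (g x))\<^sup>2) \<le> norm (f x + g x)"
  proof (rule AE_I2)
    fix x
    have "(sqrt (f x) - sqrt (g x))\<^sup>2 = f x + g x - 2 * (sqrt (f x) * sqrt (g x))"
      using nn[of x] by (simp add: power2_diff)
    moreover have "0 \<le> sqrt (f x) * sqrt (g x)" using nn[of x] by simp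
    ultimately have "(sqrt (f x) - sqrt (g x))\<^sup>2 \<le> f x + g x" by linarith
    then show "norm ((sqrt (f x) - sqrt (g x))\<^sup>2) \<le> norm (f x + g x)"
      using nn[of x] by simp
  qed
qed

text \<open>Densities with respect to \<open>P + Q + R\<close>, chosen with real values. They reduce all statements about
the Hellinger distance to pointwise inequalities.\<close>

lemma common_densities:
  fixes P Q R :: "'a measure"
  assumes P: "prob_space P" "prob_space Q" "prob_space R" "sets P = sets Q" "sets R = sets Q"
  obtains \<nu> and f g h :: "'a \<Rightarrow> real" where
    "f \<in> borel_measurable \<nu>" "g \<in> borel_measurable \<nu>" "h \<in> borel_measurable \<nu>"
    "\<And>x. 0 \<le> f x" "\<And>x. 0 \<le> g x" "\<And>x. 0 \<le> h x"
    "P = density \<nu> f" "Q = density \<nu> g" "R = density \<nu> h"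
proof -
  define \<nu>' where "\<nu>' = sum_measure P Q"
  define \<nu> where "\<nu> = sum_measure \<nu>' R"
  have s': "sets \<nu>' = sets Q" unfolding \<nu>'_def using P by (simp add: sets_sum_measure)
  have s: "sets \<nu> = sets Q" unfolding \<nu>_def using P s' by (simp add: sets_sum_measure)
  have sp: "space \<nu> = space Q" using s by (rule sets_eq_imp_space_eq)
  have spP: "space P = space Q" "space R = space Q" using P(4,5)[THEN sets_eq_imp_space_eq] by simp_all
  have em: "emeasure \<nu> A = emeasure P A + emeasure Q A + emeasure R A" if "A \<in> sets Q" for A
  proof -
    have "emeasure \<nu> A = emeasure \<nu>' A + emeasure R A"
      unfolding \<nu>_def by (rule emeasure_sum_measure) (simp_all add: s' that P(5))
    also have "emeasure \<nu>' A = emeasure P A + emeasure Q A"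
      unfolding \<nu>'_def by (rule emeasure_sum_measure) (simp_all add: that P(4))
    finally show ?thesis .
  qed
  have "emeasure \<nu> (space \<nu>) = 3"
    unfolding sp using em[of "space Q"] prob_space.emeasure_space_1[OF P(1)]
      prob_space.emeasure_space_1[OF P(2)] prob_space.emeasure_space_1[OF P(3)] spP by simp
  then interpret finite_measure \<nu> by (intro finite_measureI) simp
  have ex: "\<exists>f. f \<in> borel_measurable \<nu> \<and> (\<forall>x. 0 \<le> f x) \<and> N = density \<nu> (\<lambda>x. ennreal (f x))"
    if N: "prob_space N" "sets N = sets Q" "\<And>A. A \<in> sets Q \<Longrightarrow> emeasure N A \<le> emeasure \<nu> A" for N
  proof -
    have ac: "absolutely_continuous \<nu> N"
      unfolding absolutely_continuous_def
    proof
      fix A assume "A \<in> null_sets \<nu>"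
      then have "emeasure \<nu> A = 0" and A: "A \<in> sets Q" using s by auto
      with N(3)[OF A] have "emeasure N A = 0" by simp
      then show "A \<in> null_sets N" using A N(2) by auto
    qed
    have sN: "sets N = sets \<nu>" using N s by simp
    obtain D where D: "D \<in> borel_measurable \<nu>" "AE x in \<nu>. RN_deriv \<nu> N x = ennreal (D x)"
      "\<And>x. 0 \<le> D x"
      using real_RN_deriv[OF prob_space.finite_measure[OF N(1)] ac sN] by blast
    have "N = density \<nu> (RN_deriv \<nu> N)" using density_RN_deriv[OF ac sN] by simp
    also have "\<dots> = density \<nu> (\<lambda>x. ennreal (D x))"
      using D by (intro density_cong) auto
    finally show ?thesis using D by blast
  qed
  have le: "emeasure P A \<le> emeasure \<nu> A" "emeasure Q A \<le> emeasure \<nu> A"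
    "emeasure R A \<le> emeasure \<nu> A" if "A \<in> sets Q" for A
    unfolding em[OF that] using add_increasing2 add_increasing by (metis order_refl zero_le)+
  obtain f where f: "f \<in> borel_measurable \<nu>" "\<forall>x. 0 \<le> f x" "P = density \<nu> (\<lambda>x. ennreal (f x))"
    using ex[OF P(1) P(4) le(1)] by blast
  obtain g where g: "g \<in> borel_measurable \<nu>" "\<forall>x. 0 \<le> g x" "Q = density \<nu> (\<lambda>x. ennreal (g x))"
    using ex[OF P(2) refl le(2)] by blast
  obtain h where h: "h \<in> borel_measurable \<nu>" "\<forall>x. 0 \<le> h x" "R = density \<nu> (\<lambda>x. ennreal (h x))"
    using ex[OF P(3) P(5) le(3)] by blast
  show ?thesis
    by (rule that[OF f(1) g(1) h(1) _ _ _ f(3) g(3) h(3)]) (use f(2) g(2) h(2) in simp_all)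
qed

lemma common_densities2:
  fixes P Q :: "'a measure"
  assumes "prob_space P" "prob_space Q" "sets P = sets Q"
  obtains \<nu> and f g :: "'a \<Rightarrow> real" where
    "f \<in> borel_measurable \<nu>" "g \<in> borel_measurable \<nu>" "\<And>x. 0 \<le> f x" "\<And>x. 0 \<le> g x"
    "P = density \<nu> f" "Q = density \<nu> g"
  by (rule common_densities[OF assms(1) assms(2) assms(2) assms(3) refl]) (rule that)

lemma hellinger_sq_nonneg [simp]: "0 \<le> hellinger_sq P Q"
  unfolding hellinger_sq_def Let_def by (intro mult_nonneg_nonneg integral_nonneg_AE) auto

lemma hellinger_power2: "(hellinger P Q)\<^sup>2 = hellinger_sq P Q"
  by (simp add: hellinger_def)

lemma hellinger_nonneg [simp]: "0 \<le> hellinger P Q"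
  by (simp add: hellinger_def)

lemma hellinger_sq_le_1:
  fixes P Q :: "'a measure"
  assumes "prob_space P" "prob_space Q" "sets P = sets Q"
  shows "hellinger_sq P Q \<le> 1"
proof -
  obtain \<nu> and f g :: "'a \<Rightarrow> real" where m [measurable]: "f \<in> borel_measurable \<nu>" "g \<in> borel_measurable \<nu>"
    and nn: "\<And>x. 0 \<le> f x" "\<And>x. 0 \<le> g x" and eq: "P = density \<nu> f" "Q = density \<nu> g"
    by (rule common_densities2[OF assms(1-3)]) (rule that)
  have i: "integrable \<nu> f" "integral\<^sup>L \<nu> f = 1" "integrable \<nu> g" "integral\<^sup>L \<nu> g = 1"
    using prob_density_integral[of f \<nu>] prob_density_integral[of g \<nu>] m nn eq assms by auto
  have "hellinger_sq P Q = 1 / 2 * (\<integral>x. (sqrt (f x) - sqrt (g x))\<^sup>2 \<partial>\<nu>)"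
    unfolding eq using assms eq nn by (intro hellinger_sq_density) auto
  also have "\<dots> \<le> 1 / 2 * (\<integral>x. f x + g x \<partial>\<nu>)"
  proof (intro mult_left_mono integral_mono)
    fix x
    have "0 \<le> sqrt (f x) * sqrt (g x)" using nn[of x] by simp
    then show "(sqrt (f x) - sqrt (g x))\<^sup>2 \<le> f x + g x"
      using nn[of x] by (simp add: power2_diff)
  qed (use i nn in \<open>auto intro: integrable_sqrt_diff_sq\<close>)
  also have "\<dots> = 1" using i by simp
  finally show ?thesis .
qed

lemma hellinger_sq_commute:
  fixes P Q :: "'a measure"
  assumes "prob_space P" "prob_space Q" "sets P = sets Q"
  shows "hellinger_sq P Q = hellinger_sq Q P"
proof -
  obtain \<nu> and f g :: "'a \<Rightarrow> real" where m [measurable]: "f \<in> borel_measurable \<nu>" "g \<in> borel_measurable \<nu>"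
    and nn: "\<And>x. 0 \<le> f x" "\<And>x. 0 \<le> g x" and eq: "P = density \<nu> f" "Q = density \<nu> g"
    by (rule common_densities2[OF assms(1-3)]) (rule that)
  show ?thesis unfolding eq using assms nn unfolding eq
    by (subst (1 2) hellinger_sq_density) (auto simp: power2_commute)
qed

text \<open>The weighted form \<open>(a + b)\<^sup>2 \<le> (1 + t) a\<^sup>2 + (1 + 1/t) b\<^sup>2\<close> of the triangle inequality
  holds pointwise under the integral, and optimising over \<open>t\<close> gives Minkowski's inequality.\<close>

lemma hellinger_sq_weighted_triangle:
  fixes P Q R :: "'a measure"
  assumes P: "prob_space P" "prob_space Q" "prob_space R" "sets P = sets Q" "sets R = sets Q"
    and t: "0 < t"
  shows "hellinger_sq P R \<le> (1 + t) * hellinger_sq P Q + (1 + 1 / t) * hellinger_sq Q R"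
proof -
  obtain \<nu> and f g h :: "'a \<Rightarrow> real" where m [measurable]: "f \<in> borel_measurable \<nu>" "g \<in> borel_measurable \<nu>"
      "h \<in> borel_measurable \<nu>"
    and nn: "\<And>x. 0 \<le> f x" "\<And>x. 0 \<le> g x" "\<And>x. 0 \<le> h x"
    and eq: "P = density \<nu> f" "Q = density \<nu> g" "R = density \<nu> h"
    by (rule common_densities[OF P]) (rule that)
  have i: "integrable \<nu> f" "integrable \<nu> g" "integrable \<nu> h"
    using prob_density_integral[of f \<nu>] prob_density_integral[of g \<nu>]
      prob_density_integral[of h \<nu>] m nn eq assms by auto
  have "(\<integral>x. (sqrt (f x) - sqrt (h x))\<^sup>2 \<partial>\<nu>) \<le>
     (\<integral>x. (1 + t) * (sqrt (f x) - sqrt (g x))\<^sup>2 + (1 + 1 / t) * (sqrt (g x) - sqrt (h x))\<^sup>2 \<partial>\<nu>)"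
  proof (intro integral_mono)
    fix x
    define a b where "a = sqrt (f x) - sqrt (g x)" and "b = sqrt (g x) - sqrt (h x)"
    have "0 \<le> (t * a - b)\<^sup>2 / t" using t by simp
    also have "(t * a - b)\<^sup>2 / t = t * a\<^sup>2 - 2 * a * b + b\<^sup>2 / t"
      using t by (simp add: power2_eq_square field_simps)
    finally have "(a + b)\<^sup>2 \<le> (1 + t) * a\<^sup>2 + (1 + 1 / t) * b\<^sup>2"
      by (simp add: power2_eq_square algebra_simps)
    then show "(sqrt (f x) - sqrt (h x))\<^sup>2 \<le> (1 + t) * (sqrt (f x) - sqrt (g x))\<^sup>2
        + (1 + 1 / t) * (sqrt (g x) - sqrt (h x))\<^sup>2"
      by (simp add: a_def b_def)
  qed (use i nn in \<open>auto intro!: integrable_sqrt_diff_sq Bochner_Integration.integrable_add integrable_mult_right\<close>)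
  also have "\<dots> = (1 + t) * (\<integral>x. (sqrt (f x) - sqrt (g x))\<^sup>2 \<partial>\<nu>)
      + (1 + 1 / t) * (\<integral>x. (sqrt (g x) - sqrt (h x))\<^sup>2 \<partial>\<nu>)"
    using i nn by (subst Bochner_Integration.integral_add) (auto intro: integrable_sqrt_diff_sq)
  finally have *: "(\<integral>x. (sqrt (f x) - sqrt (h x))\<^sup>2 \<partial>\<nu>) \<le> \<dots>" .
  have H: "hellinger_sq P R = 1 / 2 * (\<integral>x. (sqrt (f x) - sqrt (h x))\<^sup>2 \<partial>\<nu>)"
    "hellinger_sq P Q = 1 / 2 * (\<integral>x. (sqrt (f x) - sqrt (g x))\<^sup>2 \<partial>\<nu>)"
    "hellinger_sq Q R = 1 / 2 * (\<integral>x. (sqrt (g x) - sqrt (h x))\<^sup>2 \<partial>\<nu>)"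
    using hellinger_sq_density[OF m(1) m(3) nn(1) nn(3)] hellinger_sq_density[OF m(1) m(2) nn(1) nn(2)]
      hellinger_sq_density[OF m(2) m(3) nn(2) nn(3)] P(1-3) unfolding eq by blast+
  have "1 / 2 * A \<le> (1 + t) * (1 / 2 * B) + (1 + 1 / t) * (1 / 2 * C)"
    if "A \<le> (1 + t) * B + (1 + 1 / t) * C" for A B C :: real
  proof -
    have "(1 + t) * (1 / 2 * B) = 1 / 2 * ((1 + t) * B)"
      "(1 + 1 / t) * (1 / 2 * C) = 1 / 2 * ((1 + 1 / t) * C)" by (rule mult.left_commute)+
    then have "(1 + t) * (1 / 2 * B) + (1 + 1 / t) * (1 / 2 * C)
        = 1 / 2 * ((1 + t) * B + (1 + 1 / t) * C)"
      by (simp only: distrib_left)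
    with that show ?thesis by simp
  qed
  from this[OF *] show ?thesis unfolding H .
qed

lemma hellinger_triangle:
  fixes P Q R :: "'a measure"
  assumes P: "prob_space P" "prob_space Q" "prob_space R" "sets P = sets Q" "sets R = sets Q"
  shows "hellinger P R \<le> hellinger P Q + hellinger Q R"
proof (rule field_le_epsilon)
  fix e :: real assume e: "0 < e"
  define a b where "a = hellinger P Q + e / 2" and "b = hellinger Q R + e / 2"
  have a: "0 < a" "0 < b" using e by (simp_all add: a_def b_def add_nonneg_pos)
  have "(hellinger P R)\<^sup>2 \<le> (1 + b / a) * (hellinger P Q)\<^sup>2 + (1 + 1 / (b / a)) * (hellinger Q R)\<^sup>2"
    unfolding hellinger_power2 by (rule hellinger_sq_weighted_triangle[OF P]) (use a in simp)
  also have "\<dots> \<le> (1 + b / a) * a\<^sup>2 + (1 + 1 / (b / a)) * b\<^sup>2"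
  proof (intro add_mono mult_left_mono)
    show "(hellinger P Q)\<^sup>2 \<le> a\<^sup>2" "(hellinger Q R)\<^sup>2 \<le> b\<^sup>2"
      using e by (auto intro!: power_mono simp: a_def b_def)
    show "0 \<le> 1 + b / a" "0 \<le> 1 + 1 / (b / a)" using a by simp_all
  qed
  also have "\<dots> = (a + b)\<^sup>2"
  proof -
    have "(1 + b / a) * a\<^sup>2 = a\<^sup>2 + b * a" "(1 + 1 / (b / a)) * b\<^sup>2 = b\<^sup>2 + a * b"
      using a by (simp_all add: power2_eq_square distrib_right)
    then show ?thesis by (simp add: power2_sum)
  qed
  finally have "hellinger P R \<le> a + b" by (rule power2_le_imp_le) (use a in simp)
  then show "hellinger P R \<le> hellinger P Q + hellinger Q R + e" by (simp add: a_def b_def)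
qed

lemma hellinger_sq_le_L1:
  fixes f g :: "'a \<Rightarrow> real"
  assumes m [measurable]: "f \<in> borel_measurable \<nu>" "g \<in> borel_measurable \<nu>"
    and nn: "\<And>x. 0 \<le> f x" "\<And>x. 0 \<le> g x"
    and P: "prob_space (density \<nu> f)" "prob_space (density \<nu> g)"
  shows "hellinger_sq (density \<nu> f) (density \<nu> g) \<le> 1 / 2 * (\<integral>x. \<bar>f x - g x\<bar> \<partial>\<nu>)"
proof -
  note i = prob_density_integral(1)[OF m(1) nn(1) P(1)] prob_density_integral(1)[OF m(2) nn(2) P(2)]
  show ?thesis unfolding hellinger_sq_density[OF m nn P]
  proof (intro mult_left_mono integral_mono)
    fix x
    have "\<bar>sqrt (f x) - sqrt (g x)\<bar> * \<bar>sqrt (f x) - sqrt (g x)\<bar> \<le>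
      \<bar>sqrt (f x) - sqrt (g x)\<bar> * \<bar>sqrt (f x) + sqrt (g x)\<bar>"
    proof (rule mult_left_mono)
      have "0 \<le> sqrt (f x)" "0 \<le> sqrt (g x)" using nn[of x] by auto
      then show "\<bar>sqrt (f x) - sqrt (g x)\<bar> \<le> \<bar>sqrt (f x) + sqrt (g x)\<bar>" by linarith
    qed simp
    also have "\<dots> = \<bar>(sqrt (f x) - sqrt (g x)) * (sqrt (f x) + sqrt (g x))\<bar>"
      by (rule abs_mult[symmetric])
    also have "(sqrt (f x) - sqrt (g x)) * (sqrt (f x) + sqrt (g x)) = f x - g x"
      using nn[of x] by (simp add: algebra_simps)
    finally show "(sqrt (f x) - sqrt (g x))\<^sup>2 \<le> \<bar>f x - g x\<bar>"
      by (simp add: power2_eq_square abs_mult[symmetric])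
  qed (use i nn in \<open>auto intro: integrable_sqrt_diff_sq\<close>)
qed

text \<open>This is Cauchy-Schwarz for \<open>\<bar>f - g\<bar> = \<bar>sqrt f - sqrt g\<bar> (sqrt f + sqrt g)\<close>, in the form
\<open>a b \<le> a\<^sup>2 / (2 t) + t b\<^sup>2 / 2\<close>; the bound tends to \<open>3 h\<close> as \<open>t\<close> decreases to \<open>h\<close>.\<close>

lemma L1_le_hellinger:
  fixes f g :: "'a \<Rightarrow> real"
  assumes m [measurable]: "f \<in> borel_measurable \<nu>" "g \<in> borel_measurable \<nu>"
    and nn: "\<And>x. 0 \<le> f x" "\<And>x. 0 \<le> g x"
    and P: "prob_space (density \<nu> f)" "prob_space (density \<nu> g)"
  shows "(\<integral>x. \<bar>f x - g x\<bar> \<partial>\<nu>) \<le> 3 * hellinger (density \<nu> f) (density \<nu> g)"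
proof (rule field_le_epsilon)
  fix e :: real assume e: "0 < e"
  define H where "H = hellinger (density \<nu> f) (density \<nu> g)"
  define t where "t = H + e / 3"
  have H: "H \<ge> 0" by (simp add: H_def)
  have t: "0 < t" using e H by (simp add: t_def)
  note i = prob_density_integral[OF m(1) nn(1) P(1)] prob_density_integral[OF m(2) nn(2) P(2)]
  have "(\<integral>x. \<bar>f x - g x\<bar> \<partial>\<nu>) \<le> (\<integral>x. 1 / (2 * t) * (sqrt (f x) - sqrt (g x))\<^sup>2 + t * (f x + g x) \<partial>\<nu>)"
  proof (intro integral_mono)
    fix x
    define a b where "a = \<bar>sqrt (f x) - sqrt (g x)\<bar>" and "b = sqrt (f x) + sqrt (g x)"
    have "\<bar>f x - g x\<bar> = a * b"
    proof -
      have "f x - g x = (sqrt (f x) - sqrt (g x)) * b"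
        using nn[of x] by (simp add: b_def algebra_simps)
      moreover have "0 \<le> b" using nn[of x] by (simp add: b_def)
      ultimately show ?thesis by (simp add: abs_mult a_def)
    qed
    also have "\<dots> \<le> 1 / (2 * t) * a\<^sup>2 + t / 2 * b\<^sup>2"
    proof -
      have "0 \<le> (a - t * b)\<^sup>2 / (2 * t)" using t by simp
      also have "\<dots> = 1 / (2 * t) * a\<^sup>2 + t / 2 * b\<^sup>2 - a * b"
        using t by (simp add: power2_eq_square field_simps)
      finally show ?thesis by simp
    qed
    also have "t / 2 * b\<^sup>2 \<le> t * (f x + g x)"
    proof -
      have "0 \<le> (sqrt (f x) - sqrt (g x))\<^sup>2" by simp
      then have "b\<^sup>2 \<le> 2 * (f x + g x)"
        using nn[of x] by (simp add: b_def power2_sum power2_diff)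
      then show ?thesis using t mult_left_mono[of "b\<^sup>2" "2 * (f x + g x)" "t / 2"]
        by (simp add: algebra_simps)
    qed
    finally show "\<bar>f x - g x\<bar> \<le> 1 / (2 * t) * (sqrt (f x) - sqrt (g x))\<^sup>2 + t * (f x + g x)"
      using t by (simp add: a_def)
  qed (use i nn in \<open>auto intro!: integrable_sqrt_diff_sq Bochner_Integration.integrable_add integrable_mult_right\<close>)
  also have "\<dots> = 1 / (2 * t) * (\<integral>x. (sqrt (f x) - sqrt (g x))\<^sup>2 \<partial>\<nu>) + t * 2"
    using i nn by (subst Bochner_Integration.integral_add) (auto intro!: integrable_sqrt_diff_sq Bochner_Integration.integrable_add integrable_mult_right)
  also have "(\<integral>x. (sqrt (f x) - sqrt (g x))\<^sup>2 \<partial>\<nu>) = 2 * H\<^sup>2"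
    unfolding H_def hellinger_power2 using hellinger_sq_density[OF m nn P] by simp
  also have "1 / (2 * t) * (2 * H\<^sup>2) \<le> t"
  proof -
    have "H\<^sup>2 \<le> t\<^sup>2" using H e by (intro power_mono) (auto simp: t_def)
    then show ?thesis using t by (simp add: divide_simps power2_eq_square)
  qed
  finally show "(\<integral>x. \<bar>f x - g x\<bar> \<partial>\<nu>) \<le> 3 * hellinger (density \<nu> f) (density \<nu> g) + e"
    by (simp add: t_def H_def)
qed

lemma measure_density_integral:
  fixes h :: "'a \<Rightarrow> real"
  assumes [measurable]: "h \<in> borel_measurable \<nu>" "A \<in> sets \<nu>" and nn: "\<And>x. 0 \<le> h x"
  shows "measure (density \<nu> h) A = (\<integral>x. indicator A x * h x \<partial>\<nu>)"
proof -
  have "measure (density \<nu> h) A = (\<integral>x. indicator A x \<partial>density \<nu> h)" by simp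
  also have "\<dots> = (\<integral>x. h x * indicator A x \<partial>\<nu>)"
    using nn by (subst integral_density) auto
  finally show ?thesis by (simp add: mult.commute)
qed

lemma measure_diff_le_L1:
  fixes f g :: "'a \<Rightarrow> real"
  assumes m [measurable]: "f \<in> borel_measurable \<nu>" "g \<in> borel_measurable \<nu>"
    and nn: "\<And>x. 0 \<le> f x" "\<And>x. 0 \<le> g x"
    and P: "prob_space (density \<nu> f)" "prob_space (density \<nu> g)"
    and A [measurable]: "A \<in> sets \<nu>"
  shows "\<bar>measure (density \<nu> f) A - measure (density \<nu> g) A\<bar> \<le> (\<integral>x. \<bar>f x - g x\<bar> \<partial>\<nu>)"
proof -
  note i = prob_density_integral[OF m(1) nn(1) P(1)] prob_density_integral[OF m(2) nn(2) P(2)]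
  have ii: "integrable \<nu> (\<lambda>x. indicator A x * f x)" "integrable \<nu> (\<lambda>x. indicator A x * g x)"
    using i A by (auto intro!: integrable_real_mult_indicator simp: mult.commute[of "indicator A _"])
  have "\<bar>measure (density \<nu> f) A - measure (density \<nu> g) A\<bar> = \<bar>\<integral>x. indicator A x * f x - indicator A x * g x \<partial>\<nu>\<bar>"
    using ii i nn by (simp add: measure_density_integral)
  also have "\<dots> \<le> (\<integral>x. \<bar>indicator A x * f x - indicator A x * g x\<bar> \<partial>\<nu>)"
    by (rule integral_abs_bound)
  also have "\<dots> \<le> (\<integral>x. \<bar>f x - g x\<bar> \<partial>\<nu>)"
    using ii i by (intro integral_mono) (auto simp: indicator_def)
  finally show ?thesis .
qed

lemma measure_diff_le_hellinger:
  fixes P Q :: "'a measure"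
  assumes "prob_space P" "prob_space Q" "sets P = sets Q" "A \<in> sets Q"
  shows "\<bar>measure P A - measure Q A\<bar> \<le> 3 * hellinger P Q"
proof -
  obtain \<nu> and f g :: "'a \<Rightarrow> real" where m [measurable]: "f \<in> borel_measurable \<nu>" "g \<in> borel_measurable \<nu>"
    and nn: "\<And>x. 0 \<le> f x" "\<And>x. 0 \<le> g x" and eq: "P = density \<nu> f" "Q = density \<nu> g"
    by (rule common_densities2[OF assms(1-3)]) (rule that)
  have "\<bar>measure P A - measure Q A\<bar> \<le> (\<integral>x. \<bar>f x - g x\<bar> \<partial>\<nu>)"
    unfolding eq using assms nn unfolding eq by (intro measure_diff_le_L1) auto
  also have "\<dots> \<le> 3 * hellinger P Q"
    unfolding eq using assms nn unfolding eq by (intro L1_le_hellinger) auto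
  finally show ?thesis .
qed

text \<open>The set where one density exceeds the other carries half of their \<open>L\<^sup>1\<close> distance, so a single
  test set detects the Hellinger distance.\<close>

lemma hellinger_sq_le_Scheffe:
  fixes f g :: "'a \<Rightarrow> real"
  assumes m [measurable]: "f \<in> borel_measurable \<nu>" "g \<in> borel_measurable \<nu>"
    and nn: "\<And>x. 0 \<le> f x" "\<And>x. 0 \<le> g x"
    and P: "prob_space (density \<nu> f)" "prob_space (density \<nu> g)"
  shows "hellinger_sq (density \<nu> f) (density \<nu> g) \<le>
    measure (density \<nu> f) {x \<in> space \<nu>. g x < f x} - measure (density \<nu> g) {x \<in> space \<nu>. g x < f x}"
proof -
  note i = prob_density_integral[OF m(1) nn(1) P(1)] prob_density_integral[OF m(2) nn(2) P(2)]
  define A where "A = {x \<in> space \<nu>. g x < f x}"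
  have A [measurable]: "A \<in> sets \<nu>" unfolding A_def by measurable
  have ii: "integrable \<nu> (\<lambda>x. indicator A x * f x)" "integrable \<nu> (\<lambda>x. indicator A x * g x)"
    using i A by (auto intro!: integrable_real_mult_indicator simp: mult.commute[of "indicator A _"])
  have "1 / 2 * (\<integral>x. \<bar>f x - g x\<bar> \<partial>\<nu>) =
      1 / 2 * (\<integral>x. 2 * (indicator A x * f x - indicator A x * g x) - (f x - g x) \<partial>\<nu>)"
    by (intro arg_cong2[where f="(*)"] refl Bochner_Integration.integral_cong)
      (auto simp: indicator_def A_def)
  also have "\<dots> = measure (density \<nu> f) A - measure (density \<nu> g) A"
    using ii i nn by (simp add: measure_density_integral)
  finally show ?thesis using hellinger_sq_le_L1[OF m nn P] by (simp add: A_def)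
qed

section \<open>Measurability of the Hellinger loss\<close>

text \<open>Evaluations \<open>R \<mapsto> R A\<close> are measurable but \<open>R \<mapsto> h\<^sup>2(P, R)\<close> is not obviously so. On the closure
of a countable set \<open>{Q 0, Q 1, \<dots>}\<close> it suffices to recognise which \<open>Q j\<close> are close to \<open>R\<close>. As \<open>R\<close> is
itself almost equal to some \<open>Q i\<close>, and the Scheffe set \<open>A i j\<close> determines the distance between \<open>Q i\<close>
and \<open>Q j\<close>, the countably many numbers \<open>R (A i j)\<close> contain this information.\<close>

lemma hellinger_sublevel_measurable:
  fixes q :: "nat \<Rightarrow> real \<Rightarrow> real"
  assumes q [measurable]: "\<And>j. q j \<in> borel_measurable borel"
    and nn: "\<And>j x. 0 \<le> q j x" and prob: "\<And>j. prob_space (density lborel (q j))"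
    and Phat [measurable]: "Phat \<in> M \<rightarrow>\<^sub>M prob_algebra borel"
    and cl: "\<And>x. x \<in> space M \<Longrightarrow> Phat x \<in> hellinger_closure (range (\<lambda>j. density lborel (q j)))"
    and P: "prob_space P" "sets P = sets borel" and t: "0 \<le> t"
  shows "{x \<in> space M. hellinger_sq P (Phat x) \<le> t} \<in> sets M"
proof -
  define Q where "Q j = density lborel (q j)" for j
  define A where "A i j = {x. q j x < q i x}" for i j
  define s where "s = sqrt t"
  have A: "A i j \<in> sets borel" for i j unfolding A_def by measurable
  have Q: "prob_space (Q j)" "sets (Q j) = sets borel" for j
    unfolding Q_def using prob by auto
  have Phat': "Phat \<in> M \<rightarrow>\<^sub>M subprob_algebra borel" by (rule measurable_prob_algebraD[OF Phat])
  have m: "(\<lambda>x. measure (Phat x) (A i j)) \<in> borel_measurable M" for i j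
    by (rule measurable_compose[OF Phat' measurable_measure_subprob_algebra[OF A]])
  have iff: "hellinger P R \<le> s \<longleftrightarrow> (\<forall>m::nat. \<exists>j. hellinger P (Q j) \<le> s + 1 / real (m + 1) \<and>
      (\<forall>i. \<bar>measure R (A i j) - measure (Q j) (A i j)\<bar> \<le> 1 / (real (m + 1))\<^sup>2))"
    if R: "R \<in> hellinger_closure (range Q)" for R
  proof
    have Rp: "prob_space R" "sets R = sets borel"
      using R by (auto simp: hellinger_closure_def space_prob_algebra)
    have near: "\<exists>j. hellinger R (Q j) < e" if "0 < e" for e
      using R that by (auto simp: hellinger_closure_def)
    { assume h: "hellinger P R \<le> s"
      show "\<forall>m::nat. \<exists>j. hellinger P (Q j) \<le> s + 1 / real (m + 1) \<and>
        (\<forall>i. \<bar>measure R (A i j) - measure (Q j) (A i j)\<bar> \<le> 1 / (real (m + 1))\<^sup>2)"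
      proof
        fix m :: nat
        \<comment> \<open>Chosen so that total variation, bounded by \<open>3 h\<close>, is below \<open>(m + 1)\<^sup>-\<^sup>2\<close>.\<close>
        define e where "e = 1 / (3 * (real (m + 1))\<^sup>2)"
        have e: "0 < e" by (simp add: e_def)
        have "real (m + 1) * 1 \<le> real (m + 1) * (3 * real (m + 1))" by (intro mult_left_mono) auto
        then have e1: "e \<le> 1 / real (m + 1)"
          unfolding e_def by (intro divide_left_mono) (auto simp: power2_eq_square)
        obtain j where j: "hellinger R (Q j) < e" using near[OF e] by blast
        have "hellinger P (Q j) \<le> hellinger P R + hellinger R (Q j)"
          using P Rp Q by (intro hellinger_triangle) auto
        then have 1: "hellinger P (Q j) \<le> s + 1 / real (m + 1)" using h j e1 by linarith
        have "\<bar>measure R (A i j) - measure (Q j) (A i j)\<bar> \<le> 1 / (real (m + 1))\<^sup>2" for i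
        proof -
          have "\<bar>measure R (A i j) - measure (Q j) (A i j)\<bar> \<le> 3 * hellinger R (Q j)"
            using Rp Q A by (intro measure_diff_le_hellinger) auto
          also have "\<dots> \<le> 3 * e" using j by simp
          finally show ?thesis by (simp add: e_def)
        qed
        with 1 show "\<exists>j. hellinger P (Q j) \<le> s + 1 / real (m + 1) \<and>
          (\<forall>i. \<bar>measure R (A i j) - measure (Q j) (A i j)\<bar> \<le> 1 / (real (m + 1))\<^sup>2)" by blast
      qed }
    { assume all: "\<forall>m::nat. \<exists>j. hellinger P (Q j) \<le> s + 1 / real (m + 1) \<and>
        (\<forall>i. \<bar>measure R (A i j) - measure (Q j) (A i j)\<bar> \<le> 1 / (real (m + 1))\<^sup>2)"
      show "hellinger P R \<le> s"
      proof (rule field_le_epsilon)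
        fix e :: real assume e: "0 < e"
        obtain m :: nat where "4 / e < real m" using reals_Archimedean2 by blast
        then have "4 / e < real (m + 1)" by simp
        then have m: "1 / real (m + 1) < e / 4" using e by (simp add: field_simps)
        define u where "u = 1 / real (m + 1)"
        have u: "0 < u" "u < e / 4" using m by (simp_all add: u_def)
        obtain j where j: "hellinger P (Q j) \<le> s + u"
          "\<And>i. \<bar>measure R (A i j) - measure (Q j) (A i j)\<bar> \<le> u\<^sup>2"
          using all[rule_format, of m] by (auto simp: u_def power_one_over)
        obtain i where i: "hellinger R (Q i) < min (e / 4) (u\<^sup>2 / 3)"
          using near[of "min (e / 4) (u\<^sup>2 / 3)"] e u by auto
        have "hellinger_sq (Q i) (Q j) \<le> measure (Q i) (A i j) - measure (Q j) (A i j)"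
          using hellinger_sq_le_Scheffe[of "q i" lborel "q j"] nn prob q
          by (simp add: Q_def A_def)
        also have "\<dots> \<le> u\<^sup>2 + 3 * hellinger R (Q i)"
        proof -
          have "\<bar>measure R (A i j) - measure (Q i) (A i j)\<bar> \<le> 3 * hellinger R (Q i)"
            using Rp Q A by (intro measure_diff_le_hellinger) auto
          with j(2)[of i] show ?thesis by linarith
        qed
        also have "\<dots> \<le> (2 * u)\<^sup>2" 
        proof -
          have "3 * hellinger R (Q i) \<le> u\<^sup>2" using i by simp
          moreover have "(2 * u)\<^sup>2 = 4 * u\<^sup>2" by (simp add: power_mult_distrib)
          ultimately show ?thesis using zero_le_power2[of u] by linarith
        qed
        finally have ij: "hellinger (Q i) (Q j) \<le> 2 * u"
          unfolding hellinger_power2[symmetric] by (rule power2_le_imp_le) (use u in simp)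
        have "hellinger P R \<le> hellinger P (Q j) + hellinger (Q j) R"
          using P Rp Q by (intro hellinger_triangle) auto
        also have "hellinger (Q j) R \<le> hellinger (Q j) (Q i) + hellinger (Q i) R"
          using P Rp Q by (intro hellinger_triangle) auto
        also have "hellinger (Q j) (Q i) = hellinger (Q i) (Q j)"
          using Q by (simp add: hellinger_def hellinger_sq_commute)
        also have "hellinger (Q i) R = hellinger R (Q i)"
          using Q Rp by (simp add: hellinger_def hellinger_sq_commute)
        finally show "hellinger P R \<le> s + e" using j(1) i ij u by simp
      qed }
  qed
  have "{x \<in> space M. hellinger_sq P (Phat x) \<le> t} = {x \<in> space M. \<forall>m::nat. \<exists>j.
      hellinger P (Q j) \<le> s + 1 / real (m + 1) \<and>
      (\<forall>i. \<bar>measure (Phat x) (A i j) - measure (Q j) (A i j)\<bar> \<le> 1 / (real (m + 1))\<^sup>2)}"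
  proof (intro Collect_cong conj_cong refl)
    fix x assume "x \<in> space M"
    then have "Phat x \<in> hellinger_closure (range Q)" using cl by (simp add: Q_def[abs_def])
    from iff[OF this] show "hellinger_sq P (Phat x) \<le> t \<longleftrightarrow> (\<forall>m::nat. \<exists>j.
      hellinger P (Q j) \<le> s + 1 / real (m + 1) \<and>
      (\<forall>i. \<bar>measure (Phat x) (A i j) - measure (Q j) (A i j)\<bar> \<le> 1 / (real (m + 1))\<^sup>2))"
      by (simp add: s_def hellinger_def)
  qed
  also have "\<dots> \<in> sets M" using m by measurable
  finally show ?thesis .
qed

section \<open>The contrast of two densities\<close>

text \<open>For \<open>a > 0\<close> this is \<open>\<psi>(sqrt (b / a))\<close>, written so that the antisymmetry is visible.\<close>

definition contrast :: "real \<Rightarrow> real \<Rightarrow> real" where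
  "contrast a b = (sqrt b - sqrt a) / (sqrt b + sqrt a)"

lemma contrast_measurable [measurable]:
  assumes [measurable]: "f \<in> borel_measurable M" "g \<in> borel_measurable M"
  shows "(\<lambda>x. contrast (f x) (g x)) \<in> borel_measurable M"
  unfolding contrast_def by measurable

lemma contrast_commute: "contrast b a = - contrast a b"
  unfolding contrast_def by (simp add: minus_divide_left add.commute)

lemma contrast_abs_le_1:
  assumes "0 \<le> a" "0 \<le> b"
  shows "\<bar>contrast a b\<bar> \<le> 1"
proof -
  have "0 \<le> sqrt a" "0 \<le> sqrt b" using assms by auto
  then show ?thesis unfolding contrast_def by (auto simp: abs_le_iff divide_le_eq_1 divide_simps)
qed

lemma contrast_mono:
  assumes "0 < a" "0 \<le> b" "b \<le> b'"
  shows "contrast a b \<le> contrast a b'"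
proof -
  define s u v where "s = sqrt a" "u = sqrt b" "v = sqrt b'"
  have s: "0 < s" "0 \<le> u" "u \<le> v" using assms by (auto simp: s_u_v_def)
  then have "0 \<le> s * (v - u)" by simp
  then have "(u - s) * (v + s) \<le> (v - s) * (u + s)" by (simp add: algebra_simps)
  moreover have "0 < u + s" "0 < v + s" using s by auto
  ultimately have "(u - s) / (u + s) \<le> (v - s) / (v + s)"
    by (simp add: pos_divide_le_eq pos_le_divide_eq)
  then show ?thesis by (simp add: contrast_def s_u_v_def)
qed

lemma contrast_increment_le:
  assumes a: "0 < a" and b: "0 \<le> b" "b \<le> b'"
  shows "contrast a b' - contrast a b \<le> 2 * sqrt ((b' - b) / a)"
proof -
  define s u v where "s = sqrt a" "u = sqrt b" "v = sqrt b'"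
  have s: "0 < s" "0 \<le> u" "u \<le> v" using assms by (auto simp: s_u_v_def)
  have "(v + s) * (u + s) \<ge> s * s" using s by (intro mult_mono) auto
  then have q: "2 * s * (v - u) / ((v + s) * (u + s)) \<le> 2 * s * (v - u) / (s * s)"
    using s by (intro divide_left_mono) auto
  have "contrast a b' - contrast a b = 2 * s * (v - u) / ((v + s) * (u + s))"
    using s unfolding contrast_def s_u_v_def[symmetric] by (simp add: divide_simps) (simp add: algebra_simps)
  also note q
  also have "2 * s * (v - u) / (s * s) = 2 * ((v - u) / s)" using s by simp
  also have "v - u \<le> sqrt (b' - b)"
  proof -
    have "v\<^sup>2 = b'" "u\<^sup>2 = b" using b by (simp_all add: s_u_v_def)
    moreover have "0 \<le> u * (v - u)" using s by simp
    then have "(v - u)\<^sup>2 \<le> v\<^sup>2 - u\<^sup>2" by (simp add: power2_eq_square algebra_simps)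
    ultimately show ?thesis by (simp add: real_le_rsqrt)
  qed
  finally show ?thesis using s by (simp add: real_sqrt_divide s_u_v_def divide_right_mono)
qed

text \<open>Expanded around \<open>s = (a + b) / 2\<close>, the weighted contrast has the leading term
\<open>(b\<^sup>2 - a\<^sup>2) / 4\<close>, which integrates to 0 for the square roots of two probability densities. With
\<open>m = (a + b) / 2\<close>, \<open>d = (b - a) / 2\<close>, \<open>e = s - a\<close> and \<open>\<theta> = d / m \<in> [- 1, 1]\<close>, the remainder is
\<open>2 d (e - d) + \<theta> (e - d)\<^sup>2 \<le> e\<^sup>2 - d\<^sup>2\<close>, and \<open>d\<close> is half the difference of \<open>s - a\<close> and \<open>s - b\<close>.\<close>

lemma contrast_pointwise:
  fixes a b s :: real
  assumes a: "0 \<le> a" "0 \<le> b" "0 \<le> s"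
  shows "(b - a) / (b + a) * s\<^sup>2 \<le> (b\<^sup>2 - a\<^sup>2) / 4 + (5 / 4 * (s - a)\<^sup>2 - 1 / 8 * (s - b)\<^sup>2)" (is ?A)
    and "((b - a) / (b + a))\<^sup>2 * s\<^sup>2 \<le> 7 * (s - a)\<^sup>2 + 3 * (s - b)\<^sup>2" (is ?B)
proof -
  define m d e \<theta> where "m = (a + b) / 2" "d = (b - a) / 2" "e = s - a" "\<theta> = (b - a) / (b + a)"
  have b: "b = a + 2 * d" and s: "s = a + e" and m: "m = a + d" by (simp_all add: m_d_e_\<theta>_def field_simps)
  have \<theta>m: "\<theta> * m = d"
  proof (cases "a + b = 0")
    case True
    then have "a = 0" "b = 0" using a by auto
    then show ?thesis by (simp add: m_d_e_\<theta>_def)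
  next
    case False
    then show ?thesis by (simp add: m_d_e_\<theta>_def field_simps)
  qed
  have \<theta>: "\<bar>\<theta>\<bar> \<le> 1" using a by (auto simp: m_d_e_\<theta>_def abs_le_iff divide_simps)
  have "\<theta> * s\<^sup>2 = \<theta> * m * m + 2 * (\<theta> * m) * (e - d) + \<theta> * (e - d)\<^sup>2"
    by (simp add: s m power2_eq_square algebra_simps)
  also have "\<theta> * (e - d)\<^sup>2 \<le> 1 * (e - d)\<^sup>2" using \<theta> by (intro mult_right_mono) auto
  finally have "\<theta> * s\<^sup>2 \<le> d * m + (e\<^sup>2 - d\<^sup>2)"
    unfolding \<theta>m by (simp add: power2_eq_square algebra_simps)
  also have "d * m = (b\<^sup>2 - a\<^sup>2) / 4" by (simp add: b m power2_eq_square field_simps)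
  also have "e\<^sup>2 - d\<^sup>2 \<le> 5 / 4 * (s - a)\<^sup>2 - 1 / 8 * (s - b)\<^sup>2"
  proof -
    have "0 \<le> (e + 2 * d)\<^sup>2" by simp
    then show ?thesis by (simp add: b s power2_eq_square field_simps)
  qed
  finally show ?A by (simp add: m_d_e_\<theta>_def)
  have "\<theta> * s = \<theta> * m + \<theta> * (e - d)" by (simp add: s m algebra_simps)
  then have "\<theta> * s = d + \<theta> * (e - d)" unfolding \<theta>m .
  moreover have "(x + y)\<^sup>2 \<le> 2 * x\<^sup>2 + 2 * y\<^sup>2" for x y :: real
    using sum_squares_bound[of x y] by (simp add: power2_sum)
  ultimately have "(\<theta> * s)\<^sup>2 \<le> 2 * d\<^sup>2 + 2 * (\<theta> * (e - d))\<^sup>2" by simp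
  also have "(\<theta> * (e - d))\<^sup>2 \<le> 1 * (e - d)\<^sup>2"
    unfolding power_mult_distrib using \<theta> by (intro mult_right_mono) (auto simp: abs_square_le_1)
  finally have "(\<theta> * s)\<^sup>2 \<le> 2 * d\<^sup>2 + 2 * (e - d)\<^sup>2" by simp
  also have "\<dots> \<le> 7 * (s - a)\<^sup>2 + 3 * (s - b)\<^sup>2"
  proof -
    have "0 \<le> 4 * (e - d)\<^sup>2 + 4 * d\<^sup>2" by simp
    also have "\<dots> \<le> (7 * e\<^sup>2 + 3 * (e - 2 * d)\<^sup>2) - (2 * d\<^sup>2 + 2 * (e - d)\<^sup>2)"
    proof -
      have "0 \<le> (2 * e - d)\<^sup>2" by simp
      then show ?thesis by (simp add: power2_eq_square algebra_simps)
    qed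
    finally show ?thesis by (simp add: b s power2_eq_square algebra_simps)
  qed
  finally show ?B by (simp add: m_d_e_\<theta>_def(4) power_mult_distrib power_divide)
qed

lemma
  fixes p q r :: "'a \<Rightarrow> real"
  assumes m [measurable]: "p \<in> borel_measurable \<nu>" "q \<in> borel_measurable \<nu>" "r \<in> borel_measurable \<nu>"
    and nn: "\<And>x. 0 \<le> p x" "\<And>x. 0 \<le> q x" "\<And>x. 0 \<le> r x"
    and prob: "prob_space (density \<nu> p)" "prob_space (density \<nu> q)" "prob_space (density \<nu> r)"
  shows expectation_contrast_le: "(\<integral>x. contrast (q x) (r x) * p x \<partial>\<nu>) \<le>
      5 / 2 * hellinger_sq (density \<nu> p) (density \<nu> q) - 1 / 4 * hellinger_sq (density \<nu> p) (density \<nu> r)"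
    and second_moment_contrast_le: "(\<integral>x. (contrast (q x) (r x))\<^sup>2 * p x \<partial>\<nu>) \<le>
      14 * hellinger_sq (density \<nu> p) (density \<nu> q) + 6 * hellinger_sq (density \<nu> p) (density \<nu> r)"
proof -
  note i = prob_density_integral[OF m(1) nn(1) prob(1)] prob_density_integral[OF m(2) nn(2) prob(2)]
    prob_density_integral[OF m(3) nn(3) prob(3)]
  have H: "(\<integral>x. (sqrt (p x) - sqrt (q x))\<^sup>2 \<partial>\<nu>) = 2 * hellinger_sq (density \<nu> p) (density \<nu> q)"
    "(\<integral>x. (sqrt (p x) - sqrt (r x))\<^sup>2 \<partial>\<nu>) = 2 * hellinger_sq (density \<nu> p) (density \<nu> r)"
    using hellinger_sq_density[OF m(1) m(2) nn(1) nn(2) prob(1) prob(2)]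
      hellinger_sq_density[OF m(1) m(3) nn(1) nn(3) prob(1) prob(3)] by simp_all
  note I = integrable_sqrt_diff_sq[OF i(1) i(3) nn(1) nn(2)]
    integrable_sqrt_diff_sq[OF i(1) i(5) nn(1) nn(3)]
  have b: "\<bar>contrast (q x) (r x)\<bar> \<le> 1" for x using nn by (intro contrast_abs_le_1) auto
  have b2: "(contrast (q x) (r x))\<^sup>2 \<le> 1" for x using b[of x] by (simp add: abs_square_le_1)
  have ic: "integrable \<nu> (\<lambda>x. contrast (q x) (r x) * p x)"
    by (rule Bochner_Integration.integrable_bound[OF i(1)])
      (use b nn in \<open>auto intro!: mult_left_le_one_le simp: abs_mult\<close>)
  have ic2: "integrable \<nu> (\<lambda>x. (contrast (q x) (r x))\<^sup>2 * p x)"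
    by (rule Bochner_Integration.integrable_bound[OF i(1)])
      (use b2 nn in \<open>auto intro!: mult_left_le_one_le simp: abs_mult\<close>)
  have "(\<integral>x. contrast (q x) (r x) * p x \<partial>\<nu>) \<le> (\<integral>x. 1 / 4 * (r x - q x) +
      (5 / 4 * (sqrt (p x) - sqrt (q x))\<^sup>2 - 1 / 8 * (sqrt (p x) - sqrt (r x))\<^sup>2) \<partial>\<nu>)"
  proof (intro integral_mono ic)
    fix x
    show "contrast (q x) (r x) * p x \<le> 1 / 4 * (r x - q x) +
      (5 / 4 * (sqrt (p x) - sqrt (q x))\<^sup>2 - 1 / 8 * (sqrt (p x) - sqrt (r x))\<^sup>2)"
      using contrast_pointwise(1)[of "sqrt (q x)" "sqrt (r x)" "sqrt (p x)"] nn[of x]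
      by (simp add: contrast_def)
  qed (intro Bochner_Integration.integrable_add Bochner_Integration.integrable_diff integrable_mult_right I i)
  also have "\<dots> = 1 / 4 * ((\<integral>x. r x \<partial>\<nu>) - (\<integral>x. q x \<partial>\<nu>)) +
      (5 / 4 * (\<integral>x. (sqrt (p x) - sqrt (q x))\<^sup>2 \<partial>\<nu>) - 1 / 8 * (\<integral>x. (sqrt (p x) - sqrt (r x))\<^sup>2 \<partial>\<nu>))"
    by (subst Bochner_Integration.integral_add)
      (use i I in \<open>auto intro!: Bochner_Integration.integrable_diff integrable_mult_right\<close>)
  finally show "(\<integral>x. contrast (q x) (r x) * p x \<partial>\<nu>) \<le>
      5 / 2 * hellinger_sq (density \<nu> p) (density \<nu> q) - 1 / 4 * hellinger_sq (density \<nu> p) (density \<nu> r)"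
    using i H by simp
  have "(\<integral>x. (contrast (q x) (r x))\<^sup>2 * p x \<partial>\<nu>) \<le> (\<integral>x. 7 * (sqrt (p x) - sqrt (q x))\<^sup>2 +
      3 * (sqrt (p x) - sqrt (r x))\<^sup>2 \<partial>\<nu>)"
  proof (intro integral_mono ic2)
    fix x
    show "(contrast (q x) (r x))\<^sup>2 * p x \<le> 7 * (sqrt (p x) - sqrt (q x))\<^sup>2 +
      3 * (sqrt (p x) - sqrt (r x))\<^sup>2"
      using contrast_pointwise(2)[of "sqrt (q x)" "sqrt (r x)" "sqrt (p x)"] nn[of x]
      by (simp add: contrast_def)
  qed (intro Bochner_Integration.integrable_add integrable_mult_right I)
  also have "\<dots> = 7 * (\<integral>x. (sqrt (p x) - sqrt (q x))\<^sup>2 \<partial>\<nu>) + 3 * (\<integral>x. (sqrt (p x) - sqrt (r x))\<^sup>2 \<partial>\<nu>)"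
    by (subst Bochner_Integration.integral_add) (use I in auto)
  finally show "(\<integral>x. (contrast (q x) (r x))\<^sup>2 * p x \<partial>\<nu>) \<le>
      14 * hellinger_sq (density \<nu> p) (density \<nu> q) + 6 * hellinger_sq (density \<nu> p) (density \<nu> r)"
    using H by simp
qed

section \<open>Chernoff bounds for sums over a sample\<close>

lemma exp_le_quadratic:
  fixes y :: real
  assumes "\<bar>y\<bar> \<le> 1"
  shows "exp y \<le> 1 + y + y\<^sup>2"
proof (cases "0 \<le> y")
  case True
  then show ?thesis using exp_bound[of y] assms by simp
next
  case False
  define x where "x = - y"
  have x: "0 \<le> x" using False by (simp add: x_def)
  have "1 \<le> (1 - x + x\<^sup>2) * (1 + x + x\<^sup>2 / 2)"
  proof -
    have "(1 - x + x\<^sup>2) * (1 + x + x\<^sup>2 / 2) = 1 + (x\<^sup>2 / 2 + x ^ 3 / 2 + x ^ 4 / 2)"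
      by (simp add: field_simps power2_eq_square power3_eq_cube power4_eq_xxxx)
    then show ?thesis using x by simp
  qed
  also have "\<dots> \<le> (1 - x + x\<^sup>2) * exp x"
  proof (rule mult_left_mono)
    show "1 + x + x\<^sup>2 / 2 \<le> exp x" by (rule exp_lower_Taylor_quadratic[OF x])
    have "0 \<le> (x - 1 / 2)\<^sup>2" by simp
    then show "0 \<le> 1 - x + x\<^sup>2" by (simp add: power2_eq_square algebra_simps)
  qed
  finally have "exp (- x) \<le> 1 - x + x\<^sup>2"
    by (simp add: exp_minus divide_simps)
  then show ?thesis by (simp add: x_def)
qed

text \<open>Bernstein's inequality in exponential form. For a variable in \<open>[- 1, 1]\<close> the quadratic bound on
\<open>exp\<close> replaces the variance by the second moment, which is what the Hellinger distances control.\<close>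

lemma chernoff_sum:
  fixes F :: "'a \<Rightarrow> real" and I :: "'i set"
  assumes P: "prob_space P" and F [measurable]: "F \<in> borel_measurable P"
    and bd: "\<And>x. \<bar>F x\<bar> \<le> 1" and I: "finite I" and l: "0 < l" "l \<le> 1"
  defines "\<Omega> \<equiv> \<Pi>\<^sub>M i\<in>I. P"
  shows "measure \<Omega> {x \<in> space \<Omega>. real (card I) * ((\<integral>x. F x \<partial>P) + l * (\<integral>x. (F x)\<^sup>2 \<partial>P)) + t / l
      \<le> (\<Sum>i\<in>I. F (x i))} \<le> exp (- t)"
proof -
  interpret P: prob_space P by fact
  interpret pp: product_prob_space "\<lambda>_. P" I
    by unfold_locales
  define thr where "thr = real (card I) * ((\<integral>x. F x \<partial>P) + l * (\<integral>x. (F x)\<^sup>2 \<partial>P)) + t / l"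
  interpret \<Omega>: prob_space \<Omega> unfolding \<Omega>_def by (rule prob_space_PiM) (rule P)
  have [measurable]: "(\<lambda>x. F (x i)) \<in> borel_measurable \<Omega>" if "i \<in> I" for i
    unfolding \<Omega>_def using that by measurable
  have Sm [measurable]: "(\<lambda>x. \<Sum>i\<in>I. F (x i)) \<in> borel_measurable \<Omega>" by measurable
  have bd2: "(F x)\<^sup>2 \<le> 1" for x using bd[of x] by (simp add: abs_square_le_1)
  have iF: "integrable P F" using bd by (intro P.integrable_const_bound[where B=1]) auto
  have iF2: "integrable P (\<lambda>x. (F x)\<^sup>2)" using bd2 by (intro P.integrable_const_bound[where B=1]) auto
  have ie: "integrable P (\<lambda>x. exp (l * F x))"
  proof (rule P.integrable_const_bound[where B="exp l"])
    show "AE x in P. norm (exp (l * F x)) \<le> exp l"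
      using bd l by (auto simp: abs_le_iff)
  qed measurable
  have one: "(\<integral>x. exp (l * F x) \<partial>P) \<le> exp (l * ((\<integral>x. F x \<partial>P) + l * (\<integral>x. (F x)\<^sup>2 \<partial>P)))"
  proof -
    have "(\<integral>x. exp (l * F x) \<partial>P) \<le> (\<integral>x. 1 + (l * F x + l\<^sup>2 * (F x)\<^sup>2) \<partial>P)"
    proof (intro integral_mono ie)
      fix x
      have "\<bar>l * F x\<bar> \<le> 1" using bd[of x] l by (simp add: abs_mult mult_le_one)
      from exp_le_quadratic[OF this] show "exp (l * F x) \<le> 1 + (l * F x + l\<^sup>2 * (F x)\<^sup>2)"
        by (simp add: power_mult_distrib)
    qed (use iF iF2 in auto)
    also have "\<dots> = 1 + (l * (\<integral>x. F x \<partial>P) + l\<^sup>2 * (\<integral>x. (F x)\<^sup>2 \<partial>P))"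
      using iF iF2 by (simp add: P.prob_space)
    also have "\<dots> \<le> exp (l * (\<integral>x. F x \<partial>P) + l\<^sup>2 * (\<integral>x. (F x)\<^sup>2 \<partial>P))" by (rule exp_ge_add_one_self)
    finally show ?thesis by (simp add: power2_eq_square algebra_simps)
  qed
  have iS: "integrable \<Omega> (\<lambda>x. exp (l * (\<Sum>i\<in>I. F (x i))))"
  proof (rule \<Omega>.integrable_const_bound[where B="exp (l * real (card I))"])
    have "(\<Sum>i\<in>I. F (x i)) \<le> real (card I)" for x
      using sum_bounded_above[of I "\<lambda>i. F (x i)" 1] bd by (simp add: abs_le_iff)
    then show "AE x in \<Omega>. norm (exp (l * (\<Sum>i\<in>I. F (x i)))) \<le> exp (l * real (card I))"
      using l by auto
  qed measurable
  have "measure \<Omega> {x \<in> space \<Omega>. thr \<le> (\<Sum>i\<in>I. F (x i))}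
      = measure \<Omega> {x \<in> space \<Omega>. exp (l * thr) \<le> exp (l * (\<Sum>i\<in>I. F (x i)))}"
    using l by simp
  also have "\<dots> \<le> (\<integral>x. exp (l * (\<Sum>i\<in>I. F (x i))) \<partial>\<Omega>) / exp (l * thr)"
    by (rule integral_Markov_inequality_measure[where A="{}"]) (use iS in auto)
  also have "(\<integral>x. exp (l * (\<Sum>i\<in>I. F (x i))) \<partial>\<Omega>) = (\<integral>x. (\<Prod>i\<in>I. exp (l * F (x i))) \<partial>\<Omega>)"
    using I by (simp add: sum_distrib_left exp_sum)
  also have "\<dots> = (\<Prod>i\<in>I. \<integral>x. exp (l * F x) \<partial>P)"
    unfolding \<Omega>_def by (rule pp.product_integral_prod[OF I]) (rule ie)
  also have "\<dots> \<le> (\<Prod>i\<in>I. exp (l * ((\<integral>x. F x \<partial>P) + l * (\<integral>x. (F x)\<^sup>2 \<partial>P))))"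
    using one by (intro prod_mono) auto
  also have "\<dots> = exp (l * thr - t)"
    using l by (simp add: thr_def exp_of_nat_mult[symmetric] algebra_simps)
  also have "\<dots> / exp (l * thr) = exp (- t)" by (simp add: exp_diff exp_minus field_simps)
  finally show ?thesis by (simp add: thr_def divide_right_mono)
qed

lemma simultaneous_chernoff:
  fixes F :: "'j \<Rightarrow> 'a \<Rightarrow> real" and I :: "'i set"
  assumes P: "prob_space P" and F [measurable]: "\<And>j. j \<in> J \<Longrightarrow> F j \<in> borel_measurable P"
    and bd: "\<And>j x. j \<in> J \<Longrightarrow> \<bar>F j x\<bar> \<le> 1" and I: "finite I" and J: "finite J"
    and l: "0 < l" "l \<le> 1" and t: "(\<Sum>j\<in>J. exp (- t j)) \<le> \<eta>"
  defines "\<Omega> \<equiv> \<Pi>\<^sub>M i\<in>I. P"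
  shows "\<exists>G\<in>sets \<Omega>. 1 - \<eta> \<le> measure \<Omega> G \<and> (\<forall>x\<in>G. \<forall>j\<in>J. (\<Sum>i\<in>I. F j (x i)) \<le>
      real (card I) * ((\<integral>x. F j x \<partial>P) + l * (\<integral>x. (F j x)\<^sup>2 \<partial>P)) + t j / l)"
proof -
  interpret \<Omega>: prob_space \<Omega> unfolding \<Omega>_def by (rule prob_space_PiM) (rule P)
  define thr where "thr j = real (card I) * ((\<integral>x. F j x \<partial>P) + l * (\<integral>x. (F j x)\<^sup>2 \<partial>P)) + t j / l" for j
  define B where "B j = {x \<in> space \<Omega>. thr j \<le> (\<Sum>i\<in>I. F j (x i))}" for j
  have Bm: "B j \<in> sets \<Omega>" if "j \<in> J" for j
  proof -
    have [measurable]: "F j \<in> borel_measurable P" using that by (rule F)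
    have [measurable]: "(\<lambda>x. F j (x i)) \<in> borel_measurable \<Omega>" if "i \<in> I" for i
      unfolding \<Omega>_def using that by measurable
    show ?thesis unfolding B_def by measurable
  qed
  define G where "G = space \<Omega> - (\<Union>j\<in>J. B j)"
  have U: "(\<Union>j\<in>J. B j) \<in> sets \<Omega>" using Bm J by auto
  have "measure \<Omega> (\<Union>j\<in>J. B j) \<le> (\<Sum>j\<in>J. measure \<Omega> (B j))"
    by (rule \<Omega>.finite_measure_subadditive_finite) (use Bm J in auto)
  also have "\<dots> \<le> (\<Sum>j\<in>J. exp (- t j))"
    unfolding B_def thr_def \<Omega>_def using P F bd I l by (intro sum_mono chernoff_sum) auto
  finally have "1 - \<eta> \<le> measure \<Omega> G" using t U by (simp add: G_def \<Omega>.prob_compl)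
  moreover have "G \<in> sets \<Omega>" using U by (simp add: G_def)
  moreover have "(\<Sum>i\<in>I. F j (x i)) \<le> thr j" if "x \<in> G" "j \<in> J" for x j
    using that by (auto simp: G_def B_def not_le)
  ultimately show ?thesis unfolding thr_def by blast
qed

section \<open>One-sided brackets for Gaussian densities\<close>

lemma normal_density_le_inverse:
  assumes "0 < \<sigma>"
  shows "normal_density z \<sigma> x \<le> 1 / \<sigma>"
proof -
  have "1 * \<sigma>\<^sup>2 \<le> 2 * pi * \<sigma>\<^sup>2" using pi_gt3 by (intro mult_right_mono) auto
  then have "\<sigma> \<le> sqrt (2 * pi * \<sigma>\<^sup>2)" by (intro real_le_rsqrt) simp
  then have "1 / sqrt (2 * pi * \<sigma>\<^sup>2) * exp (- (x - z)\<^sup>2 / (2 * \<sigma>\<^sup>2)) \<le> 1 / \<sigma> * 1"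
    using assms by (intro mult_mono divide_left_mono) auto
  then show ?thesis by (simp add: normal_density_def)
qed

text \<open>From \<open>exp (- y) \<le> 1 / y\<close>: at a fixed distance from the mean the density is small whenever
the scale is small, and for any bounded scale it is small far from the mean.\<close>

lemma normal_density_tail_le:
  assumes s: "0 < \<sigma>" and d: "0 < d" "d \<le> \<bar>x - z\<bar>"
  shows "normal_density z \<sigma> x \<le> 2 * \<sigma> / d\<^sup>2"
proof -
  define y where "y = (x - z)\<^sup>2 / (2 * \<sigma>\<^sup>2)"
  have d2: "d\<^sup>2 \<le> (x - z)\<^sup>2" using d by (metis abs_le_square_iff abs_of_pos)
  have dp: "0 < d\<^sup>2" using d by simp
  have y: "d\<^sup>2 / (2 * \<sigma>\<^sup>2) \<le> y" unfolding y_def using d2 by (intro divide_right_mono) auto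
  have y0: "0 < d\<^sup>2 / (2 * \<sigma>\<^sup>2)" using s dp by simp
  have "y \<le> exp y" using exp_ge_add_one_self[of y] by linarith
  then have "exp (- y) \<le> 1 / y" using y y0 by (simp add: exp_minus inverse_eq_divide frac_le)
  also have "1 / y \<le> 1 / (d\<^sup>2 / (2 * \<sigma>\<^sup>2))" by (rule frac_le) (use y y0 in simp_all)
  also have "\<dots> = 2 * \<sigma>\<^sup>2 / d\<^sup>2" by simp
  finally have e: "exp (- y) \<le> 2 * \<sigma>\<^sup>2 / d\<^sup>2" .
  have "1 * \<sigma>\<^sup>2 \<le> 2 * pi * \<sigma>\<^sup>2" using pi_gt3 by (intro mult_right_mono) auto
  then have "\<sigma> \<le> sqrt (2 * pi * \<sigma>\<^sup>2)" by (intro real_le_rsqrt) simp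
  then have "1 / sqrt (2 * pi * \<sigma>\<^sup>2) * exp (- y) \<le> 1 / \<sigma> * (2 * \<sigma>\<^sup>2 / d\<^sup>2)"
    using s e by (intro mult_mono divide_left_mono) auto
  also have "\<dots> = 2 * \<sigma> / d\<^sup>2" using s by (simp add: power2_eq_square)
  finally show ?thesis by (simp add: normal_density_def y_def)
qed

lemma exp_neg_half_square_lipschitz:
  fixes s t :: real
  shows "\<bar>exp (- s\<^sup>2 / 2) - exp (- t\<^sup>2 / 2)\<bar> \<le> \<bar>s - t\<bar>"
proof -
  have "norm (exp (- s\<^sup>2 / 2) - exp (- t\<^sup>2 / 2)) \<le> 1 * norm (s - t)"
  proof (rule field_differentiable_bound[where S=UNIV and f'="\<lambda>u. - u * exp (- u\<^sup>2 / 2)"])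
    fix u :: real
    show "((\<lambda>u. exp (- u\<^sup>2 / 2)) has_field_derivative - u * exp (- u\<^sup>2 / 2)) (at u within UNIV)"
      by (auto intro!: derivative_eq_intros)
    have "0 \<le> (\<bar>u\<bar> - 1)\<^sup>2" by simp
    then have "\<bar>u\<bar> \<le> 1 + u\<^sup>2 / 2" by (simp add: power2_diff)
    also have "\<dots> \<le> exp (u\<^sup>2 / 2)" by (rule exp_ge_add_one_self)
    finally show "norm (- u * exp (- u\<^sup>2 / 2)) \<le> 1"
      by (simp add: abs_mult exp_minus divide_simps)
  qed auto
  then show ?thesis by simp
qed

lemma normal_density_lipschitz:
  assumes A: "0 < A" and s: "1 / A \<le> \<sigma>" "1 / A \<le> \<sigma>'" and R: "\<bar>x - z\<bar> \<le> R"
  shows "\<bar>normal_density z \<sigma> x - normal_density z' \<sigma>' x\<bar> \<le>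
    \<bar>\<sigma> - \<sigma>'\<bar> * A\<^sup>2 + A * (R * (\<bar>\<sigma> - \<sigma>'\<bar> * A\<^sup>2) + \<bar>z - z'\<bar> * A)"
proof -
  have "0 < 1 / A" using A by simp
  then have sp: "0 < \<sigma>" "0 < \<sigma>'" using s by linarith+
  have inv: "1 / \<sigma> \<le> A" "1 / \<sigma>' \<le> A" using s sp A by (simp_all add: field_simps)
  define u v where "u = (x - z) / \<sigma>" and "v = (x - z') / \<sigma>'"
  define e where "e = (\<lambda>s::real. exp (- s\<^sup>2 / 2))"
  define c where "c = 1 / sqrt (2 * pi)"
  have c: "0 \<le> c" "c \<le> 1"
  proof -
    have "1 \<le> sqrt (2 * pi)" using pi_gt3 by (intro real_le_rsqrt) simp
    then show "c \<le> 1" "0 \<le> c" by (simp_all add: c_def)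
  qed
  have phi: "normal_density z \<sigma> x = c * (1 / \<sigma> * e u)" "normal_density z' \<sigma>' x = c * (1 / \<sigma>' * e v)"
    using sp by (simp_all add: normal_density_def c_def e_def u_def v_def real_sqrt_mult power_divide)
  have e: "0 \<le> e u" "e u \<le> 1" by (simp_all add: e_def)
  have dinv: "\<bar>1 / \<sigma> - 1 / \<sigma>'\<bar> \<le> \<bar>\<sigma> - \<sigma>'\<bar> * A\<^sup>2"
  proof -
    have "1 / \<sigma> - 1 / \<sigma>' = (\<sigma>' - \<sigma>) * (1 / \<sigma> * (1 / \<sigma>'))" using sp by (simp add: field_simps)
    then have "\<bar>1 / \<sigma> - 1 / \<sigma>'\<bar> = \<bar>\<sigma> - \<sigma>'\<bar> * (1 / \<sigma> * (1 / \<sigma>'))"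
      using sp by (simp add: abs_mult abs_minus_commute)
    also have "\<dots> \<le> \<bar>\<sigma> - \<sigma>'\<bar> * (A * A)" using inv sp A by (intro mult_left_mono mult_mono) auto
    finally show ?thesis by (simp add: power2_eq_square)
  qed
  have uv: "\<bar>u - v\<bar> \<le> R * (\<bar>\<sigma> - \<sigma>'\<bar> * A\<^sup>2) + \<bar>z - z'\<bar> * A"
  proof -
    have "u - v = (x - z) * (1 / \<sigma> - 1 / \<sigma>') + (z' - z) * (1 / \<sigma>')"
      using sp by (simp add: u_def v_def field_simps)
    then have "\<bar>u - v\<bar> \<le> \<bar>x - z\<bar> * \<bar>1 / \<sigma> - 1 / \<sigma>'\<bar> + \<bar>z - z'\<bar> * (1 / \<sigma>')"
      using sp by (metis abs_mult abs_triangle_ineq abs_minus_commute abs_of_pos zero_less_divide_1_iff)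
    also have "\<dots> \<le> R * (\<bar>\<sigma> - \<sigma>'\<bar> * A\<^sup>2) + \<bar>z - z'\<bar> * A"
      using R dinv inv sp by (intro add_mono mult_mono) auto
    finally show ?thesis .
  qed
  have "normal_density z \<sigma> x - normal_density z' \<sigma>' x =
      c * ((1 / \<sigma> - 1 / \<sigma>') * e u + 1 / \<sigma>' * (e u - e v))"
    unfolding phi by (simp add: algebra_simps)
  then have "\<bar>normal_density z \<sigma> x - normal_density z' \<sigma>' x\<bar> =
      c * \<bar>(1 / \<sigma> - 1 / \<sigma>') * e u + 1 / \<sigma>' * (e u - e v)\<bar>" using c by (simp add: abs_mult)
  also have "\<dots> \<le> 1 * (\<bar>1 / \<sigma> - 1 / \<sigma>'\<bar> * e u + 1 / \<sigma>' * \<bar>e u - e v\<bar>)"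
  proof (intro mult_mono c)
    show "\<bar>(1 / \<sigma> - 1 / \<sigma>') * e u + 1 / \<sigma>' * (e u - e v)\<bar> \<le> \<bar>1 / \<sigma> - 1 / \<sigma>'\<bar> * e u + 1 / \<sigma>' * \<bar>e u - e v\<bar>"
      using sp e abs_triangle_ineq[of "(1 / \<sigma> - 1 / \<sigma>') * e u" "1 / \<sigma>' * (e u - e v)"]
      by (simp add: abs_mult)
  qed auto
  also have "\<dots> \<le> \<bar>\<sigma> - \<sigma>'\<bar> * A\<^sup>2 * 1 + A * (R * (\<bar>\<sigma> - \<sigma>'\<bar> * A\<^sup>2) + \<bar>z - z'\<bar> * A)"
    unfolding mult_1
  proof (intro add_mono mult_mono dinv e inv)
    show "\<bar>e u - e v\<bar> \<le> R * (\<bar>\<sigma> - \<sigma>'\<bar> * A\<^sup>2) + \<bar>z - z'\<bar> * A"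
      using exp_neg_half_square_lipschitz[of u v] uv by (simp add: e_def)
  qed (use A in auto)
  finally show ?thesis by simp
qed

definition grid_mean :: "nat \<Rightarrow> nat \<Rightarrow> real" where
  "grid_mean n i = real i / real n ^ 56 - real n ^ 9"

definition grid_scale :: "nat \<Rightarrow> nat \<Rightarrow> real" where
  "grid_scale n j = real j / real n ^ 56"

text \<open>The grid has mesh \<open>n\<^sup>-\<^sup>5\<^sup>6\<close>. The added \<open>n\<^sup>-\<^sup>7\<close> makes a nearby grid density an upper bound, and the
index \<open>j = 0\<close> stands for densities that are themselves below \<open>n\<^sup>-\<^sup>7\<close>.\<close>

definition gaussian_bracket :: "nat \<Rightarrow> nat \<Rightarrow> nat \<Rightarrow> real \<Rightarrow> real" where
  "gaussian_bracket n i j x =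
    (if j = 0 then 0 else normal_density (grid_mean n i) (grid_scale n j) x) + 1 / real n ^ 7"

text \<open>A Gaussian with scale at least \<open>n\<^sup>7\<close>, or with mean outside \<open>[- n\<^sup>9, n\<^sup>9]\<close> and a smaller scale, is below \<open>n\<^sup>-\<^sup>7\<close> on
\<open>[- n, n]\<close>. One with scale at most \<open>n\<^sup>-\<^sup>1\<^sup>2\<close> is below \<open>n\<^sup>-\<^sup>7\<close> at distance \<open>n\<^sup>-\<^sup>2\<close> from its mean.
The remaining parameters form a polynomially large box on which the density is
Lipschitz with a constant polynomial in \<open>n\<close>.\<close>

lemma gaussian_bracket_exists:
  assumes n: "2 \<le> n" and s: "0 < \<sigma>"
  shows "\<exists>i<n ^ 70. \<exists>j<n ^ 70. \<forall>x. \<bar>x\<bar> \<le> real n \<longrightarrow> 2 / (real n)\<^sup>2 \<le> \<bar>x - grid_mean n i\<bar> \<longrightarrow>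
    normal_density z \<sigma> x \<le> gaussian_bracket n i j x \<and>
    gaussian_bracket n i j x \<le> normal_density z \<sigma> x + 2 / real n ^ 7 \<and>
    gaussian_bracket n i j x \<le> real n ^ 13"
proof -
  define N where "N = real n"
  define h where "h = 1 / N ^ 56"
  have N: "2 \<le> N" using n by (simp add: N_def)
  have N0 [simp]: "0 < N" "N \<noteq> 0" "0 \<le> N" using N by auto
  have Np [simp]: "0 < N ^ k" for k by simp
  have pw: "N ^ a \<le> N ^ b" if "a \<le> b" for a b using N that by (intro power_increasing) auto
  have pwi: "1 / N ^ b \<le> 1 / N ^ a" if "a \<le> b" for a b
    using pw[OF that] by (intro divide_left_mono) auto
  have hp: "0 < h" unfolding h_def using Np[of 56] by (intro divide_pos_pos) auto
  have small7: "1 / N ^ 7 \<le> N ^ 13"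
  proof -
    have "1 / N ^ 7 \<le> 1 / N ^ 0" by (rule pwi) simp
    also have "\<dots> \<le> N ^ 13" using pw[of 0 13] by simp
    finally show ?thesis .
  qed
  define B where "B i j x \<longleftrightarrow> normal_density z \<sigma> x \<le> gaussian_bracket n i j x \<and>
    gaussian_bracket n i j x \<le> normal_density z \<sigma> x + 2 / N ^ 7 \<and>
    gaussian_bracket n i j x \<le> N ^ 13" for i j x
  have goal: ?thesis if "i < n ^ 70" "j < n ^ 70"
    "\<And>x. \<bar>x\<bar> \<le> N \<Longrightarrow> 2 / N\<^sup>2 \<le> \<bar>x - grid_mean n i\<bar> \<Longrightarrow> B i j x" for i j
    using that unfolding B_def N_def by blast
  have neg: "B i 0 x" if "normal_density z \<sigma> x \<le> 1 / N ^ 7" for i x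
  proof -
    have "1 / N ^ 7 \<le> normal_density z \<sigma> x + (1 / N ^ 7 + 1 / N ^ 7)"
      using Np[of 7] by (intro add_increasing add_nonneg_nonneg) auto
    then show ?thesis using that small7 unfolding B_def gaussian_bracket_def N_def[symmetric] by simp
  qed
  have zero: "0 < n ^ 70" using n by simp
  consider "N ^ 7 \<le> \<sigma>" | "\<sigma> < N ^ 7" "N ^ 9 \<le> \<bar>z\<bar>" | "\<sigma> < N ^ 7" "\<bar>z\<bar> < N ^ 9" by linarith
  then show ?thesis
  proof cases
    case 1
    have "normal_density z \<sigma> x \<le> 1 / N ^ 7" for x
    proof -
      have "normal_density z \<sigma> x \<le> 1 / \<sigma>" by (rule normal_density_le_inverse[OF s])
      also have "\<dots> \<le> 1 / N ^ 7" using 1 by (intro frac_le) auto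
      finally show ?thesis .
    qed
    then show ?thesis by (intro goal[OF zero zero] neg)
  next
    case 2
    have "normal_density z \<sigma> x \<le> 1 / N ^ 7" if x: "\<bar>x\<bar> \<le> N" for x
    proof -
      have "2 * N ^ 8 \<le> N * N ^ 8" by (rule mult_right_mono[OF N]) simp
      moreover have "N \<le> N ^ 8" using pw[of 1 8] by simp
      moreover have "N ^ 9 = N * N ^ 8" by (simp add: power_Suc[symmetric] del: power_Suc)
      ultimately have "N ^ 8 \<le> \<bar>x - z\<bar>" using 2 x by linarith
      then have "normal_density z \<sigma> x \<le> 2 * \<sigma> / (N ^ 8)\<^sup>2"
        by (intro normal_density_tail_le s) auto
      also have "\<dots> \<le> N * N ^ 7 / (N ^ 8)\<^sup>2"
        using 2 N s by (intro divide_right_mono mult_mono) auto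
      also have "N * N ^ 7 = N ^ 8" by (simp flip: power_Suc)
      also have "N ^ 8 / (N ^ 8)\<^sup>2 = 1 / N ^ 8" by (simp add: divide_simps flip: power_add power_mult)
      also have "\<dots> \<le> 1 / N ^ 7" by (rule pwi) simp
      finally show ?thesis .
    qed
    then show ?thesis by (intro goal[OF zero zero] neg)
  next
    case 3
    define i where "i = nat \<lfloor>(z + N ^ 9) * N ^ 56\<rfloor>"
    have zi: "0 \<le> (z + N ^ 9) * N ^ 56" using 3 by (intro mult_nonneg_nonneg) (auto simp: abs_less_iff less_eq_real_def)
    have ri: "real i = of_int \<lfloor>(z + N ^ 9) * N ^ 56\<rfloor>" unfolding i_def using zi by simp
    have i1: "real i \<le> (z + N ^ 9) * N ^ 56" "(z + N ^ 9) * N ^ 56 < real i + 1"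
      unfolding ri by linarith+
    have il: "i < n ^ 70"
    proof -
      have "real i \<le> (z + N ^ 9) * N ^ 56" by (rule i1)
      also have "\<dots> < (N ^ 9 + N ^ 9) * N ^ 56" using 3 by (intro mult_strict_right_mono) auto
      also have "\<dots> = 2 * N ^ 65" by (simp add: power_add[symmetric])
      also have "\<dots> \<le> N * N ^ 65" using N by (intro mult_right_mono) auto
      also have "\<dots> = N ^ 66" by (simp add: power_Suc[symmetric] del: power_Suc)
      also have "\<dots> \<le> N ^ 70" by (rule pw) simp
      finally have "real i < real (n ^ 70)" by (simp add: N_def)
      then show ?thesis by (simp only: of_nat_less_iff)
    qed
    have zd: "\<bar>z - grid_mean n i\<bar> \<le> h"
    proof -
      have "z - grid_mean n i = ((z + N ^ 9) * N ^ 56 - real i) / N ^ 56"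
        by (simp add: grid_mean_def N_def[symmetric] diff_divide_distrib)
      then show ?thesis using i1 by (simp add: h_def abs_of_nonneg divide_right_mono)
    qed
    have hN: "h \<le> 1 / N ^ 2" unfolding h_def by (rule pwi) simp
    show ?thesis
    proof (cases "\<sigma> \<le> 1 / N ^ 12")
      case True
      have "normal_density z \<sigma> x \<le> 1 / N ^ 7" if x: "2 / N\<^sup>2 \<le> \<bar>x - grid_mean n i\<bar>" for x
      proof -
        have "1 / N\<^sup>2 \<le> \<bar>x - z\<bar>" using x zd hN by simp
        then have "normal_density z \<sigma> x \<le> 2 * \<sigma> / (1 / N\<^sup>2)\<^sup>2"
          using N by (intro normal_density_tail_le s) auto
        also have "\<dots> \<le> N * (1 / N ^ 12) / (1 / N\<^sup>2)\<^sup>2"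
          using True N s by (intro divide_right_mono mult_mono) auto
        also have "\<dots> = N ^ 5 / N ^ 12" by (simp add: power_one_over flip: power_Suc power_mult)
        also have "\<dots> = 1 / N ^ 7" by (simp add: divide_simps flip: power_add)
        finally show ?thesis .
      qed
      then show ?thesis by (intro goal[OF il zero] neg)
    next
      case False
      define j where "j = nat \<lceil>\<sigma> * N ^ 56\<rceil>"
      have sj: "0 < \<sigma> * N ^ 56" using s by simp
      have rj: "real j = of_int \<lceil>\<sigma> * N ^ 56\<rceil>" unfolding j_def using sj by simp
      have j1: "\<sigma> * N ^ 56 \<le> real j" "real j < \<sigma> * N ^ 56 + 1" unfolding rj by linarith+
      have j0: "j \<noteq> 0" using j1 sj by (intro notI) simp
      have jl: "j < n ^ 70"
      proof -
        have "real j < \<sigma> * N ^ 56 + 1" by (rule j1)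
        also have "\<dots> \<le> N ^ 7 * N ^ 56 + N ^ 63" using 3 pw[of 0 63] by (intro add_mono mult_right_mono) auto
        also have "\<dots> = 2 * N ^ 63" by (simp add: power_add[symmetric])
        also have "\<dots> \<le> N * N ^ 63" using N by (intro mult_right_mono) auto
        also have "\<dots> = N ^ 64" by (simp add: power_Suc[symmetric] del: power_Suc)
        also have "\<dots> \<le> N ^ 70" by (rule pw) simp
        finally have "real j < real (n ^ 70)" by (simp add: N_def)
        then show ?thesis by (simp only: of_nat_less_iff)
      qed
      have sd: "\<sigma> \<le> grid_scale n j" "\<bar>\<sigma> - grid_scale n j\<bar> \<le> h"
      proof -
        have "grid_scale n j - \<sigma> = (real j - \<sigma> * N ^ 56) / N ^ 56"
          by (simp add: grid_scale_def N_def[symmetric] diff_divide_distrib)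
        then have "0 \<le> grid_scale n j - \<sigma>" "grid_scale n j - \<sigma> \<le> h"
          using j1 by (simp_all add: h_def divide_right_mono)
        then show "\<sigma> \<le> grid_scale n j" "\<bar>\<sigma> - grid_scale n j\<bar> \<le> h" by simp_all
      qed
      have inv: "1 / N ^ 12 \<le> \<sigma>" "1 / N ^ 12 \<le> grid_scale n j" using False sd by linarith+
      have gs: "0 < grid_scale n j" using sd s by simp
      have "B i j x" if x: "\<bar>x\<bar> \<le> N" for x
      proof -
        have R: "\<bar>x - z\<bar> \<le> N ^ 10"
        proof -
          have "2 * N ^ 9 \<le> N * N ^ 9" by (rule mult_right_mono[OF N]) simp
          moreover have "N \<le> N ^ 9" using pw[of 1 9] by simp
          moreover have "N ^ 10 = N * N ^ 9" by (simp add: power_Suc[symmetric] del: power_Suc)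
          ultimately show ?thesis using 3 x by linarith
        qed
        have "\<bar>normal_density z \<sigma> x - normal_density (grid_mean n i) (grid_scale n j) x\<bar> \<le>
            \<bar>\<sigma> - grid_scale n j\<bar> * (N ^ 12)\<^sup>2 +
            N ^ 12 * (N ^ 10 * (\<bar>\<sigma> - grid_scale n j\<bar> * (N ^ 12)\<^sup>2) + \<bar>z - grid_mean n i\<bar> * N ^ 12)"
          by (rule normal_density_lipschitz[OF _ inv R]) simp
        also have "\<dots> \<le> h * (N ^ 12)\<^sup>2 + N ^ 12 * (N ^ 10 * (h * (N ^ 12)\<^sup>2) + h * N ^ 12)"
          using sd zd N by (intro add_mono mult_left_mono mult_right_mono) auto
        also have "\<dots> = h * (N ^ 24 + N ^ 46 + N ^ 24)"
          by (simp add: power_mult[symmetric] algebra_simps flip: power_add)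
        also have "\<dots> \<le> h * (N ^ 46 + N ^ 46 + N ^ 46)"
          using hp by (intro mult_left_mono add_mono pw) auto
        also have "\<dots> = 3 / N ^ 10" by (simp add: h_def divide_simps flip: power_add)
        also have "\<dots> \<le> N\<^sup>2 / N ^ 10"
        proof (rule divide_right_mono)
          have "2\<^sup>2 \<le> N\<^sup>2" using N by (intro power_mono) auto
          then show "3 \<le> N\<^sup>2" by simp
        qed (use N in simp)
        also have "\<dots> = 1 / N ^ 8" by (simp add: divide_simps flip: power_add)
        also have "\<dots> \<le> 1 / N ^ 7" by (rule pwi) simp
        finally have D: "\<bar>normal_density z \<sigma> x - normal_density (grid_mean n i) (grid_scale n j) x\<bar> \<le> 1 / N ^ 7" .
        have "normal_density (grid_mean n i) (grid_scale n j) x \<le> 1 / grid_scale n j"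
          by (rule normal_density_le_inverse[OF gs])
        also have "\<dots> \<le> N ^ 12" using inv gs N by (simp add: field_simps)
        finally have U: "normal_density (grid_mean n i) (grid_scale n j) x \<le> N ^ 12" .
        have "2 * N ^ 12 \<le> N * N ^ 12" by (rule mult_right_mono[OF N]) simp
        then have "2 * N ^ 12 \<le> N ^ 13" by (simp add: power_Suc[symmetric] del: power_Suc)
        moreover have "1 / N ^ 7 \<le> N ^ 12"
        proof -
          have "1 / N ^ 7 \<le> 1 / N ^ 0" by (rule pwi) simp
          also have "\<dots> \<le> N ^ 12" using pw[of 0 12] by simp
          finally show ?thesis .
        qed
        moreover have "2 / N ^ 7 = 2 * (1 / N ^ 7)" by simp
        ultimately show ?thesis using D U
          unfolding B_def gaussian_bracket_def N_def[symmetric] if_not_P[OF j0]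
          by (intro conjI; linarith)
      qed
      then show ?thesis by (intro goal[OF il jl])
    qed
  qed
qed

section \<open>Brackets for Gaussian mixtures\<close>

lemma mixture_density_measurable [measurable]: "mixture_density K w z \<sigma> \<in> borel_measurable borel"
  unfolding mixture_density_def[abs_def] by measurable

lemma mixture_density_nonneg:
  assumes "w \<in> weights K"
  shows "0 \<le> mixture_density K w z \<sigma> x"
  using assms unfolding mixture_density_def weights_def
  by (intro sum_nonneg mult_nonneg_nonneg) auto

lemma mixture_density_pos:
  assumes w: "w \<in> weights K" and s: "\<forall>k\<in>{1..K}. 0 < \<sigma> k"
  shows "0 < mixture_density K w z \<sigma> x"
proof -
  have "\<exists>k\<in>{1..K}. w k \<noteq> 0"
  proof (rule ccontr)
    assume "\<not> ?thesis"
    then have "(\<Sum>k=1..K. w k) = 0" by (intro sum.neutral) auto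
    then show False using w by (simp add: weights_def)
  qed
  then obtain k where k: "k \<in> {1..K}" "0 < w k" using w by (force simp: weights_def)
  have "0 < w k * normal_density (z k) (\<sigma> k) x"
    using k s by (intro mult_pos_pos normal_density_pos) auto
  then show ?thesis unfolding mixture_density_def
    using k w by (intro sum_pos2[of _ k]) (auto simp: weights_def)
qed

lemma mixture_density_prob:
  assumes w: "w \<in> weights K" and s: "\<forall>k\<in>{1..K}. 0 < \<sigma> k"
  shows "prob_space (density lborel (mixture_density K w z \<sigma>))"
proof
  have i: "integrable lborel (mixture_density K w z \<sigma>)"
    unfolding mixture_density_def using s by (intro Bochner_Integration.integrable_sum integrable_mult_right) auto
  have "(\<integral>x. mixture_density K w z \<sigma> x \<partial>lborel) = (\<Sum>k=1..K. w k * 1)"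
    unfolding mixture_density_def using s
    by (subst Bochner_Integration.integral_sum) (auto intro!: sum.cong)
  also have "\<dots> = 1" using w by (simp add: weights_def)
  finally have "(\<integral>\<^sup>+x. ennreal (mixture_density K w z \<sigma> x) \<partial>lborel) = 1"
    using i mixture_density_nonneg[OF w] by (subst nn_integral_eq_integral) auto
  then show "emeasure (density lborel (mixture_density K w z \<sigma>))
      (space (density lborel (mixture_density K w z \<sigma>))) = 1"
    by (simp add: emeasure_density)
qed

text \<open>A code \<open>(a, i, j)\<close> for one component stands for the weight \<open>a / n\<^sup>2\<^sup>1\<close> and for the bracket
\<open>gaussian_bracket n i j\<close>.\<close>

definition bracket_codes :: "nat \<Rightarrow> nat \<Rightarrow> (nat \<Rightarrow> nat \<times> nat \<times> nat) set" where
  "bracket_codes n K = {1..K} \<rightarrow>\<^sub>E {..<n ^ 70} \<times> {..<n ^ 70} \<times> {..<n ^ 70}"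

lemma finite_bracket_codes: "finite (bracket_codes n K)"
  unfolding bracket_codes_def by (intro finite_PiE) auto

lemma card_bracket_codes: "card (bracket_codes n K) = n ^ (210 * K)"
  unfolding bracket_codes_def
  by (subst card_PiE) (auto simp: card_cartesian_product power_mult simp flip: power_add)

definition near_some_mean :: "nat \<Rightarrow> nat \<Rightarrow> (nat \<Rightarrow> nat \<times> nat \<times> nat) \<Rightarrow> real \<Rightarrow> bool" where
  "near_some_mean n K c x \<longleftrightarrow> (\<exists>k\<in>{1..K}. \<bar>x - grid_mean n (fst (snd (c k)))\<bar> < 2 / (real n)\<^sup>2)"

definition mixture_bracket :: "nat \<Rightarrow> nat \<Rightarrow> (nat \<Rightarrow> nat \<times> nat \<times> nat) \<Rightarrow> real \<Rightarrow> real" where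
  "mixture_bracket n K c x = (\<Sum>k=1..K. real (fst (c k)) / real n ^ 21 *
     gaussian_bracket n (fst (snd (c k))) (snd (snd (c k))) x)"

lemma gaussian_bracket_nonneg: "0 \<le> gaussian_bracket n i j x"
  by (simp add: gaussian_bracket_def)

lemma gaussian_bracket_measurable [measurable]: "gaussian_bracket n i j \<in> borel_measurable borel"
  unfolding gaussian_bracket_def[abs_def] by (cases "j = 0") auto

lemma mixture_bracket_measurable [measurable]: "mixture_bracket n K c \<in> borel_measurable borel"
  unfolding mixture_bracket_def[abs_def] by measurable

lemma mixture_bracket_nonneg: "0 \<le> mixture_bracket n K c x"
  unfolding mixture_bracket_def
  by (intro sum_nonneg mult_nonneg_nonneg gaussian_bracket_nonneg) auto

text \<open>Weights are rounded up. The brackets are at most \<open>n\<^sup>1\<^sup>3\<close>, so that the rounding error \<open>n\<^sup>-\<^sup>2\<^sup>1\<close> of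
each of the \<open>K \<le> n\<close> weights adds up to at most \<open>n\<^sup>-\<^sup>7\<close>.\<close>

lemma mixture_bracket_exists:
  assumes n: "2 \<le> n" and K: "1 \<le> K" "K \<le> n" and w: "w \<in> weights K" and s: "\<forall>k\<in>{1..K}. 0 < \<sigma> k"
  shows "\<exists>c\<in>bracket_codes n K. \<forall>x. \<bar>x\<bar> \<le> real n \<longrightarrow> \<not> near_some_mean n K c x \<longrightarrow>
    mixture_density K w z \<sigma> x \<le> mixture_bracket n K c x \<and>
    mixture_bracket n K c x \<le> mixture_density K w z \<sigma> x + 3 / real n ^ 7"
proof -
  define N where "N = real n"
  have N: "2 \<le> N" "0 < N" using n by (auto simp: N_def)
  define good where "good k i j \<longleftrightarrow> i < n ^ 70 \<and> j < n ^ 70 \<and> (\<forall>x. \<bar>x\<bar> \<le> N \<longrightarrow> 2 / N\<^sup>2 \<le> \<bar>x - grid_mean n i\<bar> \<longrightarrow>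
    normal_density (z k) (\<sigma> k) x \<le> gaussian_bracket n i j x \<and>
    gaussian_bracket n i j x \<le> normal_density (z k) (\<sigma> k) x + 2 / N ^ 7 \<and>
    gaussian_bracket n i j x \<le> N ^ 13)" for k i j
  have "\<forall>k\<in>{1..K}. \<exists>ij. good k (fst ij) (snd ij)"
    using gaussian_bracket_exists[OF n] s unfolding good_def N_def by auto
  then obtain ij where ij: "\<forall>k\<in>{1..K}. good k (fst (ij k)) (snd (ij k))" by (rule bchoice[THEN exE])
  define a where "a k = nat \<lceil>w k * N ^ 21\<rceil>" for k
  have a: "w k \<le> real (a k) / N ^ 21" "real (a k) / N ^ 21 \<le> w k + 1 / N ^ 21" "a k < n ^ 70"
    if "k \<in> {1..K}" for k
  proof -
    have wk: "0 \<le> w k" "w k \<le> 1" using w that by (auto simp: weights_def)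
    then have "0 \<le> w k * N ^ 21" using N by simp
    then have "real (a k) = of_int \<lceil>w k * N ^ 21\<rceil>" unfolding a_def
      by (metis ceiling_mono ceiling_zero of_nat_nat)
    then have a1: "w k * N ^ 21 \<le> real (a k)" "real (a k) < w k * N ^ 21 + 1" by linarith+
    show "w k \<le> real (a k) / N ^ 21" using a1 N by (simp add: pos_le_divide_eq)
    show "real (a k) / N ^ 21 \<le> w k + 1 / N ^ 21" using a1 N by (simp add: field_simps)
    have "w k * N ^ 21 \<le> 1 * N ^ 21" using wk N by (intro mult_right_mono) auto
    then have "real (a k) < N ^ 21 + 1" using a1 by linarith
    also have "\<dots> \<le> N ^ 21 + N ^ 21" using N one_le_power[of N 21] by simp
    also have "\<dots> \<le> N * N ^ 21" using N mult_right_mono[of 2 N "N ^ 21"] by simp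
    also have "\<dots> = N ^ 22" by (simp flip: power_Suc)
    also have "\<dots> \<le> N ^ 70" using N by (intro power_increasing) auto
    finally have "real (a k) < real (n ^ 70)" by (simp add: N_def)
    then show "a k < n ^ 70" by (simp only: of_nat_less_iff)
  qed
  define c where "c = (\<lambda>k\<in>{1..K}. (a k, ij k))"
  have c: "c \<in> bracket_codes n K"
    unfolding bracket_codes_def c_def using a(3) ij
    by (auto simp: good_def mem_Times_iff)
  have "mixture_density K w z \<sigma> x \<le> mixture_bracket n K c x \<and>
    mixture_bracket n K c x \<le> mixture_density K w z \<sigma> x + 3 / N ^ 7"
    if x: "\<bar>x\<bar> \<le> N" "\<not> near_some_mean n K c x" for x
  proof -
    define g where "g k = gaussian_bracket n (fst (ij k)) (snd (ij k)) x" for k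
    define \<phi> where "\<phi> k = normal_density (z k) (\<sigma> k) x" for k
    have g: "\<phi> k \<le> g k" "g k \<le> \<phi> k + 2 / N ^ 7" "g k \<le> N ^ 13" if k: "k \<in> {1..K}" for k
    proof -
      have "2 / N\<^sup>2 \<le> \<bar>x - grid_mean n (fst (ij k))\<bar>"
        using x(2) k unfolding near_some_mean_def c_def N_def by (auto simp: not_less)
      then show "\<phi> k \<le> g k" "g k \<le> \<phi> k + 2 / N ^ 7" "g k \<le> N ^ 13"
        using ij k x(1) unfolding good_def g_def \<phi>_def by blast+
    qed
    have ph: "0 \<le> \<phi> k" for k by (simp add: \<phi>_def)
    have mb: "mixture_bracket n K c x = (\<Sum>k=1..K. real (a k) / N ^ 21 * g k)"
      unfolding mixture_bracket_def g_def N_def by (intro sum.cong) (auto simp: c_def)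
    have md: "mixture_density K w z \<sigma> x = (\<Sum>k=1..K. w k * \<phi> k)"
      by (simp add: mixture_density_def \<phi>_def)
    have w0: "0 \<le> w k" if "k \<in> {1..K}" for k using w that by (auto simp: weights_def)
    have "(\<Sum>k=1..K. w k * \<phi> k) \<le> (\<Sum>k=1..K. real (a k) / N ^ 21 * g k)"
      using a(1) g(1) ph w0 N by (intro sum_mono mult_mono) auto
    moreover have "(\<Sum>k=1..K. real (a k) / N ^ 21 * g k) \<le>
        (\<Sum>k=1..K. w k * \<phi> k + (w k * (2 / N ^ 7) + 1 / N ^ 7 * (1 / real K)))"
    proof (rule sum_mono)
      fix k assume k: "k \<in> {1..K}"
      have g0: "0 \<le> g k" using g(1)[OF k] ph[of k] by linarith
      have "real (a k) / N ^ 21 * g k \<le> (w k + 1 / N ^ 21) * g k"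
        using a(2)[OF k] g0 by (rule mult_right_mono)
      also have "\<dots> = w k * g k + 1 / N ^ 21 * g k" by (simp add: distrib_right)
      also have "\<dots> \<le> w k * (\<phi> k + 2 / N ^ 7) + 1 / N ^ 21 * N ^ 13"
      proof (rule add_mono)
        show "w k * g k \<le> w k * (\<phi> k + 2 / N ^ 7)" using g(2)[OF k] w0[OF k] by (rule mult_left_mono)
        show "1 / N ^ 21 * g k \<le> 1 / N ^ 21 * N ^ 13"
          using g(3)[OF k] N by (intro mult_left_mono) auto
      qed
      also have "1 / N ^ 21 * N ^ 13 = 1 / N ^ 7 * (1 / N)" using N
        by (simp add: divide_simps flip: power_add power_Suc power_Suc2)
      also have "\<dots> \<le> 1 / N ^ 7 * (1 / real K)"
        using K N by (intro mult_left_mono divide_left_mono) (auto simp: N_def)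
      finally show "real (a k) / N ^ 21 * g k \<le> w k * \<phi> k + (w k * (2 / N ^ 7) + 1 / N ^ 7 * (1 / real K))"
        by (simp add: distrib_left)
    qed
    moreover have "(\<Sum>k=1..K. w k * \<phi> k + (w k * (2 / N ^ 7) + 1 / N ^ 7 * (1 / real K))) =
        (\<Sum>k=1..K. w k * \<phi> k) + 3 / N ^ 7"
    proof -
      have "(\<Sum>k=1..K. w k) = 1" using w by (simp add: weights_def)
      moreover have "real K * (1 / N ^ 7 * (1 / real K)) = 1 / N ^ 7" using K by simp
      ultimately show ?thesis
        by (simp add: sum.distrib sum_distrib_right[symmetric] del: times_divide_eq_right)
    qed
    ultimately show ?thesis unfolding mb md by linarith
  qed
  then show ?thesis using c unfolding N_def by blast
qed

section \<open>Fluctuations of the contrast, uniformly over all mixtures\<close>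

text \<open>Near a mean of the mixture and outside \<open>[- n, n]\<close>, where the brackets give no information, the
value 1 is the trivial upper bound of the contrast.\<close>

definition bracket_contrast ::
    "nat \<Rightarrow> (real \<Rightarrow> real) \<Rightarrow> nat \<Rightarrow> (nat \<Rightarrow> nat \<times> nat \<times> nat) \<Rightarrow> real \<Rightarrow> real" where
  "bracket_contrast n q K c x =
    (if real n < \<bar>x\<bar> \<or> near_some_mean n K c x then 1 else contrast (q x) (mixture_bracket n K c x))"

lemma near_some_mean_measurable [measurable]: "Measurable.pred borel (near_some_mean n K c)"
  unfolding near_some_mean_def[abs_def] by measurable

lemma bracket_contrast_measurable [measurable]:
  assumes [measurable]: "q \<in> borel_measurable borel"
  shows "bracket_contrast n q K c \<in> borel_measurable borel"
  unfolding bracket_contrast_def[abs_def] by measurable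

lemma bracket_contrast_abs_le_1:
  assumes "0 \<le> q x"
  shows "\<bar>bracket_contrast n q K c x\<bar> \<le> 1"
  using contrast_abs_le_1[OF assms mixture_bracket_nonneg] by (simp add: bracket_contrast_def)

lemma second_moment_psi0:
  "integrable lborel (\<lambda>x. x\<^sup>2 * psi0 x)" "(\<integral>x. x\<^sup>2 * psi0 x \<partial>lborel) = 1 / 2"
proof -
  have psi: "psi0 x = normal_density 0 (1 / sqrt 2) x" for x
  proof -
    have "pi powr (- 1 / 2) = 1 / sqrt pi"
      using powr_minus_divide[of pi "1 / 2"] by (simp add: powr_half_sqrt)
    then show ?thesis by (simp add: psi0_def normal_density_def power_divide)
  qed
  have "has_bochner_integral lborel (\<lambda>x. x\<^sup>2 * psi0 x) (1 / 2)"
    using normal_moment_even[of "1 / sqrt 2" 0 1]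
    by (simp add: psi mult.commute[of "_ ^ 2"] power_divide fact_numeral)
  then show "integrable lborel (\<lambda>x. x\<^sup>2 * psi0 x)" "(\<integral>x. x\<^sup>2 * psi0 x \<partial>lborel) = 1 / 2"
    by (auto simp: has_bochner_integral_iff)
qed

lemma psi0_le_1: "psi0 x \<le> 1"
proof -
  have "pi powr (- 1 / 2) \<le> pi powr 0" using pi_gt3 by (intro powr_mono) auto
  then have "pi powr (- 1 / 2) * exp (- x\<^sup>2) \<le> 1 * 1" by (intro mult_mono) auto
  then show ?thesis by (simp add: psi0_def)
qed

lemma psi0_nonneg: "0 \<le> psi0 x" by (simp add: psi0_def)

lemma bracket_error_pointwise:
  fixes p q b b' x :: real
  assumes n: "2 \<le> n" and p: "1 / (real n)\<^sup>2 \<le> p" and q: "p / 4 \<le> q" and b: "0 \<le> b" "b \<le> b'" "b' \<le> b + 3 / real n ^ 7"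
  shows "contrast q b' - contrast q b \<le> 8 / real n"
proof -
  define N where "N = real n"
  have N: "2 \<le> N" "0 < N" using n by (auto simp: N_def)
  have q1: "1 / (4 * N\<^sup>2) \<le> q" using p q unfolding N_def by simp
  have q0: "0 < 1 / (4 * N\<^sup>2)" using N by simp
  have "contrast q b' - contrast q b \<le> 2 * sqrt ((b' - b) / q)"
    by (rule contrast_increment_le) (use q0 q1 b in linarith)+
  also have "(b' - b) / q \<le> (3 / N ^ 7) / (1 / (4 * N\<^sup>2))"
    using q0 q1 b N by (intro frac_le) (auto simp: N_def)
  also have "\<dots> = 12 / N ^ 5" using N by (simp add: divide_simps flip: power_add)
  also have "\<dots> \<le> 16 / N\<^sup>2"
    using N power_increasing[of 2 5 N] by (intro frac_le) auto
  also have "\<dots> = (4 / N)\<^sup>2" by (simp add: power_divide)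
  finally show ?thesis using N unfolding N_def[symmetric] by simp
qed

text \<open>Integrated, this shows that the region where \<open>q < p / 4\<close> has \<open>p\<close>-mass at most
\<open>8 h\<^sup>2(p, q)\<close>.\<close>

lemma sqrt_gap_of_small:
  fixes p q :: real
  assumes "0 \<le> q" "q < p / 4"
  shows "p \<le> 4 * (sqrt p - sqrt q)\<^sup>2"
proof -
  have "sqrt q \<le> sqrt (p / 4)" using assms by simp
  also have "\<dots> = sqrt p / 2" by (simp add: real_sqrt_divide)
  finally have "sqrt p \<le> 2 * (sqrt p - sqrt q)" by simp
  then have "(sqrt p)\<^sup>2 \<le> (2 * (sqrt p - sqrt q))\<^sup>2" using assms by (intro power_mono) auto
  also have "\<dots> = 4 * (sqrt p - sqrt q)\<^sup>2" unfolding power_mult_distrib by simp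
  finally show ?thesis using assms by simp
qed

text \<open>The bracket is accurate up to \<open>8 / n\<close> where \<open>\<bar>x\<bar> \<le> n\<close>, \<open>p \<ge> n\<^sup>-\<^sup>2\<close>, \<open>q \<ge> p / 4\<close> and no mean is near. Each
of the four exceptional regions has \<open>p\<close>-mass \<open>O(1 / n)\<close>, \<open>O(K / n)\<close> or \<open>O(h\<^sup>2(p, q))\<close>, and there
the error is at most 2.\<close>

lemma bracket_contrast_error:
  fixes p q r :: "real \<Rightarrow> real"
  assumes n: "2 \<le> n" and K: "2 \<le> K" and M: "0 \<le> M" "M \<le> real n"
    and m [measurable]: "p \<in> borel_measurable borel" "q \<in> borel_measurable borel" "r \<in> borel_measurable borel"
    and nn: "\<And>x. 0 \<le> p x" "\<And>x. 0 < q x" "\<And>x. 0 \<le> r x"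
    and prob: "prob_space (density lborel p)" "prob_space (density lborel q)"
    and pM: "\<And>x. p x \<le> M * psi0 x"
    and br: "\<And>x. \<bar>x\<bar> \<le> real n \<Longrightarrow> \<not> near_some_mean n K c x \<Longrightarrow>
      r x \<le> mixture_bracket n K c x \<and> mixture_bracket n K c x \<le> r x + 3 / real n ^ 7"
  shows "(\<integral>x. (bracket_contrast n q K c x - contrast (q x) (r x)) * p x \<partial>lborel)
    \<le> 15 * real K / real n + 16 * hellinger_sq (density lborel p) (density lborel q)"
proof -
  define N where "N = real n"
  have N: "2 \<le> N" "0 < N" using n by (auto simp: N_def)
  have q0: "0 \<le> q x" for x using nn(2)[of x] by simp
  note ip = prob_density_integral[OF _ nn(1) prob(1), simplified] prob_density_integral[OF _ q0 prob(2), simplified]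
  define J where "J k = {grid_mean n (fst (snd (c k))) - 2 / N\<^sup>2 .. grid_mean n (fst (snd (c k))) + 2 / N\<^sup>2}" for k
  define E where "E x = 8 / N * p x + 2 * (M / N\<^sup>2 * (x\<^sup>2 * psi0 x) + 1 / N\<^sup>2 * indicator {- N .. N} x
    + 4 * (sqrt (p x) - sqrt (q x))\<^sup>2 + (\<Sum>k=1..K. M * indicator (J k) x))" for x
  have Eint: "integrable lborel (\<lambda>x. 8 / N * p x)" "integrable lborel (\<lambda>x. M / N\<^sup>2 * (x\<^sup>2 * psi0 x))"
     "integrable lborel (\<lambda>x. 1 / N\<^sup>2 * indicator {- N .. N} x)"
     "integrable lborel (\<lambda>x. 4 * (sqrt (p x) - sqrt (q x))\<^sup>2)"
     "integrable lborel (\<lambda>x. \<Sum>k=1..K. M * indicator (J k) x)"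
  proof -
    have Icc: "integrable lborel (\<lambda>x. indicator {a..b} x :: real)" for a b :: real
      by (rule integrable_real_indicator) (auto simp: emeasure_lborel_Icc_eq)
    have sq: "integrable lborel (\<lambda>x. (sqrt (p x) - sqrt (q x))\<^sup>2)"
      by (rule integrable_sqrt_diff_sq) (use ip nn q0 in auto)
    show "integrable lborel (\<lambda>x. 8 / N * p x)" "integrable lborel (\<lambda>x. M / N\<^sup>2 * (x\<^sup>2 * psi0 x))"
      "integrable lborel (\<lambda>x. 1 / N\<^sup>2 * indicator {- N .. N} x)"
      "integrable lborel (\<lambda>x. 4 * (sqrt (p x) - sqrt (q x))\<^sup>2)"
      "integrable lborel (\<lambda>x. \<Sum>k=1..K. M * indicator (J k) x)"
      unfolding J_def
      by (intro integrable_mult_right Bochner_Integration.integrable_sum Icc sq second_moment_psi0 ip)+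
  qed
  have bd: "\<bar>contrast (q x) (r x)\<bar> \<le> 1" "\<bar>bracket_contrast n q K c x\<bar> \<le> 1" for x
    using contrast_abs_le_1[OF q0 nn(3)] bracket_contrast_abs_le_1[of q x, OF q0[of x]] by blast+
  have "(\<integral>x. (bracket_contrast n q K c x - contrast (q x) (r x)) * p x \<partial>lborel) \<le> (\<integral>x. E x \<partial>lborel)"
  proof (rule integral_mono)
    show "integrable lborel E" unfolding E_def
      by (intro Bochner_Integration.integrable_add integrable_mult_right Eint)
    show "integrable lborel (\<lambda>x. (bracket_contrast n q K c x - contrast (q x) (r x)) * p x)"
    proof (rule Bochner_Integration.integrable_bound[of _ "\<lambda>x. 2 * p x"])
      show "integrable lborel (\<lambda>x. 2 * p x)" using ip by simp
      show "AE x in lborel. norm ((bracket_contrast n q K c x - contrast (q x) (r x)) * p x) \<le> norm (2 * p x)"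
      proof (rule AE_I2)
        fix x
        have "\<bar>bracket_contrast n q K c x - contrast (q x) (r x)\<bar> * p x \<le> 2 * p x"
          using bd[of x] nn(1)[of x] by (intro mult_right_mono) auto
        then show "norm ((bracket_contrast n q K c x - contrast (q x) (r x)) * p x) \<le> norm (2 * p x)"
          using nn(1)[of x] by (simp add: abs_mult)
      qed
    qed measurable
    fix x
    define t1 t2 t3 t4 t5 where "t1 = 8 / N * p x" "t2 = M / N\<^sup>2 * (x\<^sup>2 * psi0 x)"
      "t3 = 1 / N\<^sup>2 * indicator {- N .. N} x" "t4 = 4 * (sqrt (p x) - sqrt (q x))\<^sup>2"
      "t5 = (\<Sum>k=1..K. M * indicator (J k) x)"
    have t: "0 \<le> t1" "0 \<le> t2" "0 \<le> t3" "0 \<le> t4" "0 \<le> t5"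
      using N M nn(1)[of x] psi0_nonneg[of x] unfolding t1_t2_t3_t4_t5_def
      by (auto intro!: sum_nonneg mult_nonneg_nonneg)
    have E: "E x = t1 + (2 * t2 + 2 * t3 + 2 * t4 + 2 * t5)" by (simp add: E_def t1_t2_t3_t4_t5_def)
    have two: "(bracket_contrast n q K c x - contrast (q x) (r x)) * p x \<le> 2 * p x"
      using bd[of x] nn(1)[of x] by (intro mult_right_mono) auto
    \<comment> \<open>The four exceptional regions are charged to \<open>t2\<close>, \<open>t3\<close>, \<open>t4\<close>, \<open>t5\<close>, and the rest to \<open>t1\<close>.\<close>
    consider "N < \<bar>x\<bar>" | "\<bar>x\<bar> \<le> N" "p x < 1 / N\<^sup>2" | "q x < p x / 4" | "near_some_mean n K c x"
      | "\<bar>x\<bar> \<le> N" "1 / N\<^sup>2 \<le> p x" "p x / 4 \<le> q x" "\<not> near_some_mean n K c x" by linarith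
    then show "(bracket_contrast n q K c x - contrast (q x) (r x)) * p x \<le> E x"
    proof cases
      case 1
      have "N\<^sup>2 \<le> x\<^sup>2" using 1 N by (metis abs_le_square_iff abs_of_pos less_imp_le)
      then have "1 * (M * psi0 x) \<le> x\<^sup>2 / N\<^sup>2 * (M * psi0 x)"
        using N M psi0_nonneg[of x] by (intro mult_right_mono) auto
      then have "p x \<le> t2" using pM[of x] by (simp add: t1_t2_t3_t4_t5_def mult_ac)
      then show ?thesis unfolding E using t by (intro order_trans[OF two]) linarith
    next
      case 2
      then have "p x \<le> t3" by (auto simp: t1_t2_t3_t4_t5_def indicator_def abs_le_iff)
      then show ?thesis unfolding E using t by (intro order_trans[OF two]) linarith
    next
      case 3
      then have "p x \<le> t4" unfolding t1_t2_t3_t4_t5_def using sqrt_gap_of_small[OF q0] by blast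
      then show ?thesis unfolding E using t by (intro order_trans[OF two]) linarith
    next
      case 4
      then obtain k where k: "k \<in> {1..K}" "\<bar>x - grid_mean n (fst (snd (c k)))\<bar> < 2 / N\<^sup>2"
        by (auto simp: near_some_mean_def N_def)
      have "p x \<le> M * 1" using pM[of x] mult_left_mono[OF psi0_le_1[of x] M(1)] by linarith
      also have "\<dots> = M * indicator (J k) x" using k by (simp add: J_def abs_less_iff)
      also have "\<dots> \<le> t5" unfolding t1_t2_t3_t4_t5_def
        by (rule member_le_sum) (use k M in auto)
      finally show ?thesis unfolding E using t by (intro order_trans[OF two]) linarith
    next
      case 5
      have "bracket_contrast n q K c x - contrast (q x) (r x) \<le> 8 / N"
        using 5 br[of x] nn(3)[of x] bracket_error_pointwise[OF n, of "p x" "q x" "r x" "mixture_bracket n K c x"]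
        unfolding bracket_contrast_def N_def by auto
      then have "(bracket_contrast n q K c x - contrast (q x) (r x)) * p x \<le> t1"
        unfolding t1_t2_t3_t4_t5_def by (rule mult_right_mono) (rule nn)
      then show ?thesis unfolding E by (rule order_trans) (use t in linarith)
    qed
  qed
  also have "(\<integral>x. E x \<partial>lborel) = (\<integral>x. 8 / N * p x \<partial>lborel) + 2 * ((\<integral>x. M / N\<^sup>2 * (x\<^sup>2 * psi0 x) \<partial>lborel)
      + (\<integral>x. 1 / N\<^sup>2 * indicator {- N .. N} x \<partial>lborel)
      + (\<integral>x. 4 * (sqrt (p x) - sqrt (q x))\<^sup>2 \<partial>lborel) + (\<integral>x. (\<Sum>k=1..K. M * indicator (J k) x) \<partial>lborel))"
    unfolding E_def using Eint
    by (simp only: Bochner_Integration.integral_add Bochner_Integration.integrable_add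
       integral_mult_right_zero integrable_mult_right)
  also have "(\<integral>x. 8 / N * p x \<partial>lborel) = 8 / N" using ip by simp
  also have "(\<integral>x. M / N\<^sup>2 * (x\<^sup>2 * psi0 x) \<partial>lborel) \<le> 1 / N"
  proof -
    have "(\<integral>x. M / N\<^sup>2 * (x\<^sup>2 * psi0 x) \<partial>lborel) = M / N\<^sup>2 / 2"
      by (subst integral_mult_right_zero) (simp add: second_moment_psi0(2))
    also have "\<dots> \<le> N / N\<^sup>2 / 1" using M N by (intro frac_le divide_right_mono) (auto simp: N_def)
    finally show ?thesis using N by (simp add: power2_eq_square)
  qed
  also have "(\<integral>x. 1 / N\<^sup>2 * indicator {- N .. N} x \<partial>lborel) = 2 / N"
    using N by (simp add: power2_eq_square)
  also have "(\<integral>x. 4 * (sqrt (p x) - sqrt (q x))\<^sup>2 \<partial>lborel) = 8 * hellinger_sq (density lborel p) (density lborel q)"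
    using hellinger_sq_density[of p lborel q] nn q0 prob by simp
  also have "(\<integral>x. (\<Sum>k=1..K. M * indicator (J k) x) \<partial>lborel) \<le> 4 * real K / N"
  proof -
    have "(\<integral>x. (\<Sum>k=1..K. M * indicator (J k) x) \<partial>lborel) = (\<Sum>k=1..K. M * (4 / N\<^sup>2))"
      by (subst Bochner_Integration.integral_sum) (auto simp: J_def intro!: sum.cong integrable_mult_right integrable_real_indicator)
    also have "\<dots> = 4 * real K * (M / N\<^sup>2)" by simp
    also have "\<dots> \<le> 4 * real K * (N / N\<^sup>2)" using M N by (intro mult_left_mono divide_right_mono) (auto simp: N_def)
    finally show ?thesis using N by (simp add: power2_eq_square)
  qed
  finally have "(\<integral>x. (bracket_contrast n q K c x - contrast (q x) (r x)) * p x \<partial>lborel) \<le>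
    8 / N + 2 * (1 / N + 2 / N + 8 * hellinger_sq (density lborel p) (density lborel q) + 4 * real K / N)"
    by simp
  also have "\<dots> = (14 + 8 * real K) / N + 16 * hellinger_sq (density lborel p) (density lborel q)"
    by (simp add: add_divide_distrib)
  also have "(14 + 8 * real K) / N \<le> 15 * real K / N" using K N by (intro divide_right_mono) auto
  finally show ?thesis by (simp add: N_def)
qed

lemma half_le_ln:
  assumes "2 \<le> n"
  shows "1 / 2 \<le> ln (real n)"
proof -
  have "1 / 2 \<le> ln (2::real)" using ln_le_minus_one[of "1 / 2 :: real"] by (simp add: ln_div)
  also have "\<dots> \<le> ln (real n)" using assms by simp
  finally show ?thesis .
qed

lemma sum_half_powers_le: "(\<Sum>K=2..n. (1 / 2 :: real) ^ K) \<le> 1 - (1 / 2) ^ n"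
proof (induction n)
  case (Suc n)
  show ?case
  proof (cases "2 \<le> Suc n")
    case True
    then have "(\<Sum>K=2..Suc n. (1 / 2 :: real) ^ K) = (\<Sum>K=2..n. (1 / 2) ^ K) + (1 / 2) ^ Suc n"
      by (subst sum.nat_ivl_Suc') (auto simp: add.commute)
    then show ?thesis using Suc by simp
  next
    case False
    then have "n = 0" by simp
    then show ?thesis by simp
  qed
qed simp

text \<open>All mixtures are covered at once, because
\<open>contrast q r\<close> is everywhere below the contrast of a bracket of \<open>r\<close>, and there are finitely many
brackets. A code with \<open>K\<close> components receives the confidence level
\<open>exp (- \<xi>) n\<^sup>-\<^sup>2\<^sup>1\<^sup>0\<^sup>K 2\<^sup>-\<^sup>K\<close>, and these levels sum to at most \<open>exp (- \<xi>)\<close>.\<close>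

lemma contrast_deviation:
  fixes p q :: "real \<Rightarrow> real" and n :: nat and M \<xi> :: real
  assumes n: "2 \<le> n" and M: "0 \<le> M" "M \<le> real n" and xi: "0 < \<xi>"
    and m [measurable]: "p \<in> borel_measurable borel" "q \<in> borel_measurable borel"
    and nn: "\<And>x. 0 \<le> p x" "\<And>x. 0 < q x"
    and prob: "prob_space (density lborel p)" "prob_space (density lborel q)"
    and pM: "\<And>x. p x \<le> M * psi0 x"
  defines "\<Omega> \<equiv> \<Pi>\<^sub>M i\<in>{1..n}. density lborel p"
  shows "\<exists>G\<in>sets \<Omega>. 1 - exp (- \<xi>) \<le> measure \<Omega> G \<and>
    (\<forall>x\<in>G. \<forall>K\<in>{2..n}. \<forall>w\<in>weights K. \<forall>z \<sigma>. (\<forall>k\<in>{1..K}. 0 < \<sigma> k) \<longrightarrow>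
      (\<Sum>i=1..n. contrast (q (x i)) (mixture_density K w z \<sigma> (x i))) \<le>
        real n * (20 * hellinger_sq (density lborel p) (density lborel q)
          - hellinger_sq (density lborel p) (density lborel (mixture_density K w z \<sigma>)) / 8)
        + 10200 * real K * ln (real n) + 48 * \<xi>)"
proof -
  define P where "P = density lborel p"
  have sP [measurable_cong]: "sets P = sets borel" by (simp add: P_def)
  have q0: "0 \<le> q x" for x using nn(2)[of x] by simp
  define J where "J = (SIGMA K:{2..n}. bracket_codes n K)"
  define F where "F j = bracket_contrast n q (fst j) (snd j)" for j
  define t where "t j = \<xi> + (210 * real (fst j) * ln (real n) + real (fst j) * ln 2)"
    for j :: "nat \<times> (nat \<Rightarrow> nat \<times> nat \<times> nat)"
  have Fm: "F j \<in> borel_measurable borel" for j unfolding F_def by (rule bracket_contrast_measurable[OF m(2)])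
  have Fb: "\<bar>F j x\<bar> \<le> 1" for j x unfolding F_def by (rule bracket_contrast_abs_le_1) (rule q0)
  have "(\<Sum>j\<in>J. exp (- t j)) = (\<Sum>K=2..n. \<Sum>c\<in>bracket_codes n K. exp (- t (K, c)))"
    unfolding J_def by (subst sum.Sigma) (auto simp: finite_bracket_codes)
  also have "\<dots> = (\<Sum>K=2..n. exp (- \<xi>) * (1 / 2) ^ K)"
  proof (rule sum.cong[OF refl])
    fix K
    have e1: "exp (210 * real K * ln (real n)) = real n ^ (210 * K)"
      using n exp_of_nat_mult[of "210 * K" "ln (real n)"] by simp
    have e2: "exp (real K * ln 2) = (2::real) ^ K" using exp_of_nat_mult[of K "ln 2 :: real"] by simp
    have "(\<Sum>c\<in>bracket_codes n K. exp (- t (K, c))) =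
        real n ^ (210 * K) * (exp (- \<xi>) * inverse (real n ^ (210 * K) * 2 ^ K))"
    proof -
      have "exp (- t (K, c)) = exp (- \<xi>) * inverse (real n ^ (210 * K) * 2 ^ K)" for c
        by (simp only: t_def fst_conv minus_add_distrib exp_add exp_minus e1 e2 inverse_mult_distrib)
      then show ?thesis by (simp add: card_bracket_codes)
    qed
    also have "\<dots> = exp (- \<xi>) * (1 / 2) ^ K" using n by (simp add: field_simps power_one_over)
    finally show "(\<Sum>c\<in>bracket_codes n K. exp (- t (K, c))) = exp (- \<xi>) * (1 / 2) ^ K" .
  qed
  also have "\<dots> = exp (- \<xi>) * (\<Sum>K=2..n. (1 / 2) ^ K)" by (simp add: sum_distrib_left)
  also have "\<dots> \<le> exp (- \<xi>) * 1"
    by (intro mult_left_mono order_trans[OF sum_half_powers_le]) auto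
  finally have tsum: "(\<Sum>j\<in>J. exp (- t j)) \<le> exp (- \<xi>)" by simp
  \<comment> \<open>With \<open>l = 1 / 48\<close> the second moment contributes \<open>6 / 48 = 1 / 8\<close> of \<open>h\<^sup>2(p, r)\<close>,
    half of the \<open>1 / 4\<close> that the mean provides with the opposite sign.\<close>
  have "\<exists>G\<in>sets (\<Pi>\<^sub>M i\<in>{1..n}. P). 1 - exp (- \<xi>) \<le> measure (\<Pi>\<^sub>M i\<in>{1..n}. P) G \<and>
      (\<forall>x\<in>G. \<forall>j\<in>J. (\<Sum>i\<in>{1..n}. F j (x i)) \<le>
      real (card {1..n}) * ((\<integral>x. F j x \<partial>P) + 1 / 48 * (\<integral>x. (F j x)\<^sup>2 \<partial>P)) + t j / (1 / 48))"
  proof (rule simultaneous_chernoff[where F = F and t = t and J = J and P = P and I = "{1..n}"])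
    show "prob_space P" unfolding P_def by (rule prob(1))
    show "F j \<in> borel_measurable P" for j using Fm[of j] by measurable
    show "\<bar>F j x\<bar> \<le> 1" for j x by (rule Fb)
    show "finite J" unfolding J_def by (intro finite_SigmaI finite_bracket_codes) simp
    show "(\<Sum>j\<in>J. exp (- t j)) \<le> exp (- \<xi>)" by (rule tsum)
  qed simp_all
  then obtain G where G: "G \<in> sets \<Omega>" "1 - exp (- \<xi>) \<le> measure \<Omega> G"
    and GF: "\<And>x j. x \<in> G \<Longrightarrow> j \<in> J \<Longrightarrow> (\<Sum>i=1..n. F j (x i)) \<le>
      real n * ((\<integral>x. F j x \<partial>P) + 1 / 48 * (\<integral>x. (F j x)\<^sup>2 \<partial>P)) + 48 * t j"
    unfolding \<Omega>_def P_def by (auto simp: mult.commute[of _ 48])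
  have "(\<Sum>i=1..n. contrast (q (x i)) (mixture_density K w z \<sigma> (x i))) \<le>
        real n * (20 * hellinger_sq P (density lborel q)
          - hellinger_sq P (density lborel (mixture_density K w z \<sigma>)) / 8)
        + 10200 * real K * ln (real n) + 48 * \<xi>"
    if x: "x \<in> G" and K: "K \<in> {2..n}" and w: "w \<in> weights K" and s: "\<forall>k\<in>{1..K}. 0 < \<sigma> k" for x K w z \<sigma>
  proof -
    define r where "r = mixture_density K w z \<sigma>"
    have r [measurable]: "r \<in> borel_measurable borel" and r0: "0 \<le> r x" for x
      unfolding r_def using mixture_density_nonneg[OF w] by auto
    have rp: "prob_space (density lborel r)" unfolding r_def by (rule mixture_density_prob[OF w s])
    obtain c where c: "c \<in> bracket_codes n K"
      and br: "\<And>y. \<bar>y\<bar> \<le> real n \<Longrightarrow> \<not> near_some_mean n K c y \<Longrightarrow>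
        r y \<le> mixture_bracket n K c y \<and> mixture_bracket n K c y \<le> r y + 3 / real n ^ 7"
      using mixture_bracket_exists[OF n _ _ w s, of z] K unfolding r_def by auto
    have j: "(K, c) \<in> J" using K c by (simp add: J_def)
    define f where "f = bracket_contrast n q K c"
    have fF: "f = F (K, c)" by (simp add: f_def F_def)
    have fm [measurable]: "f \<in> borel_measurable borel" unfolding fF by (rule Fm)
    have fb: "\<bar>f y\<bar> \<le> 1" for y unfolding fF by (rule Fb)
    define g where "g y = contrast (q y) (r y)" for y
    have gm [measurable]: "g \<in> borel_measurable borel" unfolding g_def[abs_def] by measurable
    have gb: "\<bar>g y\<bar> \<le> 1" for y unfolding g_def by (rule contrast_abs_le_1[OF q0 r0])
    have gf: "g y \<le> f y" for y
    proof (cases "real n < \<bar>y\<bar> \<or> near_some_mean n K c y")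
      case True
      then show ?thesis using gb[of y] by (simp add: f_def bracket_contrast_def)
    next
      case False
      then show ?thesis using br[of y] contrast_mono[OF nn(2) r0]
        by (simp add: f_def g_def bracket_contrast_def)
    qed
    define hq hr err where "hq = hellinger_sq P (density lborel q)"
      "hr = hellinger_sq P (density lborel r)" "err = (\<integral>y. (f y - g y) * p y \<partial>lborel)"
    have err: "err \<le> 15 * real K / real n + 16 * hq"
      unfolding hq_hr_err_def f_def g_def P_def
      by (rule bracket_contrast_error[OF n _ M m r nn r0 prob pM br]) (use K in auto)
    have ip: "integrable lborel p" using prob_density_integral[OF _ nn(1) prob(1)] by simp
    have ib: "integrable lborel (\<lambda>y. u y * p y)" if [measurable]: "u \<in> borel_measurable borel"
      and "\<And>y. \<bar>u y\<bar> \<le> 1" for u :: "real \<Rightarrow> real"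
      by (rule Bochner_Integration.integrable_bound[OF ip])
        (use that(2) nn in \<open>auto intro!: mult_left_le_one_le simp: abs_mult\<close>)
    have iP: "(\<integral>y. u y \<partial>P) = (\<integral>y. u y * p y \<partial>lborel)" if [measurable]: "u \<in> borel_measurable borel"
      for u :: "real \<Rightarrow> real"
      unfolding P_def using nn by (subst integral_density) (auto simp: mult.commute)
    have sqb: "\<bar>u\<^sup>2\<bar> \<le> 1" if "\<bar>u\<bar> \<le> 1" for u :: real using that by (simp add: abs_square_le_1)
    have f1: "(\<integral>y. f y * p y \<partial>lborel) = (\<integral>y. g y * p y \<partial>lborel) + err"
      unfolding hq_hr_err_def left_diff_distrib using ib fm gm fb gb
      by (subst Bochner_Integration.integral_diff) auto
    have f2: "(\<integral>y. (f y)\<^sup>2 * p y \<partial>lborel) \<le> (\<integral>y. (g y)\<^sup>2 * p y \<partial>lborel) + 2 * err"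
    proof -
      have "(\<integral>y. (f y)\<^sup>2 * p y \<partial>lborel) \<le> (\<integral>y. (g y)\<^sup>2 * p y + 2 * ((f y - g y) * p y) \<partial>lborel)"
      proof (rule integral_mono)
        show "integrable lborel (\<lambda>y. (f y)\<^sup>2 * p y)" by (rule ib) (use fb sqb in auto)
        show "integrable lborel (\<lambda>y. (g y)\<^sup>2 * p y + 2 * ((f y - g y) * p y))"
          unfolding left_diff_distrib
          by (intro Bochner_Integration.integrable_add Bochner_Integration.integrable_diff integrable_mult_right ib)
            (use fb gb sqb in auto)
        fix y
        have "(f y - g y) * (f y + g y) \<le> (f y - g y) * 2"
          using gf[of y] fb[of y] gb[of y] by (intro mult_left_mono) auto
        then have "(f y)\<^sup>2 \<le> (g y)\<^sup>2 + 2 * (f y - g y)" by (simp add: power2_eq_square algebra_simps)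
        then have "(f y)\<^sup>2 * p y \<le> ((g y)\<^sup>2 + 2 * (f y - g y)) * p y" using nn(1) by (rule mult_right_mono)
        then show "(f y)\<^sup>2 * p y \<le> (g y)\<^sup>2 * p y + 2 * ((f y - g y) * p y)" by (simp add: algebra_simps)
      qed
      also have "\<dots> = (\<integral>y. (g y)\<^sup>2 * p y \<partial>lborel) + 2 * err"
      proof -
        have "integrable lborel (\<lambda>y. (f y - g y) * p y)"
          unfolding left_diff_distrib by (intro Bochner_Integration.integrable_diff ib fm gm fb gb)
        moreover have "integrable lborel (\<lambda>y. (g y)\<^sup>2 * p y)" by (rule ib) (use gb sqb in auto)
        ultimately show ?thesis
          by (subst Bochner_Integration.integral_add) (auto simp: hq_hr_err_def)
      qed
      finally show ?thesis .
    qed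
    have g1: "(\<integral>y. g y * p y \<partial>lborel) \<le> 5 / 2 * hq - 1 / 4 * hr"
      unfolding g_def hq_hr_err_def P_def
      by (rule expectation_contrast_le) (use nn q0 r0 prob rp in auto)
    have g2: "(\<integral>y. (g y)\<^sup>2 * p y \<partial>lborel) \<le> 14 * hq + 6 * hr"
      unfolding g_def hq_hr_err_def P_def
      by (rule second_moment_contrast_le) (use nn q0 r0 prob rp in auto)
    have hq0: "0 \<le> hq" by (simp add: hq_hr_err_def)
    have "(\<integral>y. f y \<partial>P) + 1 / 48 * (\<integral>y. (f y)\<^sup>2 \<partial>P) \<le> 20 * hq - hr / 8 + 16 * real K / real n"
    proof -
      have "(\<integral>y. f y \<partial>P) = (\<integral>y. f y * p y \<partial>lborel)" "(\<integral>y. (f y)\<^sup>2 \<partial>P) = (\<integral>y. (f y)\<^sup>2 * p y \<partial>lborel)"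
        by (auto intro!: iP)
      moreover have "16 * real K / real n = 16 * (real K / real n)" "15 * real K / real n = 15 * (real K / real n)"
        by simp_all
      moreover have "0 \<le> real K / real n" by simp
      ultimately show ?thesis using f1 f2 g1 g2 err hq0 by argo
    qed
    then have "real n * ((\<integral>y. f y \<partial>P) + 1 / 48 * (\<integral>y. (f y)\<^sup>2 \<partial>P)) \<le>
        real n * (20 * hq - hr / 8 + 16 * real K / real n)" by (rule mult_left_mono) simp
    also have "\<dots> = real n * (20 * hq - hr / 8) + 16 * real K" using n by (simp add: distrib_left)
    finally have main: "real n * ((\<integral>y. f y \<partial>P) + 1 / 48 * (\<integral>y. (f y)\<^sup>2 \<partial>P)) \<le> \<dots>" .
    have "(\<Sum>i=1..n. g (x i)) \<le> (\<Sum>i=1..n. f (x i))" by (intro sum_mono gf)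
    also have "\<dots> \<le> real n * ((\<integral>y. f y \<partial>P) + 1 / 48 * (\<integral>y. (f y)\<^sup>2 \<partial>P)) + 48 * t (K, c)"
      unfolding fF by (rule GF[OF x j])
    also have "\<dots> \<le> real n * (20 * hq - hr / 8) + (16 * real K + 48 * t (K, c))" using main by simp
    also have "16 * real K + 48 * t (K, c) \<le> 10200 * real K * ln (real n) + 48 * \<xi>"
    proof -
      have l2: "1 / 2 \<le> ln (2::real)" using ln_le_minus_one[of "1 / 2 :: real"] by (simp add: ln_div)
      have ln: "ln 2 \<le> ln (real n)" using n by simp
      define a b where "a = real K * ln (real n)" and "b = real K * ln 2"
      have ba: "b \<le> a" unfolding a_def b_def using ln by (intro mult_left_mono) auto
      have "real K * (1 / 2) \<le> b" unfolding b_def using l2 by (intro mult_left_mono) auto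
      then have kb: "real K \<le> 2 * b" by simp
      have "48 * t (K, c) = 48 * \<xi> + 10080 * a + 48 * b" by (simp add: t_def a_def b_def)
      then have "16 * real K + 48 * t (K, c) \<le> 10200 * a + 48 * \<xi>" using ba kb by linarith
      then show ?thesis by (simp add: a_def mult.assoc)
    qed
    finally show ?thesis unfolding g_def r_def hq_hr_err_def by (simp add: r_def add.assoc)
  qed
  then show ?thesis using G unfolding P_def by blast
qed

section \<open>The VC-index and the penalty\<close>

text \<open>The log-ratio of two normal densities is a quadratic polynomial, so it cannot change sign
  three times; the divided differences below make this explicit.\<close>

lemma quadratic_no_three_sign_changes:
  fixes a b c :: real
  defines "Q x \<equiv> a * x\<^sup>2 + b * x + c"
  assumes x: "x1 < x2" "x2 < x3" "x3 < x4" and Q: "0 < Q x1" "Q x2 < 0" "0 < Q x3" "Q x4 < 0"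
  shows False
proof -
  have dd: "Q u * (w - v) - Q v * (w - u) + Q w * (v - u) = a * ((v - u) * (w - v) * (w - u))" for u v w
    by (simp add: Q_def power2_eq_square algebra_simps)
  have "0 < Q x1 * (x3 - x2)" "Q x2 * (x3 - x1) < 0" "0 < Q x3 * (x2 - x1)"
    using x Q by (auto intro!: mult_pos_pos mult_neg_pos)
  with dd[of x1 x3 x2] have "0 < a * ((x2 - x1) * (x3 - x2) * (x3 - x1))" by linarith
  moreover have "0 < (x2 - x1) * (x3 - x2) * (x3 - x1)" using x by (intro mult_pos_pos) auto
  ultimately have "0 < a" by (metis not_less_iff_gr_or_eq zero_less_mult_pos2)
  moreover
  have "Q x2 * (x4 - x3) < 0" "0 < Q x3 * (x4 - x2)" "Q x4 * (x3 - x2) < 0"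
    using x Q by (auto intro!: mult_pos_pos mult_neg_pos)
  with dd[of x2 x4 x3] have "a * ((x3 - x2) * (x4 - x3) * (x4 - x2)) < 0" by linarith
  moreover have "0 < (x3 - x2) * (x4 - x3) * (x4 - x2)" using x by (intro mult_pos_pos) auto
  ultimately show False by (metis mult_pos_pos not_less_iff_gr_or_eq)
qed

lemma ln_normal_density_quadratic:
  assumes "0 < \<sigma>"
  obtains a b c where "\<And>x. ln (normal_density z \<sigma> x) = a * x\<^sup>2 + b * x + c"
proof
  fix x
  have "ln (normal_density z \<sigma> x) = - (x - z)\<^sup>2 / (2 * \<sigma>\<^sup>2) - ln (sqrt (2 * pi * \<sigma>\<^sup>2))"
    unfolding normal_density_def using assms by (subst ln_mult_pos) (auto simp: ln_div)
  also have "\<dots> = (- 1 / (2 * \<sigma>\<^sup>2)) * x\<^sup>2 + (z / \<sigma>\<^sup>2) * x + (- z\<^sup>2 / (2 * \<sigma>\<^sup>2) - ln (sqrt (2 * pi * \<sigma>\<^sup>2)))"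
    using assms by (simp add: field_simps power2_eq_square)
  finally show "ln (normal_density z \<sigma> x) =
    (- 1 / (2 * \<sigma>\<^sup>2)) * x\<^sup>2 + (z / \<sigma>\<^sup>2) * x + (- z\<^sup>2 / (2 * \<sigma>\<^sup>2) - ln (sqrt (2 * pi * \<sigma>\<^sup>2)))" .
qed

text \<open>Points with equal abscissa are never shattered. For four distinct abscissae, a Gaussian that picks
the first and third point and one that picks the second and fourth have a difference that alternates in sign
three times.\<close>

lemma gaussian_subgraphs_shatter_no_4_points:
  assumes S: "finite S" "card S = 4"
    and sh: "shatters (subgraph ` {normal_density z \<sigma> | z \<sigma>. 0 < \<sigma>}) S"
  shows False
proof -
  have pick: "\<exists>z \<sigma>. 0 < \<sigma> \<and> (\<forall>p\<in>S. snd p < normal_density z \<sigma> (fst p) \<longleftrightarrow> p \<in> A)" if AS: "A \<subseteq> S" for A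
  proof -
    obtain B where "B \<in> subgraph ` {normal_density z \<sigma> | z \<sigma>. 0 < \<sigma>}" "S \<inter> B = A"
      using sh[unfolded shatters_def, rule_format, OF AS] by (rule bexE) (rule that)
    then obtain z \<sigma> where "0 < \<sigma>" and A: "S \<inter> subgraph (normal_density z \<sigma>) = A" by auto
    moreover have "snd p < normal_density z \<sigma> (fst p) \<longleftrightarrow> p \<in> A" if "p \<in> S" for p
      using that unfolding A[symmetric] by (simp add: subgraph_def case_prod_beta)
    ultimately show ?thesis by blast
  qed
  have inj: "inj_on fst S"
  proof (rule inj_onI)
    fix p p' assume p: "p \<in> S" "p' \<in> S" "fst p = fst p'"
    have le: "snd v \<le> snd u" if uv: "u \<in> S" "v \<in> S" "fst u = fst v" for u v
    proof (rule ccontr)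
      assume "\<not> ?thesis"
      then have lt: "snd u < snd v" by simp
      obtain z \<sigma> where "\<forall>p\<in>S. snd p < normal_density z \<sigma> (fst p) \<longleftrightarrow> p \<in> {v}"
        using pick[of "{v}"] uv by blast
      with uv lt have "snd v < normal_density z \<sigma> (fst v)" "\<not> snd u < normal_density z \<sigma> (fst u)"
        by auto
      with uv lt show False by simp
    qed
    show "p = p'" using le[OF p] le[OF p(2,1)] p by (simp add: prod_eq_iff)
  qed
  define xs where "xs = sorted_list_of_set (fst ` S)"
  have len: "length xs = 4" using S card_image[OF inj] by (simp add: xs_def)
  have st: "sorted_wrt (<) xs" unfolding xs_def by (rule strict_sorted_list_of_set)
  have set: "set xs = fst ` S" using S by (simp add: xs_def)
  obtain x1 x2 x3 x4 where xs: "xs = [x1, x2, x3, x4]"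
    using len by (auto simp: length_Suc_conv numeral_eq_Suc)
  have x: "x1 < x2" "x2 < x3" "x3 < x4" using st unfolding xs by auto
  have "x1 \<in> fst ` S" "x2 \<in> fst ` S" "x3 \<in> fst ` S" "x4 \<in> fst ` S" using set unfolding xs by auto
  then obtain t1 t2 t3 t4 where p: "(x1, t1) \<in> S" "(x2, t2) \<in> S" "(x3, t3) \<in> S" "(x4, t4) \<in> S"
    by auto
  obtain z \<sigma> where f: "0 < \<sigma>"
    "\<forall>p\<in>S. snd p < normal_density z \<sigma> (fst p) \<longleftrightarrow> p \<in> {(x1, t1), (x3, t3)}"
    using pick[of "{(x1, t1), (x3, t3)}"] p by auto
  obtain z' \<sigma>' where g: "0 < \<sigma>'"
    "\<forall>p\<in>S. snd p < normal_density z' \<sigma>' (fst p) \<longleftrightarrow> p \<in> {(x2, t2), (x4, t4)}"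
    using pick[of "{(x2, t2), (x4, t4)}"] p by auto
  define F G where F_G_def: "F = normal_density z \<sigma>" "G = normal_density z' \<sigma>'"
  have "t1 < F x1" "\<not> t1 < G x1" "\<not> t2 < F x2" "t2 < G x2" "t3 < F x3" "\<not> t3 < G x3" "\<not> t4 < F x4" "t4 < G x4"
    using f(2)[rule_format, OF p(1)] f(2)[rule_format, OF p(2)] f(2)[rule_format, OF p(3)] f(2)[rule_format, OF p(4)]
      g(2)[rule_format, OF p(1)] g(2)[rule_format, OF p(2)] g(2)[rule_format, OF p(3)] g(2)[rule_format, OF p(4)] x
    unfolding F_G_def by auto
  then have FG: "G x1 < F x1" "F x2 < G x2" "G x3 < F x3" "F x4 < G x4" by linarith+
  have pos: "0 < F y" "0 < G y" for y using f g by (auto simp: F_G_def normal_density_pos)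
  obtain a b c where F: "\<And>x. ln (normal_density z \<sigma> x) = a * x\<^sup>2 + b * x + c"
    by (rule ln_normal_density_quadratic[OF f(1), of z]) (rule that)
  obtain a' b' c' where G: "\<And>x. ln (normal_density z' \<sigma>' x) = a' * x\<^sup>2 + b' * x + c'"
    by (rule ln_normal_density_quadratic[OF g(1), of z']) (rule that)
  have Q: "(a - a') * x\<^sup>2 + (b - b') * x + (c - c') = ln (F x) - ln (G x)" for x
    by (simp add: F_G_def F G algebra_simps)
  show False
    by (rule quadratic_no_three_sign_changes[OF x, of "a - a'" "b - b'" "c - c'"]; unfold Q)
      (use FG pos in auto)
qed

lemma gaussian_vc_bounds: "1 \<le> gaussian_vc" "gaussian_vc \<le> 4"
proof -
  let ?P = "\<lambda>m. 1 \<le> m \<and> \<not> (\<exists>S. finite S \<and> card S = m \<and>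
    shatters (subgraph ` {normal_density z \<sigma> | z \<sigma>. 0 < \<sigma>}) S)"
  have 4: "?P 4" using gaussian_subgraphs_shatter_no_4_points by auto
  show "1 \<le> gaussian_vc" unfolding gaussian_vc_def vc_index_def using LeastI[of ?P, OF 4] by blast
  show "gaussian_vc \<le> 4" unfolding gaussian_vc_def vc_index_def by (rule Least_le[of ?P, OF 4])
qed

lemma mixture_delta_bounds:
  assumes "1 \<le> K" "K \<le> n"
  shows "1 / real n \<le> mixture_delta n K" "mixture_delta n K \<le> 4 / real n" "0 < mixture_delta n K"
proof -
  have V: "1 \<le> real gaussian_vc" "real gaussian_vc \<le> 4" using gaussian_vc_bounds by linarith+
  have "1 / real n \<le> real gaussian_vc / real n" using V by (intro divide_right_mono) auto
  moreover have "1 / real n \<le> 1 / real K" using assms by (intro divide_left_mono) auto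
  ultimately show 1: "1 / real n \<le> mixture_delta n K" by (simp add: mixture_delta_def)
  have "real gaussian_vc / real n \<le> 4 / real n" using V by (intro divide_right_mono) auto
  then show "mixture_delta n K \<le> 4 / real n" by (simp add: mixture_delta_def)
  have "0 < 1 / real n" using assms by simp
  with 1 show "0 < mixture_delta n K" by linarith
qed

text \<open>The penalty depends on a density only through its distribution, while the criterion evaluates it at the
data, so equality of distributions has to give equality at every point.\<close>

lemma continuous_densities_unique:
  fixes f g :: "real \<Rightarrow> real"
  assumes c: "continuous_on UNIV f" "continuous_on UNIV g" and nn: "\<And>x. 0 \<le> f x" "\<And>x. 0 \<le> g x"
    and eq: "density lborel f = density lborel g"
  shows "f = g"
proof -
  have [measurable]: "f \<in> borel_measurable borel" "g \<in> borel_measurable borel"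
    using c by (auto intro: borel_measurable_continuous_onI)
  have "AE x in lborel. ennreal (f x) = ennreal (g x)"
    using eq by (intro sigma_finite_measure.density_unique[OF sigma_finite_lborel]) auto
  then have "AE x in lborel. f x = g x" using nn by simp
  then have "{x \<in> space lborel. f x \<noteq> g x} \<in> null_sets lborel"
    by (subst (asm) AE_iff_null) auto
  then have "negligible {x. f x \<noteq> g x}" by (simp add: negligible_iff_null_sets null_sets_completionI)
  moreover have "open {x. f x \<noteq> g x}" using c by (rule open_Collect_neq)
  ultimately have "{x. f x \<noteq> g x} = {}" using open_not_negligible by blast
  then show ?thesis by auto
qed

lemma mixture_density_continuous:
  assumes "\<forall>k\<in>{1..K}. 0 < \<sigma> k"
  shows "continuous_on UNIV (mixture_density K w z \<sigma>)"
proof -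
  have "continuous_on UNIV (normal_density (z k) (\<sigma> k))" if "k \<in> {1..K}" for k
  proof -
    have "\<sigma> k \<noteq> 0" using assms that by force
    then show ?thesis unfolding normal_density_def by (intro continuous_intros) auto
  qed
  then show ?thesis unfolding mixture_density_def[abs_def] by (intro continuous_intros) auto
qed

lemma sqrt2_bounds: "1 \<le> sqrt (2::real)" "sqrt 2 \<le> 1.45"
  by (simp, rule real_le_lsqrt) (simp_all add: power2_eq_square)

definition penalty_term :: "nat \<Rightarrow> nat \<Rightarrow> real" where
  "penalty_term n K = 174.1 * real K * real gaussian_vc *
    (5.82 + ln ((real K + 1)\<^sup>2 / mixture_delta n K)
       + log_plus (real n / (real K * real gaussian_vc))) + real K"

lemma penalty_term_lower:
  assumes n: "2 \<le> n" and K: "2 \<le> K" "K \<le> n"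
  shows "100 * real K * ln (real n) \<le> penalty_term n K"
proof -
  have V: "1 \<le> real gaussian_vc" using gaussian_vc_bounds by linarith
  note d = mixture_delta_bounds[of K n]
  have dp: "0 < mixture_delta n K" using d K by simp
  have "real n * mixture_delta n K \<le> 4" using d(2) K n by (simp add: field_simps)
  also have "4 \<le> (real K + 1)\<^sup>2" using K power_mono[of 2 "real K + 1" 2] by simp
  finally have "real n \<le> (real K + 1)\<^sup>2 / mixture_delta n K" using dp by (simp add: pos_le_divide_eq)
  then have l: "ln (real n) \<le> ln ((real K + 1)\<^sup>2 / mixture_delta n K)" using n by (subst ln_le_cancel_iff) auto
  have ln0: "0 \<le> ln (real n)" using n by simp
  have lp: "0 \<le> log_plus x" for x by (simp add: log_plus_def)
  have "100 * real K * ln (real n) \<le> 174.1 * real K * real gaussian_vc * ln (real n)"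
  proof -
    have "100 * (real K * ln (real n)) \<le> (174.1 * real gaussian_vc) * (real K * ln (real n))"
      using V ln0 by (intro mult_right_mono) auto
    then show ?thesis by (simp add: mult_ac)
  qed
  also have "\<dots> \<le> 174.1 * real K * real gaussian_vc *
    (5.82 + ln ((real K + 1)\<^sup>2 / mixture_delta n K) + log_plus (real n / (real K * real gaussian_vc)))"
    using l lp[of "real n / (real K * real gaussian_vc)"] by (intro mult_left_mono) auto
  finally show ?thesis unfolding penalty_term_def by (rule order_trans) simp
qed

lemma penalty_term_upper:
  assumes n: "2 \<le> n" and K: "2 \<le> K" "K \<le> n"
  shows "penalty_term n K \<le> 13000 * real K * ln (real n)"
proof -
  define N where "N = real n"
  have N: "2 \<le> N" using n by (simp add: N_def)
  have V: "1 \<le> real gaussian_vc" "real gaussian_vc \<le> 4" using gaussian_vc_bounds by linarith+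
  note d = mixture_delta_bounds[of K n]
  have dp: "0 < mixture_delta n K" using d K by simp
  have l0: "1 / 2 \<le> ln N" using half_le_ln[OF n] by (simp add: N_def)
  have "(real K + 1)\<^sup>2 \<le> (N * N)\<^sup>2"
  proof (rule power_mono)
    have "real K + 1 \<le> N + N" using K N by (simp add: N_def)
    also have "\<dots> = 2 * N" by simp
    also have "\<dots> \<le> N * N" using N by (intro mult_right_mono) auto
    finally show "real K + 1 \<le> N * N" .
  qed simp
  also have "(N * N)\<^sup>2 = N ^ 4" by (simp add: power2_eq_square power4_eq_xxxx)
  finally have "(real K + 1)\<^sup>2 / mixture_delta n K \<le> N ^ 4 / (1 / N)"
    using d K n N by (intro frac_le) (auto simp: N_def)
  also have "\<dots> = N ^ 5" by (simp flip: power_Suc2)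
  finally have "ln ((real K + 1)\<^sup>2 / mixture_delta n K) \<le> ln (N ^ 5)"
    using dp N by (subst ln_le_cancel_iff) (auto intro!: divide_pos_pos)
  also have "\<dots> = 5 * ln N" using N by (simp add: ln_realpow)
  finally have l1: "ln ((real K + 1)\<^sup>2 / mixture_delta n K) \<le> 5 * ln N" .
  have l2: "log_plus (N / (real K * real gaussian_vc)) \<le> ln N"
  proof -
    have "1 * 1 \<le> real K * real gaussian_vc" using K V by (intro mult_mono) auto
    then have "N / (real K * real gaussian_vc) \<le> N / 1" using N by (intro frac_le) auto
    moreover have "0 < N / (real K * real gaussian_vc)" using K V N by (intro divide_pos_pos mult_pos_pos) auto
    ultimately have "ln (N / (real K * real gaussian_vc)) \<le> ln N" by simp
    then show ?thesis using l0 by (simp add: log_plus_def)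
  qed
  have l3: "0 \<le> ln ((real K + 1)\<^sup>2 / mixture_delta n K)"
  proof -
    have "mixture_delta n K \<le> 1 / real K" by (simp add: mixture_delta_def)
    also have "\<dots> \<le> 1" using K by simp
    finally have "mixture_delta n K \<le> 1" .
    moreover have "1 \<le> (real K + 1)\<^sup>2" using K by (intro one_le_power) auto
    ultimately have "mixture_delta n K \<le> (real K + 1)\<^sup>2" by linarith
    then show ?thesis using dp by (intro ln_ge_zero) (simp add: pos_le_divide_eq)
  qed
  have "174.1 * real K * real gaussian_vc *
      (5.82 + ln ((real K + 1)\<^sup>2 / mixture_delta n K) + log_plus (N / (real K * real gaussian_vc)))
    \<le> 174.1 * real K * 4 * (18 * ln N)"
  proof (intro mult_mono)
    show "5.82 + ln ((real K + 1)\<^sup>2 / mixture_delta n K) + log_plus (N / (real K * real gaussian_vc)) \<le> 18 * ln N"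
      using l0 l1 l2 by simp
    show "0 \<le> 5.82 + ln ((real K + 1)\<^sup>2 / mixture_delta n K) + log_plus (N / (real K * real gaussian_vc))"
      using l3 by (simp add: log_plus_def)
  qed (use V in auto)
  moreover have "real K \<le> 2 * (real K * ln N)" using mult_left_mono[OF l0, of "2 * real K"] by simp
  ultimately have "penalty_term n K \<le> 174.1 * real K * 4 * (18 * ln N) + 2 * (real K * ln N)"
    unfolding penalty_term_def N_def[symmetric] by (rule add_mono)
  also have "\<dots> \<le> 13000 * real K * ln N" using l0 by simp
  finally show ?thesis by (simp add: N_def)
qed

text \<open>The infimum in the penalty may be attained at a number of components different from the one through
which \<open>q\<close> belongs to the model. This is harmless as the deviation bound holds for all mixtures.\<close>

lemma mixture_penalty_lower:
  assumes n: "2 \<le> n" and q: "q \<in> model_densities D n"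
  obtains K w z \<sigma> where "K \<in> {2..n}" "w \<in> weights K" "\<forall>k\<in>{1..K}. 0 < \<sigma> k"
    "q = mixture_density K w z \<sigma>" "10200 * real K * ln (real n) \<le> mixture_penalty n q"
proof -
  obtain K0 w0 z0 \<sigma>0 where 0: "K0 \<in> {2..n}" "w0 \<in> weights K0" "\<forall>k\<in>{1..K0}. 0 < \<sigma>0 k"
    "q = mixture_density K0 w0 z0 \<sigma>0"
    using q unfolding model_densities_def restricted_mixture_densities_def by blast
  define S where "S = {K\<in>{2..n}. density lborel q \<in> gaussian_mixtures K}"
  have S: "finite S" "K0 \<in> S" using 0 unfolding S_def gaussian_mixtures_def by auto
  have pen: "mixture_penalty n q = (280 * sqrt 2 + 74) * Inf (penalty_term n ` S)"
    unfolding mixture_penalty_def S_def penalty_term_def ..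
  have "Inf (penalty_term n ` S) \<in> penalty_term n ` S"
    using S by (subst cInf_eq_Min) (auto intro!: Min_in)
  then obtain K where K: "K \<in> S" "Inf (penalty_term n ` S) = penalty_term n K" by blast
  then obtain w z \<sigma> where 1: "w \<in> weights K" "\<forall>k\<in>{1..K}. 0 < \<sigma> k"
    "density lborel q = density lborel (mixture_density K w z \<sigma>)"
    unfolding S_def gaussian_mixtures_def by auto
  have q: "q = mixture_density K w z \<sigma>"
    using 1 0 by (intro continuous_densities_unique)
      (auto intro: mixture_density_continuous mixture_density_nonneg)
  have K2: "K \<in> {2..n}" using K by (simp add: S_def)
  have a0: "0 \<le> real K * ln (real n)" using n by simp
  have "10200 * real K * ln (real n) \<le> 354 * (100 * real K * ln (real n))" using a0 by simp
  also have "\<dots> \<le> (280 * sqrt 2 + 74) * penalty_term n K"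
    using penalty_term_lower[OF n, of K] K2 a0 sqrt2_bounds by (intro mult_mono) auto
  finally have "10200 * real K * ln (real n) \<le> mixture_penalty n q" by (simp add: pen K)
  with K2 1(1,2) q show ?thesis by (rule that)
qed

lemma mixture_penalty_upper:
  assumes n: "2 \<le> n" and K: "K \<in> {2..n}" and q: "q \<in> restricted_mixture_densities D K \<delta>"
  shows "mixture_penalty n q \<le> 10 ^ 7 * real K * ln (real n)"
proof -
  define S where "S = {K\<in>{2..n}. density lborel q \<in> gaussian_mixtures K}"
  have S: "finite S" "K \<in> S" using K q
    unfolding S_def gaussian_mixtures_def restricted_mixture_densities_def by auto
  have pen: "mixture_penalty n q = (280 * sqrt 2 + 74) * Inf (penalty_term n ` S)"
    unfolding mixture_penalty_def S_def penalty_term_def ..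
  have "Inf (penalty_term n ` S) \<le> penalty_term n K"
    using S by (intro cInf_lower) auto
  also have "\<dots> \<le> 13000 * real K * ln (real n)" using penalty_term_upper[OF n, of K] K by simp
  finally have "mixture_penalty n q \<le> (280 * sqrt 2 + 74) * (13000 * real K * ln (real n))"
    unfolding pen using sqrt2_bounds by (intro mult_left_mono) auto
  also have "\<dots> \<le> 480 * (13000 * real K * ln (real n))"
    using sqrt2_bounds n by (intro mult_right_mono) auto
  also have "\<dots> \<le> 10 ^ 7 * real K * ln (real n)" using n by simp
  finally show ?thesis .
qed

section \<open>Approximation by mixtures with restricted weights and components\<close>

text \<open>Mixing with the constant weight, \<open>(1 - 2 K \<delta>) w k + \<delta>\<close>, leaves the total mass \<open>K \<delta>\<close> unassigned. It is
used to round up all weights but the last one to rational numbers; the last one takes the rest and is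
then rational as well.\<close>

lemma rational_weights:
  fixes w :: "nat \<Rightarrow> real"
  assumes K: "1 \<le> K" and w: "w \<in> weights K" and d: "0 < \<delta>" "2 * real K * \<delta> \<le> 1"
  obtains w' where "w' \<in> weights K" "\<And>k. k \<in> {1..K} \<Longrightarrow> \<delta> \<le> w' k \<and> w' k \<in> \<rat>"
    "(\<Sum>k=1..K. \<bar>w k - w' k\<bar>) \<le> 4 * real K * \<delta>"
proof -
  define v where "v k = (1 - 2 * real K * \<delta>) * w k + \<delta>" for k
  have w0: "0 \<le> w k" if "k \<in> {1..K}" for k using w that by (auto simp: weights_def)
  have w1: "(\<Sum>k=1..K. w k) = 1" using w by (simp add: weights_def)
  have split: "sum f {1..K} = sum f {1..<K} + f K" for f :: "nat \<Rightarrow> real"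
    using K sum.last_plus[of 1 K f] by (simp add: add.commute)
  have vsum: "(\<Sum>k=1..K. v k) = 1 - real K * \<delta>"
    using w1 by (simp add: v_def sum.distrib flip: sum_distrib_left)
  have "\<exists>\<rho>. \<forall>k. \<rho> k \<in> \<rat> \<and> v k < \<rho> k \<and> \<rho> k < v k + \<delta>"
  proof (rule choice, rule allI)
    fix k show "\<exists>r. r \<in> \<rat> \<and> v k < r \<and> r < v k + \<delta>"
      using Rats_dense_in_real[of "v k" "v k + \<delta>"] d by auto
  qed
  then obtain \<rho> where r: "\<And>k. \<rho> k \<in> \<rat>" "\<And>k. v k < \<rho> k" "\<And>k. \<rho> k < v k + \<delta>" by blast
  define w' where "w' k = (if k = K then 1 - (\<Sum>i=1..<K. \<rho> i) else \<rho> k)" for k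
  have sum1: "(\<Sum>k=1..K. w' k) = 1"
  proof -
    have "(\<Sum>k=1..<K. w' k) = (\<Sum>k=1..<K. \<rho> k)" by (intro sum.cong) (auto simp: w'_def)
    then show ?thesis unfolding split by (simp add: w'_def)
  qed
  have rat: "w' k \<in> \<rat>" for k by (auto simp: w'_def r intro!: Rats_diff Rats_sum)
  have ge: "v k \<le> w' k" for k
  proof (cases "k = K")
    case True
    have "(\<Sum>i=1..<K. \<rho> i) \<le> (\<Sum>i=1..<K. v i + \<delta>)" by (intro sum_mono less_imp_le r)
    also have "\<dots> = (\<Sum>i=1..<K. v i) + (real K - 1) * \<delta>" using K by (simp add: sum.distrib of_nat_diff)
    also have "(\<Sum>i=1..<K. v i) = 1 - real K * \<delta> - v K" using vsum unfolding split by simp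
    finally have "v K + \<delta> \<le> w' K" by (simp add: w'_def algebra_simps)
    then show ?thesis using True d by simp
  next
    case False
    then show ?thesis using r(2)[of k] by (simp add: w'_def)
  qed
  have vd: "\<delta> \<le> v k" if "k \<in> {1..K}" for k
    using w0[OF that] d by (simp add: v_def)
  have w'd: "\<delta> \<le> w' k" if "k \<in> {1..K}" for k using vd[OF that] ge[of k] by linarith
  have w'0: "0 \<le> w' k" if "k \<in> {1..K}" for k using w'd[OF that] d by linarith
  have "w' k \<le> 1" if "k \<in> {1..K}" for k
    using member_le_sum[of k "{1..K}" w'] that w'0 sum1 by auto
  with w'0 sum1 have W: "w' \<in> weights K" by (auto simp: weights_def)
  have "(\<Sum>k=1..K. \<bar>w k - w' k\<bar>) \<le> (\<Sum>k=1..K. (w' k - v k) + (2 * real K * \<delta> * w k + \<delta>))"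
  proof (rule sum_mono)
    fix k assume k: "k \<in> {1..K}"
    have "w k - v k = 2 * real K * \<delta> * w k - \<delta>" by (simp add: v_def algebra_simps)
    moreover have "0 \<le> 2 * real K * \<delta> * w k" using w0[OF k] d by simp
    ultimately show "\<bar>w k - w' k\<bar> \<le> (w' k - v k) + (2 * real K * \<delta> * w k + \<delta>)"
      using ge[of k] d(1) by linarith
  qed
  also have "\<dots> = 1 - (1 - real K * \<delta>) + (2 * real K * \<delta> * 1 + real K * \<delta>)"
    by (simp only: sum.distrib sum_subtractf sum1 vsum w1 sum_constant card_atLeastAtMost flip: sum_distrib_left) simp
  finally have "(\<Sum>k=1..K. \<bar>w k - w' k\<bar>) \<le> 4 * real K * \<delta>" by (simp add: algebra_simps)
  with W w'd rat show ?thesis by (intro that) auto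
qed

lemma hellinger_sq_mixtures_le:
  assumes w: "w \<in> weights K" and s: "\<forall>k\<in>{1..K}. 0 < \<sigma> k"
    and w': "w' \<in> weights K" and s': "\<forall>k\<in>{1..K}. 0 < \<sigma>' k"
    and h: "\<And>k. k \<in> {1..K} \<Longrightarrow> hellinger (gaussian (z k) (\<sigma> k)) (gaussian (z' k) (\<sigma>' k)) \<le> e"
  shows "hellinger_sq (density lborel (mixture_density K w z \<sigma>)) (density lborel (mixture_density K w' z' \<sigma>'))
    \<le> 1 / 2 * ((\<Sum>k=1..K. \<bar>w k - w' k\<bar>) + 3 * e)"
proof -
  define \<phi> where "\<phi> k = normal_density (z k) (\<sigma> k)" for k
  define \<psi> where "\<psi> k = normal_density (z' k) (\<sigma>' k)" for k
  have i: "integrable lborel (\<phi> k)" "integrable lborel (\<psi> k)" "(\<integral>x. \<phi> k x \<partial>lborel) = 1" if "k \<in> {1..K}" for k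
    using that s s' by (auto simp: \<phi>_def \<psi>_def)
  have w0: "0 \<le> w' k" if "k \<in> {1..K}" for k using w' that by (auto simp: weights_def)
  have L1: "(\<integral>x. \<bar>\<phi> k x - \<psi> k x\<bar> \<partial>lborel) \<le> 3 * e" if k: "k \<in> {1..K}" for k
  proof -
    have "0 < \<sigma> k" "0 < \<sigma>' k" using k s s' by auto
    then have "(\<integral>x. \<bar>\<phi> k x - \<psi> k x\<bar> \<partial>lborel) \<le> 3 * hellinger (density lborel (\<phi> k)) (density lborel (\<psi> k))"
      unfolding \<phi>_def \<psi>_def by (intro L1_le_hellinger prob_space_normal_density) auto
    also have "\<dots> \<le> 3 * e" using h[OF k] by (simp add: gaussian_def \<phi>_def \<psi>_def)
    finally show ?thesis .
  qed
  have "hellinger_sq (density lborel (mixture_density K w z \<sigma>)) (density lborel (mixture_density K w' z' \<sigma>'))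
      \<le> 1 / 2 * (\<integral>x. \<bar>mixture_density K w z \<sigma> x - mixture_density K w' z' \<sigma>' x\<bar> \<partial>lborel)"
    by (intro hellinger_sq_le_L1 mixture_density_nonneg mixture_density_prob w w' s s') auto
  also have "(\<integral>x. \<bar>mixture_density K w z \<sigma> x - mixture_density K w' z' \<sigma>' x\<bar> \<partial>lborel)
      \<le> (\<integral>x. (\<Sum>k=1..K. \<bar>w k - w' k\<bar> * \<phi> k x + w' k * \<bar>\<phi> k x - \<psi> k x\<bar>) \<partial>lborel)"
  proof (rule integral_mono)
    have "integrable lborel (mixture_density K w z \<sigma>)" "integrable lborel (mixture_density K w' z' \<sigma>')"
      using prob_density_integral(1)[OF _ mixture_density_nonneg[OF w] mixture_density_prob[OF w s]]
       prob_density_integral(1)[OF _ mixture_density_nonneg[OF w'] mixture_density_prob[OF w' s']] by auto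
    then show "integrable lborel (\<lambda>x. \<bar>mixture_density K w z \<sigma> x - mixture_density K w' z' \<sigma>' x\<bar>)" by auto
    show "integrable lborel (\<lambda>x. \<Sum>k=1..K. \<bar>w k - w' k\<bar> * \<phi> k x + w' k * \<bar>\<phi> k x - \<psi> k x\<bar>)"
      using i by (intro Bochner_Integration.integrable_sum Bochner_Integration.integrable_add integrable_mult_right integrable_abs
        Bochner_Integration.integrable_diff)
    fix x
    have "\<bar>mixture_density K w z \<sigma> x - mixture_density K w' z' \<sigma>' x\<bar> = \<bar>\<Sum>k=1..K. w k * \<phi> k x - w' k * \<psi> k x\<bar>"
      by (simp add: mixture_density_def \<phi>_def \<psi>_def sum_subtractf)
    also have "\<dots> \<le> (\<Sum>k=1..K. \<bar>w k * \<phi> k x - w' k * \<psi> k x\<bar>)" by (rule sum_abs)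
    also have "\<dots> \<le> (\<Sum>k=1..K. \<bar>w k - w' k\<bar> * \<phi> k x + w' k * \<bar>\<phi> k x - \<psi> k x\<bar>)"
    proof (rule sum_mono)
      fix k assume k: "k \<in> {1..K}"
      have "w k * \<phi> k x - w' k * \<psi> k x = (w k - w' k) * \<phi> k x + w' k * (\<phi> k x - \<psi> k x)"
        by (simp add: algebra_simps)
      also have "\<bar>\<dots>\<bar> \<le> \<bar>(w k - w' k) * \<phi> k x\<bar> + \<bar>w' k * (\<phi> k x - \<psi> k x)\<bar>" by (rule abs_triangle_ineq)
      finally show "\<bar>w k * \<phi> k x - w' k * \<psi> k x\<bar> \<le> \<bar>w k - w' k\<bar> * \<phi> k x + w' k * \<bar>\<phi> k x - \<psi> k x\<bar>"
        using w0[OF k] by (simp add: abs_mult \<phi>_def)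
    qed
    finally show "\<bar>mixture_density K w z \<sigma> x - mixture_density K w' z' \<sigma>' x\<bar>
      \<le> (\<Sum>k=1..K. \<bar>w k - w' k\<bar> * \<phi> k x + w' k * \<bar>\<phi> k x - \<psi> k x\<bar>)" .
  qed
  also have "\<dots> = (\<Sum>k=1..K. \<bar>w k - w' k\<bar> * 1 + w' k * (\<integral>x. \<bar>\<phi> k x - \<psi> k x\<bar> \<partial>lborel))"
    using i by (subst Bochner_Integration.integral_sum) (auto intro!: sum.cong)
  also have "\<dots> \<le> (\<Sum>k=1..K. \<bar>w k - w' k\<bar> * 1 + w' k * (3 * e))"
    by (intro sum_mono add_mono mult_left_mono order_refl L1 w0)
  also have "\<dots> = (\<Sum>k=1..K. \<bar>w k - w' k\<bar>) + (\<Sum>k=1..K. w' k) * (3 * e)"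
    by (simp add: sum.distrib sum_distrib_right)
  also have "(\<Sum>k=1..K. w' k) = 1" using w' by (simp add: weights_def)
  finally show ?thesis by simp
qed

lemma restricted_mixture_approximation:
  assumes D: "countable_dense_gaussians D" and K: "1 \<le> K" and w: "w \<in> weights K"
    and s: "\<forall>k\<in>{1..K}. 0 < \<sigma> k" and d: "0 < \<delta>" "2 * real K * \<delta> \<le> 1" and e: "0 < e"
  shows "\<exists>q\<in>restricted_mixture_densities D K \<delta>.
    hellinger_sq (density lborel (mixture_density K w z \<sigma>)) (density lborel q) \<le> 2 * real K * \<delta> + e"
proof -
  obtain w' where w': "w' \<in> weights K" "\<And>k. k \<in> {1..K} \<Longrightarrow> \<delta> \<le> w' k \<and> w' k \<in> \<rat>"
    "(\<Sum>k=1..K. \<bar>w k - w' k\<bar>) \<le> 4 * real K * \<delta>"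
    by (rule rational_weights[OF K w d]) (rule that)
  have "\<exists>zs. 0 < snd zs \<and> gaussian (fst zs) (snd zs) \<in> D \<and>
      hellinger (gaussian (z k) (\<sigma> k)) (gaussian (fst zs) (snd zs)) < 2 * e / 3" if k: "k \<in> {1..K}" for k
  proof -
    have "gaussian (z k) (\<sigma> k) \<in> gaussian_family" using bspec[OF s k] unfolding gaussian_family_def by blast
    then obtain Q where Q: "Q \<in> D" "hellinger (gaussian (z k) (\<sigma> k)) Q < 2 * e / 3"
      using D e unfolding countable_dense_gaussians_def
      by (metis divide_pos_pos mult_pos_pos zero_less_numeral)
    moreover obtain a b where "Q = gaussian a b" "0 < b"
      using Q D unfolding countable_dense_gaussians_def gaussian_family_def by blast
    ultimately show ?thesis by (intro exI[of _ "(a, b)"]) auto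
  qed
  then obtain zs where zs: "\<And>k. k \<in> {1..K} \<Longrightarrow> 0 < snd (zs k) \<and> gaussian (fst (zs k)) (snd (zs k)) \<in> D \<and>
      hellinger (gaussian (z k) (\<sigma> k)) (gaussian (fst (zs k)) (snd (zs k))) < 2 * e / 3" by metis
  define q where "q = mixture_density K w' (\<lambda>k. fst (zs k)) (\<lambda>k. snd (zs k))"
  have "q \<in> restricted_mixture_densities D K \<delta>"
    unfolding restricted_mixture_densities_def q_def using w' zs by blast
  moreover have "hellinger_sq (density lborel (mixture_density K w z \<sigma>)) (density lborel q)
      \<le> 1 / 2 * ((\<Sum>k=1..K. \<bar>w k - w' k\<bar>) + 3 * (2 * e / 3))"
    unfolding q_def using zs by (intro hellinger_sq_mixtures_le w s w') (auto intro: less_imp_le)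
  then have "hellinger_sq (density lborel (mixture_density K w z \<sigma>)) (density lborel q) \<le> 2 * real K * \<delta> + e"
    using w'(3) by simp
  ultimately show ?thesis by blast
qed

section \<open>The optimal number of components\<close>

definition rate :: "real \<Rightarrow> nat \<Rightarrow> real" where
  "rate \<beta> n = ln (real n) powr (5 * \<beta> / (2 * \<beta> + 1)) / real n powr (2 * \<beta> / (2 * \<beta> + 1))"

lemma rate_lower:
  assumes n: "2 \<le> n" and b: "0 < \<beta>"
  shows "1 / (8 * real n) \<le> rate \<beta> n"
proof -
  have l: "1 / 2 \<le> ln (real n)" by (rule half_le_ln[OF n])
  have "(1 / 8 :: real) = (1 / 2) powr 3" by (simp add: powr_numeral power_one_over)
  also have "\<dots> \<le> (1 / 2) powr (5 * \<beta> / (2 * \<beta> + 1))"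
    using b by (intro powr_mono') (auto simp: divide_simps)
  also have "\<dots> \<le> ln (real n) powr (5 * \<beta> / (2 * \<beta> + 1))"
    using l b by (intro powr_mono2) auto
  finally have 1: "1 / 8 \<le> ln (real n) powr (5 * \<beta> / (2 * \<beta> + 1))" .
  have "real n powr (2 * \<beta> / (2 * \<beta> + 1)) \<le> real n powr 1"
    using b n by (intro powr_mono) (auto simp: divide_simps)
  then have 2: "real n powr (2 * \<beta> / (2 * \<beta> + 1)) \<le> real n" using n by simp
  have "1 / 8 / real n \<le> rate \<beta> n" unfolding rate_def
    using 1 2 n by (intro frac_le) auto
  then show ?thesis by simp
qed

text \<open>With \<open>log K\<close> replaced by \<open>log n\<close>, the two errors are equal for \<open>K = (n (log n)\<^sup>3\<^sup>\<beta>\<^sup>-\<^sup>1)\<close> to the power \<open>1 / (2 \<beta> + 1)\<close>. Rounding this number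
up costs at most a factor 3, and it is \<open>o(n)\<close> uniformly over \<open>\<beta> \<ge> \<beta>l\<close>.\<close>

lemma optimal_components:
  assumes b: "0 < \<beta>l" "\<beta>l < \<beta>u"
  shows "\<exists>n0\<ge>3. \<forall>n\<ge>n0. \<forall>\<beta>\<in>{\<beta>l..\<beta>u}. \<exists>K\<in>{2..n}. 8 * K \<le> n \<and>
    ln (real K) powr (3 * \<beta>) / real K powr (2 * \<beta>) \<le> rate \<beta> n \<and>
    real K * ln (real n) / real n \<le> 3 * rate \<beta> n"
proof -
  define a where "a = 1 / (2 * \<beta>l + 1)"
  have a: "a < 1" using b by (simp add: a_def)
  have "((\<lambda>x::real. 24 * (x powr a * ln x powr (3 / 2)) / x) \<longlongrightarrow> 0) at_top"
    using a by real_asymp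
  then have "eventually (\<lambda>x::real. 24 * (x powr a * ln x powr (3 / 2)) / x < 1) at_top"
    by (rule order_tendstoD) simp
  then obtain x0 :: real where x0: "\<And>x. x0 \<le> x \<Longrightarrow> 24 * (x powr a * ln x powr (3 / 2)) / x < 1"
    by (auto simp: eventually_at_top_linorder)
  define n0 where "n0 = max 3 (nat \<lceil>x0\<rceil>)"
  have main: "\<exists>K\<in>{2..n}. 8 * K \<le> n \<and>
    ln (real K) powr (3 * \<beta>) / real K powr (2 * \<beta>) \<le> rate \<beta> n \<and>
    real K * ln (real n) / real n \<le> 3 * rate \<beta> n" if n: "n0 \<le> n" and \<beta>: "\<beta> \<in> {\<beta>l..\<beta>u}" for n \<beta>
  proof -
    define N L where "N = real n" and "L = ln N"
    have N: "3 \<le> N" "x0 \<le> N" using n unfolding n0_def N_def by linarith+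
    have b0: "0 < \<beta>" "\<beta>l \<le> \<beta>" using \<beta> b by auto
    have L: "1 \<le> L"
    proof -
      have "exp 1 \<le> N" using exp_le N by linarith
      then show ?thesis using N by (simp add: L_def ln_ge_iff)
    qed
    have LN: "L \<le> N" unfolding L_def using N ln_le_minus_one[of N] by simp
    define c where "c = 1 / (2 * \<beta> + 1)"
    define X where "X = N powr c * L powr ((3 * \<beta> - 1) * c)"
    have c: "0 < c" "c \<le> a" "c * (2 * \<beta> + 1) = 1" using b0 b by (auto simp: c_def a_def frac_le)
    have X1: "1 \<le> X"
    proof -
      have "1 \<le> N * L powr (3 * \<beta> - 1)"
      proof -
        have "1 \<le> N * (1 / L)" using LN L by simp
        also have "1 / L = L powr (- 1)" using L by (simp add: powr_minus_divide)
        also have "N * L powr (- 1) \<le> N * L powr (3 * \<beta> - 1)"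
          using L b0 N by (intro mult_left_mono powr_mono) auto
        finally show ?thesis .
      qed
      then have "1 powr c \<le> (N * L powr (3 * \<beta> - 1)) powr c" using c by (intro powr_mono2) auto
      also have "\<dots> = X" using N L by (simp add: X_def powr_mult powr_powr)
      finally show ?thesis by simp
    qed
    have XA: "X \<le> N powr a * L powr (3 / 2)"
      unfolding X_def
    proof (intro mult_mono powr_mono)
      show "(3 * \<beta> - 1) * c \<le> 3 / 2" using b0 by (simp add: c_def divide_simps)
    qed (use c N L in auto)
    have X8: "24 * X \<le> N"
    proof -
      have "24 * (N powr a * L powr (3 / 2)) < N" using x0[OF N(2)] N by (simp add: L_def divide_less_eq)
      then show ?thesis using XA by linarith
    qed
    \<comment> \<open>Adding 1 ensures \<open>K \<ge> 2\<close>.\<close>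
    define K where "K = nat \<lceil>X\<rceil> + 1"
    have rK: "real K = of_int \<lceil>X\<rceil> + 1" using X1 by (simp add: K_def)
    have K: "X \<le> real K" "real K \<le> X + 2" unfolding rK by linarith+
    have K3: "real K \<le> 3 * X" using K X1 by linarith
    have "8 * real K \<le> N" using K3 X8 by linarith
    then have K8: "8 * K \<le> n" unfolding N_def by linarith
    have K2: "2 \<le> K" using X1 rK by linarith
    have rate: "rate \<beta> n = L powr (5 * \<beta> * c) / N powr (2 * \<beta> * c)"
      by (simp add: rate_def L_def N_def c_def)
    have e1: "L powr (3 * \<beta>) / X powr (2 * \<beta>) = rate \<beta> n"
    proof -
      have "X powr (2 * \<beta>) = N powr (2 * \<beta> * c) * L powr ((3 * \<beta> - 1) * c * (2 * \<beta>))"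
        using N L by (simp add: X_def powr_mult powr_powr mult_ac)
      moreover have "L powr (3 * \<beta>) = L powr (5 * \<beta> * c) * L powr ((3 * \<beta> - 1) * c * (2 * \<beta>))"
      proof -
        have "5 * \<beta> * c + (3 * \<beta> - 1) * c * (2 * \<beta>) = 3 * \<beta> * (c * (2 * \<beta> + 1))"
          by (simp add: algebra_simps)
        then show ?thesis using c by (simp flip: powr_add)
      qed
      ultimately show ?thesis using L by (simp add: rate)
    qed
    have e2: "X * L / N = rate \<beta> n"
    proof -
      have "N powr (2 * \<beta> * c) * N powr c = N"
      proof -
        have "2 * \<beta> * c + c = 1" using c(3) by (simp add: algebra_simps)
        then show ?thesis using N by (simp flip: powr_add)
      qed
      moreover have "L powr ((3 * \<beta> - 1) * c) * L = L powr (5 * \<beta> * c)"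
      proof -
        have "(3 * \<beta> - 1) * c + 1 = 5 * \<beta> * c"
          using c(3) by (simp add: algebra_simps)
        then show ?thesis using L powr_add[of L "(3 * \<beta> - 1) * c" 1] by simp
      qed
      ultimately have "X * L * N powr (2 * \<beta> * c) = L powr (5 * \<beta> * c) * N"
        unfolding X_def by (metis mult.assoc mult.commute)
      then show ?thesis using N unfolding rate by (simp add: field_simps)
    qed
    have "ln (real K) powr (3 * \<beta>) / real K powr (2 * \<beta>) \<le> L powr (3 * \<beta>) / X powr (2 * \<beta>)"
    proof (rule frac_le)
      show "ln (real K) powr (3 * \<beta>) \<le> L powr (3 * \<beta>)"
        using K2 K8 b0 by (intro powr_mono2) (auto simp: L_def N_def)
      show "X powr (2 * \<beta>) \<le> real K powr (2 * \<beta>)" using K X1 b0 by (intro powr_mono2) auto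
    qed (use X1 in auto)
    moreover have "real K * L / N \<le> 3 * (X * L / N)"
    proof -
      have "real K * (L / N) \<le> (3 * X) * (L / N)" using K3 L N by (intro mult_right_mono) auto
      then show ?thesis by simp
    qed
    ultimately show ?thesis using K2 K8 unfolding e1 e2 by (intro bexI[of _ K]) (auto simp: L_def N_def)
  qed
  show ?thesis by (rule exI[of _ n0]) (use main in \<open>auto simp: n0_def\<close>)
qed

section \<open>The oracle inequality for penalized rho-estimators\<close>

lemma rho_psi_sqrt_ratio:
  assumes "0 < a" "0 \<le> b"
  shows "rho_psi (sqrt_ratio b a) = contrast a b"
proof -
  have s: "0 < sqrt a" "0 \<le> sqrt b" using assms by auto
  have "rho_psi (sqrt_ratio b a) = (sqrt b / sqrt a - 1) / (sqrt b / sqrt a + 1)"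
    using assms by (simp add: rho_psi_def sqrt_ratio_def real_sqrt_divide)
  also have "\<dots> = contrast a b"
    using s by (simp add: contrast_def divide_simps)
  finally show ?thesis .
qed

lemma rho_T_eq_contrast:
  assumes "\<And>x. 0 < q x" "\<And>x. 0 \<le> q' x"
  shows "rho_T n x q q' = (\<Sum>i=1..n. contrast (q (x i)) (q' (x i)))"
  unfolding rho_T_def using assms by (simp add: rho_psi_sqrt_ratio)

text \<open>The criterion of \<open>q\<close> is at least \<open>T q qb - pen qb + pen q = - T qb q - pen qb + pen q\<close>, and the
criterion of \<open>qb\<close> is at most \<open>A + pen qb\<close>. Both bounds only involve \<open>T qb\<close>, whose fluctuations are those of
a process indexed by a single density.\<close>

lemma rho_oracle_inequality:
  fixes h :: "(real \<Rightarrow> real) \<Rightarrow> real"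
  assumes pos: "\<And>q x. q \<in> \<Q> \<Longrightarrow> 0 < q x" and pen: "\<And>q. q \<in> \<Q> \<Longrightarrow> 0 \<le> pen q"
    and h: "\<And>q. q \<in> \<Q> \<Longrightarrow> 0 \<le> h q" and qb: "qb \<in> \<Q>"
    and dev: "\<And>q. q \<in> \<Q> \<Longrightarrow> rho_T n x qb q \<le> A - h q + pen q"
    and q: "q \<in> \<Q>" "rho_Upsilon n \<Q> pen x q < (INF q'\<in>\<Q>. rho_Upsilon n \<Q> pen x q') + s"
  shows "h q \<le> 2 * A + 2 * pen qb + s"
proof -
  define T where "T u v = rho_T n x u v" for u v
  have T: "T u v = (\<Sum>i=1..n. contrast (u (x i)) (v (x i)))" if "u \<in> \<Q>" "v \<in> \<Q>" for u v
    unfolding T_def using pos that by (intro rho_T_eq_contrast) (auto intro: less_imp_le)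
  have anti: "T u v = - T v u" if "u \<in> \<Q>" "v \<in> \<Q>" for u v
    unfolding T[OF that] T[OF that(2,1)] by (subst contrast_commute) (simp add: sum_negf)
  have Tn: "T u v \<le> real n" if "u \<in> \<Q>" "v \<in> \<Q>" for u v
  proof -
    have "contrast (u y) (v y) \<le> 1" for y
      using contrast_abs_le_1[of "u y" "v y"] pos[OF that(1), of y] pos[OF that(2), of y] by simp
    then show ?thesis unfolding T[OF that]
      using sum_bounded_above[of "{1..n}" "\<lambda>i. contrast (u (x i)) (v (x i))" 1] by simp
  qed
  define \<Upsilon> where "\<Upsilon> u = rho_Upsilon n \<Q> pen x u" for u
  have \<Upsilon>: "\<Upsilon> u = (SUP v\<in>\<Q>. T u v - pen v) + pen u" for u
    by (simp add: \<Upsilon>_def rho_Upsilon_def T_def)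
  have ub: "T u v - pen v \<le> (SUP v\<in>\<Q>. T u v - pen v)" if u: "u \<in> \<Q>" and v: "v \<in> \<Q>" for u v
  proof (rule cSUP_upper[OF v])
    show "bdd_above ((\<lambda>v. T u v - pen v) ` \<Q>)"
    proof (rule bdd_aboveI2)
      fix v assume v: "v \<in> \<Q>"
      show "T u v - pen v \<le> real n" using Tn[OF u v] pen[OF v] by linarith
    qed
  qed
  have \<Upsilon>0: "0 \<le> \<Upsilon> u" if u: "u \<in> \<Q>" for u
    using ub[OF u u] anti[OF u u] unfolding \<Upsilon> by linarith
  have "(INF q'\<in>\<Q>. \<Upsilon> q') \<le> \<Upsilon> qb"
    using \<Upsilon>0 by (intro cINF_lower[OF _ qb] bdd_belowI2[where m=0]) auto
  moreover have "\<Upsilon> qb \<le> A + pen qb"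
  proof -
    have "(SUP v\<in>\<Q>. T qb v - pen v) \<le> A"
    proof (rule cSUP_least)
      show "T qb v - pen v \<le> A" if "v \<in> \<Q>" for v
        using dev[OF that] h[OF that] unfolding T_def by linarith
    qed (use qb in auto)
    then show ?thesis unfolding \<Upsilon> by simp
  qed
  moreover have "\<Upsilon> q < (INF q'\<in>\<Q>. \<Upsilon> q') + s" using q(2) by (simp add: \<Upsilon>_def)
  moreover have "- (A - h q + pen q) - pen qb + pen q \<le> \<Upsilon> q"
    using ub[OF q(1) qb] anti[OF q(1) qb] dev[OF q(1)] unfolding \<Upsilon> T_def by linarith
  ultimately show ?thesis by linarith
qed

text \<open>A Gaussian distribution determines its continuous density, so a density in the model is
given by rational weights and elements of \<open>D\<close>.\<close>

lemma countable_model_densities: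
  assumes D: "D \<subseteq> gaussian_family" "countable D"
  shows "countable (model_densities D n)"
proof -
  \<comment> \<open>Continuity makes the choice unique on Gaussian distributions.\<close>
  define nd where "nd G = (SOME f :: real \<Rightarrow> real. continuous_on UNIV f \<and> (\<forall>x. 0 \<le> f x) \<and>
    density lborel (\<lambda>x. ennreal (f x)) = G)"
    for G :: "real measure"
  have cont: "continuous_on UNIV (normal_density z \<sigma>)" if "0 < \<sigma>" for z \<sigma>
    unfolding normal_density_def using that by (intro continuous_intros) auto
  have nd: "nd (gaussian z \<sigma>) = normal_density z \<sigma>" if s: "0 < \<sigma>" for z \<sigma>
  proof -
    let ?P = "\<lambda>f :: real \<Rightarrow> real. continuous_on UNIV f \<and> (\<forall>x. 0 \<le> f x) \<and>
      density lborel (\<lambda>x. ennreal (f x)) = gaussian z \<sigma>"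
    have P: "?P (normal_density z \<sigma>)" using cont[OF s] by (simp add: gaussian_def)
    have "?P (nd (gaussian z \<sigma>))" unfolding nd_def by (rule someI[of ?P, OF P])
    with P show ?thesis by (intro continuous_densities_unique) auto
  qed
  define F where "F K wG = (\<lambda>x::real. \<Sum>k=1..K. fst wG k * nd (snd wG k) x)"
    for K and wG :: "(nat \<Rightarrow> real) \<times> (nat \<Rightarrow> real measure)"
  have "model_densities D n \<subseteq> (\<Union>K\<in>{2..n}. F K ` (({1..K} \<rightarrow>\<^sub>E \<rat>) \<times> ({1..K} \<rightarrow>\<^sub>E D)))"
  proof
    fix q assume "q \<in> model_densities D n"
    then obtain K w z \<sigma> where K: "K \<in> {2..n}" and q: "q = mixture_density K w z \<sigma>"
      and k: "\<forall>k\<in>{1..K}. w k \<in> \<rat> \<and> 0 < \<sigma> k \<and> gaussian (z k) (\<sigma> k) \<in> D"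
      unfolding model_densities_def restricted_mixture_densities_def by blast
    have "q = F K (restrict w {1..K}, \<lambda>k\<in>{1..K}. gaussian (z k) (\<sigma> k))"
      unfolding q F_def mixture_density_def[abs_def] using k by (intro ext sum.cong) (auto simp: nd)
    moreover have "(restrict w {1..K}, \<lambda>k\<in>{1..K}. gaussian (z k) (\<sigma> k)) \<in> ({1..K} \<rightarrow>\<^sub>E \<rat>) \<times> ({1..K} \<rightarrow>\<^sub>E D)"
      using k by auto
    ultimately show "q \<in> (\<Union>K\<in>{2..n}. F K ` (({1..K} \<rightarrow>\<^sub>E \<rat>) \<times> ({1..K} \<rightarrow>\<^sub>E D)))" using K by blast
  qed
  moreover have "countable (\<Union>K\<in>{2..n}. F K ` (({1..K} \<rightarrow>\<^sub>E \<rat>) \<times> ({1..K} \<rightarrow>\<^sub>E D)))"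
    using D countable_rat by (intro countable_UN countable_image countable_SIGMA countable_PiE) auto
  ultimately show ?thesis by (rule countable_subset)
qed

lemma hellinger_closure_mono: "A \<subseteq> B \<Longrightarrow> hellinger_closure A \<subseteq> hellinger_closure B"
  unfolding hellinger_closure_def by blast

lemma gaussian_mixtures_nonempty: "1 \<le> K \<Longrightarrow> gaussian_mixtures K \<noteq> {}"
proof -
  assume K: "1 \<le> K"
  have "(\<lambda>k. 1 / real K) \<in> weights K" using K by (auto simp: weights_def)
  then have "density lborel (mixture_density K (\<lambda>k. 1 / real K) (\<lambda>k. 0) (\<lambda>k. 1)) \<in> gaussian_mixtures K"
    unfolding gaussian_mixtures_def by force
  then show ?thesis by blast
qed

lemma hellinger_sq_closure_le:
  assumes P: "prob_space P" "sets P = sets borel" and R: "R \<in> hellinger_closure A"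
    and A: "\<And>Q. Q \<in> A \<Longrightarrow> prob_space Q \<and> sets Q = sets borel \<and> hellinger_sq P Q \<le> B"
  shows "hellinger_sq P R \<le> 2 * B"
proof (rule field_le_epsilon)
  fix e :: real assume e: "0 < e"
  have Rp: "prob_space R" "sets R = sets borel"
    using R by (auto simp: hellinger_closure_def space_prob_algebra)
  have "0 < sqrt (e / 2)" using e by simp
  then obtain Q where Q: "Q \<in> A" "hellinger R Q < sqrt (e / 2)"
    using R unfolding hellinger_closure_def by blast
  note Qp = A[OF Q(1)]
  have "hellinger_sq Q R = hellinger_sq R Q" using Rp Qp by (intro hellinger_sq_commute) auto
  also have "\<dots> = (hellinger R Q)\<^sup>2" by (rule hellinger_power2[symmetric])
  also have "\<dots> \<le> (sqrt (e / 2))\<^sup>2" using Q(2) by (intro power_mono) auto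
  finally have QR: "hellinger_sq Q R \<le> e / 2" using e by simp
  have "hellinger_sq P R \<le> (1 + 1) * hellinger_sq P Q + (1 + 1 / 1) * hellinger_sq Q R"
    by (rule hellinger_sq_weighted_triangle) (use P Qp Rp in auto)
  then show "hellinger_sq P R \<le> 2 * B + e" using Qp QR by simp
qed

lemma rho_estimator_sublevel_measurable:
  assumes D: "countable_dense_gaussians D" and ne: "model_densities D n \<noteq> {}"
    and est: "rho_estimator n (model_densities D n) pen Phat"
    and P: "prob_space P" "sets P = sets borel" and t: "0 \<le> t"
  shows "{x \<in> space (\<Pi>\<^sub>M i\<in>{1..n}. P). hellinger_sq P (Phat x) \<le> t} \<in> sets (\<Pi>\<^sub>M i\<in>{1..n}. P)"
proof -
  define \<Q> where "\<Q> = model_densities D n"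
  have c: "countable \<Q>" unfolding \<Q>_def
    using D by (intro countable_model_densities) (auto simp: countable_dense_gaussians_def)
  have sP: "sets (\<Pi>\<^sub>M i\<in>{1..n}. P) = sets (\<Pi>\<^sub>M i\<in>{1..n}. (borel :: real measure))"
    by (intro sets_PiM_cong) (auto simp: P)
  have spP: "space (\<Pi>\<^sub>M i\<in>{1..n}. P) = space (\<Pi>\<^sub>M i\<in>{1..n}. (borel :: real measure))"
    using sP by (rule sets_eq_imp_space_eq)
  define q where "q j = from_nat_into \<Q> j" for j
  have range: "range q = \<Q>" unfolding q_def[abs_def] using ne c by (simp add: \<Q>_def range_from_nat_into)
  have qm: "\<exists>K w z \<sigma>. w \<in> weights K \<and> (\<forall>k\<in>{1..K}. 0 < \<sigma> k) \<and> u = mixture_density K w z \<sigma>"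
    if "u \<in> \<Q>" for u
    using that unfolding \<Q>_def model_densities_def restricted_mixture_densities_def by blast
  have qj: "q j \<in> borel_measurable borel \<and> (\<forall>x. 0 \<le> q j x) \<and> prob_space (density lborel (q j))" for j
  proof -
    have "q j \<in> \<Q>" using range by blast
    from qm[OF this] show ?thesis
      by (auto simp: mixture_density_nonneg mixture_density_prob)
  qed
  show ?thesis
  proof (rule hellinger_sublevel_measurable[of q])
    show "Phat \<in> (\<Pi>\<^sub>M i\<in>{1..n}. P) \<rightarrow>\<^sub>M prob_algebra borel"
      using est measurable_cong_sets[OF sP refl] unfolding rho_estimator_def by blast
    fix x assume "x \<in> space (\<Pi>\<^sub>M i\<in>{1..n}. P)"
    then have "Phat x \<in> hellinger_closure {density lborel u | u. u \<in> \<Q> \<and>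
          rho_Upsilon n \<Q> pen x u < (INF q'\<in>\<Q>. rho_Upsilon n \<Q> pen x q') + 8.24}"
      using est unfolding rho_estimator_def spP \<Q>_def by blast
    moreover have "{density lborel u | u. u \<in> \<Q> \<and>
          rho_Upsilon n \<Q> pen x u < (INF q'\<in>\<Q>. rho_Upsilon n \<Q> pen x q') + 8.24}
        \<subseteq> range (\<lambda>j. density lborel (q j))"
      using range by auto
    ultimately show "Phat x \<in> hellinger_closure (range (\<lambda>j. density lborel (q j)))"
      using hellinger_closure_mono by blast
  qed (use qj P t in auto)
qed

text \<open>The factor 2 in front of the bound pays for the passage from the near minimisers of
the criterion to their Hellinger closure.\<close>

lemma rho_estimator_risk_bound:
  fixes p :: "real \<Rightarrow> real" and M \<xi> :: real
  assumes n: "2 \<le> n" and M: "0 \<le> M" "M \<le> real n" and xi: "0 < \<xi>"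
    and D: "countable_dense_gaussians D"
    and est: "rho_estimator n (model_densities D n) (mixture_penalty n) Phat"
    and p: "probability_density p" "\<And>x. p x \<le> M * psi0 x"
    and K: "K \<in> {2..n}" and qb: "qb \<in> restricted_mixture_densities D K (mixture_delta n K)"
    and B: "2 * (320 * hellinger_sq (density lborel p) (density lborel qb)
      + 16 * 10 ^ 7 * (real K * ln (real n) / real n) + 66 / real n + 768 * \<xi> / real n) \<le> B"
  shows "1 - exp (- \<xi>) \<le> measure (\<Pi>\<^sub>M i\<in>{1..n}. density lborel p)
    {x \<in> space (\<Pi>\<^sub>M i\<in>{1..n}. density lborel p). hellinger_sq (density lborel p) (Phat x) \<le> B}"
proof -
  define P where "P = density lborel p"
  define \<Omega> where "\<Omega> = (\<Pi>\<^sub>M i\<in>{1..n}. P)"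
  define \<Q> where "\<Q> = model_densities D n"
  have pm: "p \<in> borel_measurable borel" "\<And>x. 0 \<le> p x" "(\<integral>\<^sup>+x. ennreal (p x) \<partial>lborel) = 1"
    using p(1) by (auto simp: probability_density_def)
  have P: "prob_space P" "sets P = sets borel"
    unfolding P_def using pm by (auto intro!: prob_spaceI simp: emeasure_density)
  interpret \<Omega>: prob_space \<Omega> unfolding \<Omega>_def by (rule prob_space_PiM) (rule P)
  have ln0: "0 \<le> ln (real n)" using n by simp
  have qbQ: "qb \<in> \<Q>" using qb K unfolding \<Q>_def model_densities_def by blast
  have mix: "\<exists>K w z \<sigma>. w \<in> weights K \<and> (\<forall>k\<in>{1..K}. 0 < \<sigma> k) \<and> u = mixture_density K w z \<sigma>"
    if "u \<in> \<Q>" for u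
    using that unfolding \<Q>_def model_densities_def restricted_mixture_densities_def by blast
  have Qp: "u \<in> borel_measurable borel" "0 < u x" "prob_space (density lborel u)" if "u \<in> \<Q>" for u x
    using mix[OF that] by (auto simp: mixture_density_pos mixture_density_prob)
  define hb where "hb = hellinger_sq P (density lborel qb)"
  obtain G where G: "G \<in> sets \<Omega>" "1 - exp (- \<xi>) \<le> measure \<Omega> G"
    and dev: "\<And>x K w z \<sigma>. x \<in> G \<Longrightarrow> K \<in> {2..n} \<Longrightarrow> w \<in> weights K \<Longrightarrow> \<forall>k\<in>{1..K}. 0 < \<sigma> k \<Longrightarrow>
      (\<Sum>i=1..n. contrast (qb (x i)) (mixture_density K w z \<sigma> (x i))) \<le>
        real n * (20 * hb - hellinger_sq P (density lborel (mixture_density K w z \<sigma>)) / 8)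
        + 10200 * real K * ln (real n) + 48 * \<xi>"
    using contrast_deviation[OF n M xi pm(1) Qp(1)[OF qbQ] pm(2) Qp(2)[OF qbQ] P(1)[unfolded P_def] Qp(3)[OF qbQ] p(2)]
    unfolding P_def[symmetric] \<Omega>_def[symmetric] hb_def[symmetric] by blast
  have B0: "0 \<le> B"
  proof -
    have "0 \<le> 2 * (320 * hb + 16 * 10 ^ 7 * (real K * ln (real n) / real n) + 66 / real n + 768 * \<xi> / real n)"
      using ln0 xi n by (auto intro!: add_nonneg_nonneg mult_nonneg_nonneg divide_nonneg_nonneg simp: hb_def)
    with B show ?thesis unfolding P_def[symmetric] hb_def by linarith
  qed
  have sub: "hellinger_sq P (Phat x) \<le> B" if x: "x \<in> G" for x
  proof -
    have xs: "x \<in> space \<Omega>" using x G(1) sets.sets_into_space by blast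
    have "sets \<Omega> = sets (\<Pi>\<^sub>M i\<in>{1..n}. (borel :: real measure))"
      unfolding \<Omega>_def by (intro sets_PiM_cong) (auto simp: P)
    then have xb: "x \<in> space (\<Pi>\<^sub>M i\<in>{1..n}. (borel :: real measure))"
      using xs sets_eq_imp_space_eq by blast
    have devQ: "rho_T n x qb u \<le> (20 * (real n * hb) + 48 * \<xi>)
        - real n * hellinger_sq P (density lborel u) / 8 + mixture_penalty n u"
      and pen0: "0 \<le> mixture_penalty n u" if u: "u \<in> \<Q>" for u
    proof -
      obtain K w z \<sigma> where u': "K \<in> {2..n}" "w \<in> weights K" "\<forall>k\<in>{1..K}. 0 < \<sigma> k"
        "u = mixture_density K w z \<sigma>" "10200 * real K * ln (real n) \<le> mixture_penalty n u"
        by (rule mixture_penalty_lower[OF n u[unfolded \<Q>_def]]) (rule that)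
      have "rho_T n x qb u = (\<Sum>i=1..n. contrast (qb (x i)) (u (x i)))"
        using Qp(2)[OF qbQ] Qp(2)[OF u] by (intro rho_T_eq_contrast) (auto intro: less_imp_le)
      also have "\<dots> \<le> real n * (20 * hb - hellinger_sq P (density lborel u) / 8)
          + 10200 * real K * ln (real n) + 48 * \<xi>"
        using dev[OF x u'(1-3), of z] unfolding u'(4)[symmetric] .
      also have "\<dots> \<le> real n * (20 * hb - hellinger_sq P (density lborel u) / 8) + mixture_penalty n u + 48 * \<xi>"
        using u'(5) by simp
      finally show "rho_T n x qb u \<le> (20 * (real n * hb) + 48 * \<xi>)
        - real n * hellinger_sq P (density lborel u) / 8 + mixture_penalty n u"
        by (simp add: algebra_simps)
      have "0 \<le> 10200 * real K * ln (real n)" using ln0 by simp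
      then show "0 \<le> mixture_penalty n u" using u'(5) by linarith
    qed
    have cl: "Phat x \<in> hellinger_closure {density lborel u | u. u \<in> \<Q> \<and>
        rho_Upsilon n \<Q> (mixture_penalty n) x u < (INF q'\<in>\<Q>. rho_Upsilon n \<Q> (mixture_penalty n) x q') + 8.24}"
      using est xb unfolding rho_estimator_def \<Q>_def by blast
    have near: "hellinger_sq P (density lborel u) \<le> B / 2"
      if u: "u \<in> \<Q>" "rho_Upsilon n \<Q> (mixture_penalty n) x u < (INF q'\<in>\<Q>. rho_Upsilon n \<Q> (mixture_penalty n) x q') + 8.24" for u
    proof -
      define H where "H = hellinger_sq P (density lborel u)"
      define a where "a = real K * ln (real n)"
      have pb: "mixture_penalty n qb \<le> 10 ^ 7 * a"
        using mixture_penalty_upper[OF n K qb] by (simp add: a_def mult.assoc)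
      have "real n * H / 8 \<le> 2 * (20 * (real n * hb) + 48 * \<xi>) + 2 * mixture_penalty n qb + 8.24"
        unfolding H_def
        by (rule rho_oracle_inequality[where \<Q> = \<Q> and pen = "mixture_penalty n" and n = n and x = x
              and h = "\<lambda>u. real n * hellinger_sq P (density lborel u) / 8"])
          (use Qp pen0 qbQ devQ u in auto)
      then have "real n * H \<le> 320 * (real n * hb) + 768 * \<xi> + 16 * (10 ^ 7 * a) + 66"
        using pb by simp
      then have "real n * H / real n \<le> (320 * (real n * hb) + 768 * \<xi> + 16 * (10 ^ 7 * a) + 66) / real n"
        by (rule divide_right_mono) simp
      also have "\<dots> = 320 * hb + 16 * 10 ^ 7 * (a / real n) + 66 / real n + 768 * \<xi> / real n"
        using n by (simp add: add_divide_distrib)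
      also have "\<dots> \<le> B / 2" using B unfolding P_def[symmetric] hb_def[symmetric] a_def by simp
      finally show ?thesis using n by (simp add: H_def)
    qed
    have "hellinger_sq P (Phat x) \<le> 2 * (B / 2)"
      by (rule hellinger_sq_closure_le[OF P cl]) (use near Qp in auto)
    then show ?thesis by simp
  qed
  have meas: "{x \<in> space \<Omega>. hellinger_sq P (Phat x) \<le> B} \<in> sets \<Omega>"
    unfolding \<Omega>_def using qbQ
    by (intro rho_estimator_sublevel_measurable[OF D _ est P B0]) (auto simp: \<Q>_def)
  have "measure \<Omega> G \<le> measure \<Omega> {x \<in> space \<Omega>. hellinger_sq P (Phat x) \<le> B}"
    using sub G(1) sets.sets_into_space[OF G(1)] by (intro \<Omega>.finite_measure_mono meas) blast+
  with G(2) show ?thesis unfolding \<Omega>_def P_def by linarith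
qed

theorem theorem11:
  fixes \<beta>l \<beta>u :: real and \<P> :: holder_params
  assumes "0 < \<beta>l" and "\<beta>l < \<beta>u"
    and "admissible_params \<beta>l \<beta>u \<P>"
  shows "\<exists>C>0. \<forall>n\<ge>2. \<forall>D Phat.
    countable_dense_gaussians D \<longrightarrow>
    rho_estimator n (model_densities D n) (mixture_penalty n) Phat \<longrightarrow>
    (\<forall>\<beta>\<in>{\<beta>l..\<beta>u}. \<forall>p\<in>holder_class \<beta> \<P>. \<forall>\<xi>>0.
      measure (\<Pi>\<^sub>M i\<in>{1..n}. density lborel p)
        {x \<in> space (\<Pi>\<^sub>M i\<in>{1..n}. density lborel p).
          hellinger_sq (density lborel p) (Phat x)
            \<le> C * (ln (real n) powr (5 * \<beta> / (2 * \<beta> + 1)) / real n powr (2 * \<beta> / (2 * \<beta> + 1))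
                   + \<xi> / real n)}
      \<ge> 1 - exp (- \<xi>))"
proof -
  obtain c where c: "0 < c" and approx: "\<And>\<beta> p K. \<beta> \<in> {\<beta>l..\<beta>u} \<Longrightarrow> p \<in> holder_class \<beta> \<P> \<Longrightarrow> 2 \<le> K \<Longrightarrow>
      hellinger_sq_set (density lborel p) (gaussian_mixtures K)
        \<le> c * (ln (real K) powr (3 * \<beta>) / real K powr (2 * \<beta>))"
    using assms(3) unfolding admissible_params_def by blast
  define M where "M = hp_M \<P>"
  have M: "0 < M" using assms(3) unfolding admissible_params_def positive_params_def M_def by blast
  obtain n0 where n0: "3 \<le> n0" and opt: "\<And>n \<beta>. n0 \<le> n \<Longrightarrow> \<beta> \<in> {\<beta>l..\<beta>u} \<Longrightarrow> \<exists>K\<in>{2..n}. 8 * K \<le> n \<and>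
    ln (real K) powr (3 * \<beta>) / real K powr (2 * \<beta>) \<le> rate \<beta> n \<and>
    real K * ln (real n) / real n \<le> 3 * rate \<beta> n"
    using optimal_components[OF assms(1,2)] by blast
  define n1 where "n1 = max n0 (nat \<lceil>M\<rceil>)"
  define C where "C = 2 * (640 * c + 5 * 10 ^ 8) + 8 * real n1"
  have C0: "0 < C" using c by (simp add: C_def add_pos_nonneg)
  have "1 - exp (- \<xi>) \<le> measure (\<Pi>\<^sub>M i\<in>{1..n}. density lborel p)
        {x \<in> space (\<Pi>\<^sub>M i\<in>{1..n}. density lborel p).
          hellinger_sq (density lborel p) (Phat x) \<le> C * (rate \<beta> n + \<xi> / real n)}"
    if n: "2 \<le> n" and D: "countable_dense_gaussians D"
      and est: "rho_estimator n (model_densities D n) (mixture_penalty n) Phat"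
      and \<beta>: "\<beta> \<in> {\<beta>l..\<beta>u}" and p: "p \<in> holder_class \<beta> \<P>" and xi: "0 < \<xi>" for n D Phat \<beta> p \<xi>
  proof -
    have b0: "0 < \<beta>" using \<beta> assms(1) by simp
    have pd: "probability_density p" and pM: "\<And>x. p x \<le> M * psi0 x"
      using p unfolding holder_class_def Let_def M_def by blast+
    have pm: "p \<in> borel_measurable borel" "\<And>x. 0 \<le> p x" "(\<integral>\<^sup>+x. ennreal (p x) \<partial>lborel) = 1"
      using pd by (auto simp: probability_density_def)
    have P: "prob_space (density lborel p)"
      using pm by (auto intro!: prob_spaceI simp: emeasure_density)
    interpret \<Omega>: prob_space "\<Pi>\<^sub>M i\<in>{1..n}. density lborel p" by (rule prob_space_PiM) (rule P)
    define r where "r = rate \<beta> n"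
    have r: "1 / (8 * real n) \<le> r" unfolding r_def by (rule rate_lower[OF n b0])
    then have r0: "0 < r" using n by (intro less_le_trans[OF _ r]) simp
    show ?thesis
    proof (cases "n1 \<le> n")
      case False
      \<comment> \<open>For small \<open>n\<close> the bound exceeds 1, which is the largest possible loss.\<close>
      have one: "1 \<le> C * (r + \<xi> / real n)"
      proof -
        have "1 = 8 * real n * (1 / (8 * real n))" using n by simp
        also have "\<dots> \<le> C * (r + \<xi> / real n)"
        proof (rule mult_mono)
          show "8 * real n \<le> C" using False c by (simp add: C_def)
          have "0 \<le> \<xi> / real n" using xi by simp
          with r show "1 / (8 * real n) \<le> r + \<xi> / real n" by linarith
        qed (use C0 in auto)
        finally show ?thesis .
      qed
      have "hellinger_sq (density lborel p) (Phat x) \<le> C * (r + \<xi> / real n)"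
        if "x \<in> space (\<Pi>\<^sub>M i\<in>{1..n}. density lborel p)" for x
      proof -
        have "Phat x \<in> space (prob_algebra borel)"
          using est that unfolding rho_estimator_def space_PiM by (auto dest: measurable_space simp: space_PiM)
        then have "hellinger_sq (density lborel p) (Phat x) \<le> 1"
          using P by (intro hellinger_sq_le_1) (auto simp: space_prob_algebra)
        with one show ?thesis by linarith
      qed
      then have all: "{x \<in> space (\<Pi>\<^sub>M i\<in>{1..n}. density lborel p).
          hellinger_sq (density lborel p) (Phat x) \<le> C * (r + \<xi> / real n)} = space (\<Pi>\<^sub>M i\<in>{1..n}. density lborel p)"
        by blast
      show ?thesis unfolding r_def[symmetric] all \<Omega>.prob_space by simp
    next
      case True
      then have nn: "n0 \<le> n" "M \<le> real n" unfolding n1_def by linarith+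
      obtain K where K: "K \<in> {2..n}" "8 * K \<le> n" "ln (real K) powr (3 * \<beta>) / real K powr (2 * \<beta>) \<le> r"
        "real K * ln (real n) / real n \<le> 3 * r"
        using opt[OF nn(1) \<beta>] unfolding r_def by blast
      have "hellinger_sq_set (density lborel p) (gaussian_mixtures K) \<le> c * r"
        using K(1) by (intro order_trans[OF approx[OF \<beta> p] mult_left_mono[OF K(3)]] less_imp_le[OF c]) auto
      also have "\<dots> < c * r + r" using r0 by simp
      finally have "Inf (hellinger_sq (density lborel p) ` gaussian_mixtures K) < c * r + r"
        unfolding hellinger_sq_set_def .
      then obtain Q where "Q \<in> gaussian_mixtures K" and PQ: "hellinger_sq (density lborel p) Q < c * r + r"
        using cInf_lessD[of "hellinger_sq (density lborel p) ` gaussian_mixtures K"] gaussian_mixtures_nonempty[of K] K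
        by auto
      then obtain w z \<sigma> where w: "w \<in> weights K" "\<forall>k\<in>{1..K}. 0 < \<sigma> k"
        and Q: "Q = density lborel (mixture_density K w z \<sigma>)" unfolding gaussian_mixtures_def by blast
      define \<delta> where "\<delta> = mixture_delta n K"
      have d: "0 < \<delta>" "\<delta> \<le> 4 / real n" using mixture_delta_bounds[of K n] K unfolding \<delta>_def by auto
      have Kn: "real K / real n \<le> 6 * r"
      proof -
        have "real K / real n * (1 / 2) \<le> real K / real n * ln (real n)"
          using half_le_ln[OF n] by (intro mult_left_mono) auto
        then show ?thesis using K(4) by simp
      qed
      have "2 * real K * \<delta> \<le> 2 * real K * (4 / real n)" using d by (intro mult_left_mono) auto
      also have "\<dots> = 8 * (real K / real n)" by simp
      finally have Kd: "2 * real K * \<delta> \<le> 8 * (real K / real n)" .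
      have "8 * (real K / real n) \<le> 1" using K(2) n by (simp add: divide_le_eq)
      with Kd have Kd1: "2 * real K * \<delta> \<le> 1" by linarith
      obtain qb where qb: "qb \<in> restricted_mixture_densities D K \<delta>"
        and Qqb: "hellinger_sq Q (density lborel qb) \<le> 2 * real K * \<delta> + r"
        using restricted_mixture_approximation[OF D _ w d(1) Kd1 r0, of z] K Q by auto
      have "prob_space Q" "sets Q = sets borel" unfolding Q using mixture_density_prob[OF w] by auto
      moreover have "prob_space (density lborel qb)"
        using qb mixture_density_prob unfolding restricted_mixture_densities_def by blast
      ultimately have "hellinger_sq (density lborel p) (density lborel qb) \<le>
          (1 + 1) * hellinger_sq (density lborel p) Q + (1 + 1 / 1) * hellinger_sq Q (density lborel qb)"
        using P by (intro hellinger_sq_weighted_triangle) auto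
      also have "\<dots> \<le> (2 * c + 100) * r" using PQ Qqb Kd Kn by (simp add: distrib_right)
      finally have Pqb: "hellinger_sq (density lborel p) (density lborel qb) \<le> (2 * c + 100) * r" .
      have r66: "66 / real n \<le> 528 * r" using r by simp
      have "2 * (320 * hellinger_sq (density lborel p) (density lborel qb)
          + 16 * 10 ^ 7 * (real K * ln (real n) / real n) + 66 / real n + 768 * \<xi> / real n)
        \<le> 2 * (320 * ((2 * c + 100) * r) + 16 * 10 ^ 7 * (3 * r) + 528 * r + 768 * \<xi> / real n)"
        using Pqb K(4) r66 by (intro mult_left_mono add_mono) auto
      also have "\<dots> = (1280 * c + 960065056) * r + 1536 * (\<xi> / real n)"
        by (simp add: algebra_simps)
      also have "\<dots> \<le> C * r + C * (\<xi> / real n)"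
        using r0 c xi by (intro add_mono mult_right_mono) (auto simp: C_def)
      also have "\<dots> = C * (r + \<xi> / real n)" by (simp add: distrib_left)
      finally have B: "2 * (320 * hellinger_sq (density lborel p) (density lborel qb)
          + 16 * 10 ^ 7 * (real K * ln (real n) / real n) + 66 / real n + 768 * \<xi> / real n)
        \<le> C * (r + \<xi> / real n)" .
      show ?thesis unfolding r_def[symmetric]
        by (rule rho_estimator_risk_bound[OF n _ nn(2) xi D est pd pM K(1) qb[unfolded \<delta>_def] B])
          (use M in simp)
    qed
  qed
  then show ?thesis using C0 unfolding rate_def by blast
qed

end
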